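(* Suppose that $\{S^{\tau(n)}_n:\mathcal{P}_n\to\mathcal{P}_n\}_{n=1}^\infty$ is a sequence of discrete maps that periodically approximates the flow $S^t:X\to X$ (in the sense defined in the context). Let $g\in L^2(X,\mathcal{M},\mu)$, $g_n=\mathcal{W}_ng$, $\alpha>0$, and let $$\rho_\alpha(\omega;g):=\int_{-\infty}^{\infty}\varphi_\alpha(\omega,\xi)\,\rho(\xi;g)\,\mathrm{d}\xi,\qquad \rho_{\alpha,n}(\omega;g_n):=\int_{-\infty}^{\infty}\varphi_\alpha(\omega,\xi)\,\rho_n(\xi;g_n)\,\mathrm{d}\xi,\qquad\omega\in\mathbb{R}.$$ Then $$\lim_{n\to\infty}\rho_{\alpha,n}(\omega;g_n)=\rho_\alpha(\omega;g)\quad\text{uniformly in }\omega\in\mathbb{R}.$$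
   Context: Setting. $X\subseteq\mathbb{R}^N$ is compact, with metric $d$ induced by a norm on $\mathbb{R}^N$. $S^t:X\to X$, $t\in\mathbb{R}$, is a flow: $S^t\circ S^s=S^{t+s}$ and $S^0=\mathrm{id}$. It is Lipschitz continuous: for every $T>0$ the map $(t,x)\mapsto S^t(x)$ is Lipschitz on $[-T,T]\times X$. $\mathcal{M}$ is the Borel sigma-algebra of $X$, and $\mu$ is a finite nonzero Borel measure on $X$, absolutely continuous with respect to Lebesgue measure, with $\operatorname{supp}\mu=X$, and invariant: $\mu(S^t(B))=\mu(B)$ for all $B\in\mathcal{M}$ and $t\in\mathbb{R}$. On $L^2(X,\mathcal{M},\mu)$ (complex-valued functions), $\langle g,h\rangle=\int_X g^*h\,\mathrm{d}\mu$, with norm $\|\cdot\|$. The Koopman unitary group is $\mathcal{U}^tg=g\circ S^t$. By the spectral theorem there is a unique projection-valued measure $\mathcal{S}$ on the Borel sets of $\mathbb{R}$ with $\mathcal{U}^tg=\int_{\mathbb{R}}e^{i\omega t}\,\mathrm{d}\mathcal{S}_\omega g$ for all $t\in\mathbb{R}$. Time steps. $\{\tau(n)\}_{n\ge1}$ is a monotonically decreasing sequence of positive reals converging to $0$, and $\xi_n(s)=\operatorname{sign}(s)\lceil |s|/\tau(n)\rceil\tau(n)$ for $s\in\mathbb{R}$. Partitions. $\mathcal{P}_n=\{p_{n,1},\dots,p_{n,q(n)}\}$, $n\ge1$, are measurable partitions of $X$ (the elements cover $X$ and distinct elements overlap only in $\mu$-null sets) such that: (i) each $p_{n,j}$ is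 compact and connected, and $\mu(p_{n,j})=\mu(X)/q(n)$, where $q:\mathbb{N}\to\mathbb{N}$ is strictly increasing; (ii) $\operatorname{diam}(p_{n,j})\le l(n)$, where $l$ is positive, monotone, and tends to $0$; (iii) for $n>m$, each $p_{m,j}$ is a union of elements of $\mathcal{P}_n$. Discrete maps. $S_n^{\tau(n)}:\mathcal{P}_n\to\mathcal{P}_n$ is a bijection of the finite set $\mathcal{P}_n$. For $k\in\mathbb{Z}$, $S_n^{k\tau(n)}$ is its $k$-th iterate, acting elementwise on unions of elements of $\mathcal{P}_n$ (viewed as subsets of $X$). For $A\subseteq X$, $A_n:=\bigcup\{p\in\mathcal{P}_n:p\cap A\ne\emptyset\}$. The sequence $\{S_n^{\tau(n)}\}$ periodically approximates $S^t$ if $$\lim_{n\to\infty}\int_{-t}^{t}d_H\left(S^s(A),S_n^{\xi_n(s)}(A_n)\right)\mathrm{d}s=0$$ for every $t\in\mathbb{R}$ and every nonempty compact $A\subseteq X$, where $d_H$ is the Hausdorff distance. Discrete Koopman operators and spectra. $L^2_n(X,\mathcal{M},\mu)$ is the span of the indicator functions $\chi_{p_{n,j}}$, $j=1,\dots,q(n)$. The averaging operator is $\mathcal{W}_ng=g_n=\sum_{j=1}^{q(n)}g_{n,j}\chi_{p_{n,j}}$ with $g_{n,j}=\frac{q(n)}{\mu(X)}\int_X g\,\chi_{p_{n,j}}\,\mathrm{d}\mu$. For $k\in\mathbb{Z}$, $\mathcal{U}_n^{k\tau(n)}g_n=\sum_{j}g_{n,j}\,\chi_{S_n^{-k\tau(n)}(p_{n,j})}$,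 a unitary (permutation) operator on $L^2_n(X,\mathcal{M},\mu)$. Let $v_{n,1},\dots,v_{n,q(n)}$ be an orthonormal basis of $L_n^2(X,\mathcal{M},\mu)$ of eigenfunctions, $\mathcal{U}_n^{\tau(n)}v_{n,k}=e^{i\theta_{n,k}}v_{n,k}$ with $\theta_{n,k}\in[-\pi,\pi)$, and put $\omega_{n,k}=\theta_{n,k}/\tau(n)$. $\mathcal{S}^{\tau(n)}_{n,\omega_{n,k}}g_n=v_{n,k}\langle v_{n,k},g_n\rangle$ is the rank-one projector attached to index $k$. Spectral densities. The spectral density $\rho(\cdot;g)$ is the distributional derivative of $c(\omega;g)=\langle\mathcal{S}_{(-\infty,\omega)}g,g\rangle$, i.e. $\int_{\mathbb{R}}\varphi'(\omega)c(\omega;g)\,\mathrm{d}\omega=-\int_{\mathbb{R}}\varphi(\omega)\rho(\omega;g)\,\mathrm{d}\omega$ for all Schwartz functions $\varphi$ on $\mathbb{R}$. Its discrete analogue is $\rho_n(\omega;g_n)=\sum_{k=1}^{q(n)}\|\mathcal{S}^{\tau(n)}_{n,\omega_{n,k}}g_n\|^2\,\delta(\omega-\omega_{n,k})$. Integrals against $\rho$ and $\rho_n$ are distributional pairings. Kernel. For $\alpha>0$, $\varphi_\alpha(x,y)=\frac{K}{\alpha}\exp\left(\frac{-1}{1-(|x-y|/\alpha)^2}\right)$ if $|x-y|<\alpha$ and $\varphi_\alpha(x,y)=0$ otherwise, where $K=\left(\int_{-1}^1\exp\left(\frac{-1}{1-x^2}\right)\mathrm{d}x\right)^{-1}$. 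*)

theory Defs
  imports "HOL-Analysis.Analysis"
begin

section \<open>Metric notions\<close>

definition is_norm :: "('a::real_vector \<Rightarrow> real) \<Rightarrow> bool" where
  "is_norm N \<longleftrightarrow>
     (\<forall>x. N x = 0 \<longleftrightarrow> x = 0) \<and>
     (\<forall>c x. N (c *\<^sub>R x) = \<bar>c\<bar> * N x) \<and>
     (\<forall>x y. N (x + y) \<le> N x + N y)"

definition norm_induced :: "('a::real_vector \<Rightarrow> 'a \<Rightarrow> real) \<Rightarrow> bool" where
  "norm_induced d \<longleftrightarrow> (\<exists>N. is_norm N \<and> (\<forall>x y. d x y = N (x - y)))"

text \<open>Only used for nonempty bounded sets; otherwise the suprema and infima are unspecified.\<close>

definition hausdorff_distance :: "('a \<Rightarrow> 'a \<Rightarrow> real) \<Rightarrow> 'a set \<Rightarrow> 'a set \<Rightarrow> real" where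
  "hausdorff_distance d A B =
     max (SUP a\<in>A. INF b\<in>B. d a b) (SUP b\<in>B. INF a\<in>A. d a b)"

section \<open>The flow and the invariant measure\<close>

definition lipschitz_flow ::
  "('a \<Rightarrow> 'a \<Rightarrow> real) \<Rightarrow> 'a set \<Rightarrow> (real \<Rightarrow> 'a \<Rightarrow> 'a) \<Rightarrow> bool" where
  "lipschitz_flow d X S \<longleftrightarrow>
     (\<forall>t. \<forall>x\<in>X. S t x \<in> X) \<and>
     (\<forall>t s. \<forall>x\<in>X. S t (S s x) = S (t + s) x) \<and>
     (\<forall>x\<in>X. S 0 x = x) \<and>
     (\<forall>T>0. \<exists>L. \<forall>s\<in>{-T..T}. \<forall>t\<in>{-T..T}. \<forall>x\<in>X. \<forall>y\<in>X.
        d (S s x) (S t y) \<le> L * prod_dist dist d (s, x) (t, y))"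

definition measure_support :: "'a::topological_space measure \<Rightarrow> 'a set" where
  "measure_support M = {x. \<forall>U. open U \<longrightarrow> x \<in> U \<longrightarrow> emeasure M (U \<inter> space M) > 0}"

definition reference_measure :: "'a::euclidean_space set \<Rightarrow> 'a measure \<Rightarrow> bool" where
  "reference_measure X M \<longleftrightarrow>
     space M = X \<and> sets M = sets (restrict_space borel X) \<and>
     finite_measure M \<and> emeasure M X \<noteq> 0 \<and>
     absolutely_continuous (restrict_space lborel X) M \<and>
     measure_support M = X"

definition flow_invariant :: "'a measure \<Rightarrow> (real \<Rightarrow> 'a \<Rightarrow> 'a) \<Rightarrow> bool" where
  "flow_invariant M S \<longleftrightarrow> (\<forall>t. \<forall>B\<in>sets M. emeasure M (S t ` B) = emeasure M B)"

section \<open>Square-integrable functions\<close>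

text \<open>Elements of the Hilbert space are represented by functions; equality in the Hilbert
  space is equality almost everywhere. The inner product is conjugate-linear in its first
  argument.\<close>

definition L2 :: "'a measure \<Rightarrow> ('a \<Rightarrow> complex) set" where
  "L2 M = {g \<in> borel_measurable M. integrable M (\<lambda>x. (cmod (g x))\<^sup>2)}"

definition inner_L2 :: "'a measure \<Rightarrow> ('a \<Rightarrow> complex) \<Rightarrow> ('a \<Rightarrow> complex) \<Rightarrow> complex" where
  "inner_L2 M g h = (LINT x|M. cnj (g x) * h x)"

definition norm_L2 :: "'a measure \<Rightarrow> ('a \<Rightarrow> complex) \<Rightarrow> real" where
  "norm_L2 M g = sqrt (LINT x|M. (cmod (g x))\<^sup>2)"

definition koopman :: "(real \<Rightarrow> 'a \<Rightarrow> 'a) \<Rightarrow> real \<Rightarrow> ('a \<Rightarrow> complex) \<Rightarrow> 'a \<Rightarrow> complex" where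
  "koopman S t g = g \<circ> S t"

section \<open>Projection-valued measures\<close>

definition projection_valued_measure ::
  "'a measure \<Rightarrow> (real set \<Rightarrow> ('a \<Rightarrow> complex) \<Rightarrow> 'a \<Rightarrow> complex) \<Rightarrow> bool" where
  "projection_valued_measure M E \<longleftrightarrow>
     \<comment> \<open>each \<open>E B\<close> is a linear operator, well defined on classes of almost equal functions\<close>
     (\<forall>B\<in>sets borel. \<forall>g\<in>L2 M. E B g \<in> L2 M) \<and>
     (\<forall>B\<in>sets borel. \<forall>g\<in>L2 M. \<forall>h\<in>L2 M.
        (AE x in M. g x = h x) \<longrightarrow> (AE x in M. E B g x = E B h x)) \<and>
     (\<forall>B\<in>sets borel. \<forall>g\<in>L2 M. \<forall>h\<in>L2 M. \<forall>a b.
        AE x in M. E B (\<lambda>y. a * g y + b * h y) x = a * E B g x + b * E B h x) \<and>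
     \<comment> \<open>each \<open>E B\<close> is an orthogonal projection\<close>
     (\<forall>B\<in>sets borel. \<forall>g\<in>L2 M. \<forall>h\<in>L2 M. inner_L2 M (E B g) h = inner_L2 M g (E B h)) \<and>
     (\<forall>B\<in>sets borel. \<forall>g\<in>L2 M. AE x in M. E B (E B g) x = E B g x) \<and>
     \<comment> \<open>normalisation, multiplicativity and strong countable additivity\<close>
     (\<forall>g\<in>L2 M. AE x in M. E {} g x = 0) \<and>
     (\<forall>g\<in>L2 M. AE x in M. E UNIV g x = g x) \<and>
     (\<forall>A\<in>sets borel. \<forall>B\<in>sets borel. \<forall>g\<in>L2 M. AE x in M. E (A \<inter> B) g x = E A (E B g) x) \<and>
     (\<forall>B :: nat \<Rightarrow> real set. range B \<subseteq> sets borel \<longrightarrow> disjoint_family B \<longrightarrow>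
        (\<forall>g\<in>L2 M. (\<lambda>n. norm_L2 M (\<lambda>x. (\<Sum>i<n. E (B i) g x) - E (\<Union>i. B i) g x))
           \<longlonglongrightarrow> 0))"

text \<open>For a bounded Borel function \<open>f\<close>, the relation \<open>has_pvm_integral M E f g h\<close> says that
  \<open>h\<close> is the integral of \<open>f\<close> with respect to the vector-valued measure \<open>B \<mapsto> E B g\<close>: it is
  the limit in mean square of the integrals of simple functions converging uniformly to \<open>f\<close>.\<close>

definition simple_pvm_integral ::
  "(real set \<Rightarrow> ('a \<Rightarrow> complex) \<Rightarrow> 'a \<Rightarrow> complex) \<Rightarrow> (real \<Rightarrow> complex) \<Rightarrow>
     ('a \<Rightarrow> complex) \<Rightarrow> 'a \<Rightarrow> complex" where
  "simple_pvm_integral E s g = (\<lambda>x. \<Sum>z\<in>range s. z * E (s -` {z}) g x)"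

definition has_pvm_integral ::
  "'a measure \<Rightarrow> (real set \<Rightarrow> ('a \<Rightarrow> complex) \<Rightarrow> 'a \<Rightarrow> complex) \<Rightarrow> (real \<Rightarrow> complex) \<Rightarrow>
     ('a \<Rightarrow> complex) \<Rightarrow> ('a \<Rightarrow> complex) \<Rightarrow> bool" where
  "has_pvm_integral M E f g h \<longleftrightarrow>
     (\<forall>s. (\<forall>k::nat. simple_function borel (s k)) \<longrightarrow> uniform_limit UNIV s f sequentially \<longrightarrow>
        (\<lambda>k. norm_L2 M (\<lambda>x. simple_pvm_integral E (s k) g x - h x)) \<longlonglongrightarrow> 0)"

definition koopman_spectral_measure ::
  "'a measure \<Rightarrow> (real \<Rightarrow> 'a \<Rightarrow> 'a) \<Rightarrow> (real set \<Rightarrow> ('a \<Rightarrow> complex) \<Rightarrow> 'a \<Rightarrow> complex) \<Rightarrow> bool" where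
  "koopman_spectral_measure M S E \<longleftrightarrow>
     projection_valued_measure M E \<and>
     (\<forall>t. \<forall>g\<in>L2 M. has_pvm_integral M E (\<lambda>\<omega>. exp (\<i> * of_real (\<omega> * t))) g (koopman S t g))"

section \<open>Partitions and discrete maps\<close>

definition partition_sequence ::
  "('a::euclidean_space \<Rightarrow> 'a \<Rightarrow> real) \<Rightarrow> 'a set \<Rightarrow> 'a measure \<Rightarrow> (nat \<Rightarrow> nat) \<Rightarrow> (nat \<Rightarrow> real) \<Rightarrow>
     (nat \<Rightarrow> 'a set set) \<Rightarrow> bool" where
  "partition_sequence d X M q l P \<longleftrightarrow>
     strict_mono_on {1..} q \<and>
     (\<forall>n\<ge>1. l n > 0) \<and> antimono_on {1..} l \<and> l \<longlonglongrightarrow> 0 \<and>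
     (\<forall>n\<ge>1. finite (P n) \<and> card (P n) = q n \<and> P n \<subseteq> sets M \<and> \<Union>(P n) = X) \<and>
     (\<forall>n\<ge>1. \<forall>p\<in>P n. \<forall>p'\<in>P n. p \<noteq> p' \<longrightarrow> p \<inter> p' \<in> null_sets M) \<and>
     (\<forall>n\<ge>1. \<forall>p\<in>P n. compact p \<and> connected p \<and> measure M p = measure M X / real (q n)) \<and>
     (\<forall>n\<ge>1. \<forall>p\<in>P n. \<forall>x\<in>p. \<forall>y\<in>p. d x y \<le> l n) \<and>
     (\<forall>m\<ge>1. \<forall>n>m. \<forall>p\<in>P m. \<exists>F\<subseteq>P n. p = \<Union>F)"

definition int_iterate :: "'b set \<Rightarrow> ('b \<Rightarrow> 'b) \<Rightarrow> int \<Rightarrow> 'b \<Rightarrow> 'b" where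
  "int_iterate P f k = (if k \<ge> 0 then f ^^ nat k else inv_into P f ^^ nat (- k))"

text \<open>The elementwise action on a union of cells. Since cells have positive measure and
  overlap in null sets only, the cells contained in a union of cells are exactly its
  constituents.\<close>

definition act_on_union :: "'a set set \<Rightarrow> ('a set \<Rightarrow> 'a set) \<Rightarrow> int \<Rightarrow> 'a set \<Rightarrow> 'a set" where
  "act_on_union P f k A = \<Union>(int_iterate P f k ` {p \<in> P. p \<subseteq> A})"

definition cell_hull :: "'a set set \<Rightarrow> 'a set \<Rightarrow> 'a set" where
  "cell_hull P A = \<Union>{p \<in> P. p \<inter> A \<noteq> {}}"

text \<open>The signed number of steps of length \<open>h\<close>, so that the discretised time
  \<open>sign(s) \<lceil>\<bar>s\<bar>/h\<rceil> h\<close> equals \<open>step_count h s\<close> times \<open>h\<close>.\<close>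

definition step_count :: "real \<Rightarrow> real \<Rightarrow> int" where
  "step_count h s = (if s < 0 then - \<lceil>\<bar>s\<bar> / h\<rceil> else \<lceil>\<bar>s\<bar> / h\<rceil>)"

definition periodically_approximates ::
  "('a::euclidean_space \<Rightarrow> 'a \<Rightarrow> real) \<Rightarrow> 'a set \<Rightarrow> (real \<Rightarrow> 'a \<Rightarrow> 'a) \<Rightarrow> (nat \<Rightarrow> real) \<Rightarrow>
     (nat \<Rightarrow> 'a set set) \<Rightarrow> (nat \<Rightarrow> 'a set \<Rightarrow> 'a set) \<Rightarrow> bool" where
  "periodically_approximates d X S \<tau> P f \<longleftrightarrow>
     (\<forall>t::real. \<forall>A. compact A \<and> A \<noteq> {} \<and> A \<subseteq> X \<longrightarrow>
        (\<lambda>n. LBINT s=-t..t. hausdorff_distance d (S s ` A)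
               (act_on_union (P n) (f n) (step_count (\<tau> n) s) (cell_hull (P n) A)))
          \<longlonglongrightarrow> 0)"

section \<open>Discrete Koopman operators\<close>

text \<open>In the following definitions \<open>m\<close> is the number of cells of the partition \<open>P\<close>.\<close>

definition cell_average :: "'a measure \<Rightarrow> nat \<Rightarrow> ('a \<Rightarrow> complex) \<Rightarrow> 'a set \<Rightarrow> complex" where
  "cell_average M m g p =
     of_real (real m / measure M (space M)) * (LINT x|M. g x * indicator p x)"

definition averaging ::
  "'a measure \<Rightarrow> nat \<Rightarrow> 'a set set \<Rightarrow> ('a \<Rightarrow> complex) \<Rightarrow> 'a \<Rightarrow> complex" where
  "averaging M m P g = (\<lambda>x. \<Sum>p\<in>P. cell_average M m g p * indicator p x)"

definition cell_space :: "'a measure \<Rightarrow> 'a set set \<Rightarrow> ('a \<Rightarrow> complex) set" where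
  "cell_space M P = {g \<in> L2 M. \<exists>c. AE x in M. g x = (\<Sum>p\<in>P. c p * indicator p x)}"

text \<open>For \<open>g \<in> cell_space M P\<close> the coefficients of \<open>g\<close> in the indicator functions are its
  cell averages.\<close>

definition discrete_koopman ::
  "'a measure \<Rightarrow> nat \<Rightarrow> 'a set set \<Rightarrow> ('a set \<Rightarrow> 'a set) \<Rightarrow> int \<Rightarrow> ('a \<Rightarrow> complex) \<Rightarrow>
     'a \<Rightarrow> complex" where
  "discrete_koopman M m P f k g =
     (\<lambda>x. \<Sum>p\<in>P. cell_average M m g p * indicator (int_iterate P f (- k) p) x)"

definition orthonormal_basis ::
  "'a measure \<Rightarrow> 'a set set \<Rightarrow> nat \<Rightarrow> (nat \<Rightarrow> 'a \<Rightarrow> complex) \<Rightarrow> bool" where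
  "orthonormal_basis M P m v \<longleftrightarrow>
     (\<forall>k\<in>{1..m}. v k \<in> cell_space M P) \<and>
     (\<forall>j\<in>{1..m}. \<forall>k\<in>{1..m}. inner_L2 M (v j) (v k) = (if j = k then 1 else 0)) \<and>
     (\<forall>g\<in>cell_space M P. \<exists>c. AE x in M. g x = (\<Sum>k=1..m. c k * v k x))"

definition discrete_eigenbasis ::
  "'a measure \<Rightarrow> nat \<Rightarrow> 'a set set \<Rightarrow> ('a set \<Rightarrow> 'a set) \<Rightarrow> (nat \<Rightarrow> 'a \<Rightarrow> complex) \<Rightarrow>
     (nat \<Rightarrow> real) \<Rightarrow> bool" where
  "discrete_eigenbasis M m P f v \<theta> \<longleftrightarrow>
     orthonormal_basis M P m v \<and>
     (\<forall>k\<in>{1..m}. \<theta> k \<in> {-pi..<pi} \<and>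
        (AE x in M. discrete_koopman M m P f 1 (v k) x = exp (\<i> * of_real (\<theta> k)) * v k x))"

definition rank_one_projector ::
  "'a measure \<Rightarrow> ('a \<Rightarrow> complex) \<Rightarrow> ('a \<Rightarrow> complex) \<Rightarrow> 'a \<Rightarrow> complex" where
  "rank_one_projector M u g = (\<lambda>x. u x * inner_L2 M u g)"

section \<open>Spectral densities\<close>

text \<open>A distribution on the real line is represented by its pairing with test functions; the
  values are meaningful at Schwartz functions.\<close>

type_synonym distribution = "(real \<Rightarrow> complex) \<Rightarrow> complex"

definition distributional_derivative :: "(real \<Rightarrow> complex) \<Rightarrow> distribution" where
  "distributional_derivative c \<phi> = - (LINT \<omega>|lborel. vector_derivative \<phi> (at \<omega>) * c \<omega>)"

definition delta :: "real \<Rightarrow> distribution" where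
  "delta a \<phi> = \<phi> a"

definition spectral_density ::
  "'a measure \<Rightarrow> (real set \<Rightarrow> ('a \<Rightarrow> complex) \<Rightarrow> 'a \<Rightarrow> complex) \<Rightarrow> ('a \<Rightarrow> complex) \<Rightarrow>
     distribution" where
  "spectral_density M E g = distributional_derivative (\<lambda>\<omega>. inner_L2 M (E {..<\<omega>} g) g)"

definition discrete_spectral_density ::
  "'a measure \<Rightarrow> nat \<Rightarrow> (nat \<Rightarrow> 'a \<Rightarrow> complex) \<Rightarrow> (nat \<Rightarrow> real) \<Rightarrow> ('a \<Rightarrow> complex) \<Rightarrow>
     distribution" where
  "discrete_spectral_density M m v w g \<phi> =
     (\<Sum>k=1..m. of_real ((norm_L2 M (rank_one_projector M (v k) g))\<^sup>2) * delta (w k) \<phi>)"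

definition bump_constant :: real where
  "bump_constant = inverse (LBINT x=-1..1. exp (- 1 / (1 - x\<^sup>2)))"

definition bump_kernel :: "real \<Rightarrow> real \<Rightarrow> real \<Rightarrow> real" where
  "bump_kernel \<alpha> x y =
     (if \<bar>x - y\<bar> < \<alpha> then bump_constant / \<alpha> * exp (- 1 / (1 - (\<bar>x - y\<bar> / \<alpha>)\<^sup>2)) else 0)"

definition smoothed :: "real \<Rightarrow> distribution \<Rightarrow> real \<Rightarrow> complex" where
  "smoothed \<alpha> \<rho> \<omega> = \<rho> (\<lambda>\<xi>. of_real (bump_kernel \<alpha> \<omega> \<xi>))"

end

theory Submission
  imports Defs "HOL-Probability.Probability" "HOL-Real_Asymp.Real_Asymp"
begin

text \<open>
  Both smoothed densities are convolutions of the smooth kernel with finite measures on the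
  frequency axis: the spectral measure \<open>\<nu>(B) = \<langle>E B g, g\<rangle>\<close> and the atomic measures \<open>\<nu>\<^sub>n\<close> with masses
  \<open>\<parallel>\<S>\<^sub>n g\<^sub>n\<parallel>\<^sup>2\<close> at the discrete frequencies. Weak convergence \<open>\<nu>\<^sub>n \<rightarrow> \<nu>\<close> suffices, because by
  Skorohod's theorem it yields uniform convergence of convolutions with a bounded Lipschitz function.

  The Fourier transform of \<open>\<nu>\<close> is \<open>\<langle>g, \<U>\<^sup>t g\<rangle>\<close>; that of \<open>\<nu>\<^sub>n\<close>, sampled at multiples of \<open>\<tau>(n)\<close>, is
  \<open>\<langle>g\<^sub>n, \<U>\<^sub>n\<^sup>t g\<^sub>n\<rangle>\<close>. For the indicator of a compact set, Hausdorff convergence of the images together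
  with equality of their measures gives mean square convergence of the indicators, so the sampled
  transforms converge in \<open>L\<^sup>1\<close> on bounded time intervals; by density of such functions this holds for every \<open>g\<close>.

  Sampling leaves the frequencies up to \<open>\<pi>/\<tau>(n)\<close> uncontrolled, so tightness of \<open>\<nu>\<^sub>n\<close> is obtained from a
  discrete form of Levy's truncation inequality (a geometric sum). Helly's selection theorem and
  uniqueness of the characteristic function then identify the limit.
\<close>

section \<open>Sampled characteristic functions and weak convergence\<close>

text \<open>Levy's continuity theorem does not apply as it stands: the transform of the atomic
  measures has a dynamical meaning only at integer multiples of the time step, and the hypothesis on
  Hausdorff distances gives convergence only in mean over time, not at individual times. Tightness
  therefore has to come from the sampled values alone. This is possible because the discrete
  frequencies lie within a single period of the sampled exponentials, so that no high frequency can
  pose as a low one. The weakness of convergence in mean is repaired once a limit measure is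
  available: its transform is continuous, and continuous functions at distance zero in the mean
  coincide. Uniformity over all frequencies then costs nothing, because the error of the coupled
  variables does not see the centre of the kernel. The total masses vary with n. They are
  correlations at time zero, a null set for Lebesgue measure, so their convergence needs an argument
  of its own, and a normalisation precedes every use of probability theory.\<close>

lemma norm_iexp_minus_one_ge:
  assumes "\<bar>\<theta>\<bar> \<le> pi"
  shows "cmod (iexp \<theta> - 1) \<ge> 2 * \<bar>\<theta>\<bar> / pi"
proof -
  \<comment> \<open>Jordan's inequality: by concavity the sine lies above its chord between 0 and
    pi/2.\<close>
  have sin_ge: "sin y \<ge> 2 * y / pi" if "0 \<le> y" "y \<le> pi / 2" for y :: real
  proof -
    have "concave_on {0..pi} sin"
      unfolding concave_on_def
    proof (rule f''_ge0_imp_convex[where f' = "\<lambda>x. - cos x" and f'' = sin])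
      show "((\<lambda>x. - sin x) has_real_derivative - cos x) (at x)" for x :: real
        by (auto intro!: derivative_eq_intros)
      show "((\<lambda>x. - cos x) has_real_derivative sin x) (at x)" for x :: real
        by (auto intro!: derivative_eq_intros)
    qed (auto intro: sin_ge_zero)
    then have "sin ((1 - 2*y/pi) *\<^sub>R 0 + (2*y/pi) *\<^sub>R (pi/2)) \<ge> (1 - 2*y/pi) * sin 0 + (2*y/pi) * sin (pi/2)"
      using that by (intro concave_onD) (auto simp: field_simps)
    then show ?thesis by simp
  qed
  have "cmod (iexp \<theta> - 1) = 2 * \<bar>sin (\<theta> / 2)\<bar>"
    using dist_exp_i_1[of \<theta>] by simp
  moreover have "\<bar>sin (\<theta>/2)\<bar> = sin (\<bar>\<theta>\<bar> / 2)"
    using sin_ge_zero[of "\<bar>\<theta>\<bar> / 2"] assms pi_ge_zero by (auto simp: abs_if)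
  ultimately show ?thesis
    using sin_ge[of "\<bar>\<theta>\<bar> / 2"] assms by simp
qed

text \<open>Real part of a geometric sum. Its modulus is at most 2 / |exp(i\<theta>) - 1|, hence at
  most pi / |\<theta>| by the preceding bound, and the second hypothesis is exactly what makes this
  at most half the number of terms.\<close>

lemma sum_cos_le:
  assumes "\<bar>\<theta>\<bar> \<le> pi" "2 * pi \<le> real m * \<bar>\<theta>\<bar>"
  shows "(\<Sum>j=1..m. cos (real j * \<theta>)) \<le> real m / 2"
proof -
  have \<theta>: "\<bar>\<theta>\<bar> > 0" "m > 0"
    using assms(2) pi_gt_zero
    by (smt (verit) mult_eq_0_iff, smt (verit) mult_eq_0_iff of_nat_0 not_gr_zero)
  have d: "cmod (iexp \<theta> - 1) \<ge> 2 * \<bar>\<theta>\<bar> / pi"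
    by (rule norm_iexp_minus_one_ge) fact
  have e: "(iexp \<theta> - 1) * (\<Sum>j=1..m. iexp \<theta> ^ j) = iexp \<theta> ^ Suc m - iexp \<theta>"
  proof (induction m)
    case (Suc m)
    then show ?case by (simp add: algebra_simps)
  qed simp
  have "cmod (iexp \<theta> - 1) * cmod (\<Sum>j=1..m. iexp \<theta> ^ j) \<le> 2"
    unfolding norm_mult[symmetric] e
    by (rule order_trans[OF norm_triangle_ineq4]) (simp add: norm_power norm_mult)
  with d have "2 * \<bar>\<theta>\<bar> / pi * cmod (\<Sum>j=1..m. iexp \<theta> ^ j) \<le> 2"
    by (meson mult_right_mono norm_ge_zero order_trans)
  then have "cmod (\<Sum>j=1..m. iexp \<theta> ^ j) \<le> pi / \<bar>\<theta>\<bar>"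
    using \<theta> by (simp add: field_simps)
  also have "\<dots> \<le> real m / 2"
    using assms \<theta> by (simp add: field_simps)
  finally have "cmod (\<Sum>j=1..m. iexp \<theta> ^ j) \<le> real m / 2" .
  moreover have "Re (\<Sum>j=1..m. iexp \<theta> ^ j) = (\<Sum>j=1..m. cos (real j * \<theta>))"
    unfolding exp_of_nat_mult[symmetric]
    by (simp add: Re_exp)
  ultimately show ?thesis
    using complex_Re_le_cmod[of "\<Sum>j=1..m. iexp \<theta> ^ j"] by linarith
qed

text \<open>Markov's inequality for the sum of 1 - cos(j\<tau>x), which is at least m/2 on the tail
  by \<open>sum_cos_le\<close>. The support hypothesis keeps |\<tau>x| \<le> pi; without it, x near
  a nonzero multiple of 2 pi / \<tau> would have all sampled cosines close to 1 and escape
  detection.\<close>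

lemma (in real_distribution) tail_le_sampled_char:
  assumes "\<tau> > 0" "m > 0" "AE x in M. \<bar>x\<bar> \<le> pi / \<tau>"
  shows "prob {x. 2 * pi / (real m * \<tau>) \<le> \<bar>x\<bar>} \<le> 2 / real m * (\<Sum>j=1..m. 1 - Re (char M (real j * \<tau>)))"
proof -
  have int: "integrable M (\<lambda>x. 1 - cos (t * x))" for t
    by (rule integrable_const_bound[of _ 2]) (auto intro!: order_trans[OF abs_triangle_ineq4] simp: abs_cos_le_one add_mono)
  have intc: "integrable M (\<lambda>x. cos (t * x))" for t
    by (rule integrable_const_bound[of _ 1]) auto
  have "Re (char M t) = (LINT x|M. cos (t * x))" for t
  proof -
    have "integrable M (\<lambda>x. iexp (t * x))"
      by (rule integrable_const_bound[of _ 1]) (auto simp del: of_real_mult)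
    then show ?thesis
      unfolding char_def by (subst integral_Re[symmetric]) (auto simp: Re_exp)
  qed
  then have re: "1 - Re (char M t) = (LINT x|M. 1 - cos (t * x))" for t
    using intc[of t] by (simp add: prob_space del: space_eq_univ)
  have "real m / 2 * prob {x. 2 * pi / (real m * \<tau>) \<le> \<bar>x\<bar>}
      = (LINT x|M. real m / 2 * indicator {x. 2 * pi / (real m * \<tau>) \<le> \<bar>x\<bar>} x)"
    by simp
  also have "\<dots> \<le> (LINT x|M. (\<Sum>j=1..m. 1 - cos (real j * \<tau> * x)))"
  proof (rule integral_mono_AE)
    show "integrable M (\<lambda>x. real m / 2 * indicator {x. 2 * pi / (real m * \<tau>) \<le> \<bar>x\<bar>} x)"
      by (rule integrable_const_bound[of _ "real m / 2"]) (auto split: split_indicator)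
    show "AE x in M. real m / 2 * indicator {x. 2 * pi / (real m * \<tau>) \<le> \<bar>x\<bar>} x \<le> (\<Sum>j=1..m. 1 - cos (real j * \<tau> * x))"
      using assms(3)
    proof eventually_elim
      case (elim x)
      show ?case
      proof (cases "2 * pi / (real m * \<tau>) \<le> \<bar>x\<bar>")
        case True
        have "(\<Sum>j=1..m. cos (real j * (\<tau> * x))) \<le> real m / 2"
          using elim True assms(1,2) by (intro sum_cos_le) (auto simp: abs_mult field_simps)
        then show ?thesis using True by (simp add: sum_subtractf mult.assoc)
      next
        case False
        then show ?thesis by (auto intro!: sum_nonneg)
      qed
    qed
  qed (auto intro!: int integrable_mult_right)
  also have "\<dots> = (\<Sum>j=1..m. 1 - Re (char M (real j * \<tau>)))"
    unfolding re by (intro Bochner_Integration.integral_sum int)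
  finally show ?thesis
    using assms(2) by (simp add: field_simps)
qed

text \<open>The finitely many early distributions are each tight on their own, so a common tail
  bound is needed for large indices only.\<close>

lemma tightI_eventually:
  assumes rd: "\<And>n. real_distribution (\<mu> n)"
    and ev: "\<And>\<epsilon>. \<epsilon> > 0 \<Longrightarrow> \<exists>R. \<forall>\<^sub>F n in sequentially. measure (\<mu> n) {x. R \<le> \<bar>x\<bar>} < \<epsilon>"
  shows "tight \<mu>"
  unfolding tight_def
proof (intro conjI allI impI)
  fix \<epsilon> :: real assume \<epsilon>: "\<epsilon> > 0"
  obtain R N where RN: "\<And>n. n \<ge> N \<Longrightarrow> measure (\<mu> n) {x. R \<le> \<bar>x\<bar>} < \<epsilon>"
    using ev[OF \<epsilon>] by (auto simp: eventually_sequentially)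
  have "\<exists>k::real. measure (\<mu> n) {x. k \<le> \<bar>x\<bar>} < \<epsilon>" for n
  proof -
    interpret real_distribution "\<mu> n" by (rule rd)
    have "(\<lambda>k. prob {x. real k \<le> \<bar>x\<bar>}) \<longlonglongrightarrow> prob (\<Inter>k. {x. real k \<le> \<bar>x\<bar>})"
      by (intro finite_Lim_measure_decseq) (auto simp: decseq_def)
    moreover have "(\<Inter>k. {x::real. real k \<le> \<bar>x\<bar>}) = {}"
      by auto (meson linorder_not_le reals_Archimedean2)
    ultimately have "(\<lambda>k. prob {x. real k \<le> \<bar>x\<bar>}) \<longlonglongrightarrow> 0" by simp
    then have "\<forall>\<^sub>F k in sequentially. prob {x. real k \<le> \<bar>x\<bar>} < \<epsilon>"
      using \<epsilon> by (rule order_tendstoD)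
    then show ?thesis by (auto simp: eventually_sequentially)
  qed
  then obtain k where k: "\<And>n. measure (\<mu> n) {x. k n \<le> \<bar>x\<bar>} < \<epsilon>" by metis
  \<comment> \<open>The entry 1 makes the interval nondegenerate and the maximum positive whatever
    the other entries are.\<close>
  define K where "K = Max (insert 1 (insert R (k ` {..<N})))"
  have K: "K \<ge> 1" "K \<ge> R" "n < N \<Longrightarrow> k n \<le> K" for n
    unfolding K_def by (rule Max_ge; simp)+
  show "\<exists>a b. a < b \<and> (\<forall>n. 1 - \<epsilon> < measure (\<mu> n) {a<..b})"
  proof (intro exI conjI allI)
    show "-K < K" using K by simp
    fix n
    interpret real_distribution "\<mu> n" by (rule rd)
    have "1 - prob {-K<..K} = prob (- {-K<..K})"
      using prob_compl[of "{-K<..K}"] by (simp add: Compl_eq_Diff_UNIV)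
    also have "\<dots> < \<epsilon>"
    proof (cases "n < N")
      case True
      then have "prob (- {-K<..K}) \<le> prob {x. k n \<le> \<bar>x\<bar>}"
        using K(3)[of n] by (intro finite_measure_mono) auto
      with k[of n] show ?thesis by simp
    next
      case False
      then have "prob (- {-K<..K}) \<le> prob {x. R \<le> \<bar>x\<bar>}"
        using K(2) by (intro finite_measure_mono) auto
      with RN[of n] False show ?thesis by simp
    qed
    finally show "1 - \<epsilon> < prob {-K<..K}" by simp
  qed
qed (rule rd)

section \<open>Rounding of time to the sampling grid\<close>

lemma step_count_eq:
  assumes "\<tau> > 0" "(real j - 1) * \<tau> < s" "s \<le> real j * \<tau>" "j > 0"
  shows "step_count \<tau> s = int j"
proof -
  have "0 \<le> (real j - 1) * \<tau>" using assms(1,4) by simp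
  then have "s > 0" using assms(2) by linarith
  moreover have "\<lceil>s / \<tau>\<rceil> = int j"
    using assms by (intro ceiling_unique) (auto simp: field_simps)
  ultimately show ?thesis by (simp add: step_count_def)
qed

lemma step_count_dist:
  assumes "\<tau> > 0"
  shows "\<bar>\<tau> * of_int (step_count \<tau> s) - s\<bar> \<le> \<tau>"
proof -
  have "\<bar>s\<bar> / \<tau> \<le> of_int \<lceil>\<bar>s\<bar> / \<tau>\<rceil>" "of_int \<lceil>\<bar>s\<bar> / \<tau>\<rceil> \<le> \<bar>s\<bar> / \<tau> + 1"
    by linarith+
  then have "\<bar>s\<bar> \<le> \<tau> * of_int \<lceil>\<bar>s\<bar> / \<tau>\<rceil>" "\<tau> * of_int \<lceil>\<bar>s\<bar> / \<tau>\<rceil> \<le> \<bar>s\<bar> + \<tau>"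
    using assms by (metis mult.commute pos_divide_le_eq, simp add: field_simps)
  then show ?thesis by (auto simp: step_count_def abs_if split: if_splits)
qed

lemma step_count_minus: "\<tau> > 0 \<Longrightarrow> step_count \<tau> (- s) = - step_count \<tau> s"
  by (simp add: step_count_def)

lemma step_count_measurable [measurable]: "step_count \<tau> \<in> measurable borel (count_space UNIV)"
  unfolding step_count_def[abs_def] by measurable

text \<open>\<open>step_count\<close> rounds away from zero, so it is constantly j on the half-open
  cell from (j-1)\<tau> to j\<tau>. This turns sums over samples into integrals over time, the form
  in which convergence is known.\<close>

lemma integral_step_count:
  fixes h :: "int \<Rightarrow> real"
  assumes "\<tau> > 0"
  shows "(LINT s:{0<..real m * \<tau>}|lborel. h (step_count \<tau> s)) = \<tau> * (\<Sum>j=1..m. h (int j))"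
proof -
  have eq: "indicator {0<..real m * \<tau>} s * h (step_count \<tau> s)
      = (\<Sum>j=1..m. h (int j) * indicator {(real j - 1) * \<tau><..real j * \<tau>} s)" for s
  proof (induction m)
    case (Suc m)
    have "indicator {0<..real (Suc m) * \<tau>} s = (indicator {0<..real m * \<tau>} s + indicator {real m * \<tau><..real (Suc m) * \<tau>} s :: real)"
    proof -
      have "0 \<le> real m * \<tau>" "real m * \<tau> < real (Suc m) * \<tau>" using assms by auto
      then show ?thesis by (auto split: split_indicator)
    qed
    moreover have "indicator {real m * \<tau><..real (Suc m) * \<tau>} s * h (step_count \<tau> s) = indicator {real m * \<tau><..real (Suc m) * \<tau>} s * h (int (Suc m))"
    proof (cases "s \<in> {real m * \<tau><..real (Suc m) * \<tau>}")
      case True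
      then have "step_count \<tau> s = int (Suc m)"
        by (intro step_count_eq[OF assms]) auto
      then show ?thesis by simp
    qed simp
    moreover have "{(real (Suc m) - 1) * \<tau><..real (Suc m) * \<tau>} = {real m * \<tau><..real (Suc m) * \<tau>}"
      by simp
    ultimately show ?case using Suc by (simp only: sum.cl_ivl_Suc distrib_right) (simp add: mult.commute)
  qed simp
  have "(LINT s:{0<..real m * \<tau>}|lborel. h (step_count \<tau> s))
      = (LINT s|lborel. (\<Sum>j=1..m. h (int j) * indicator {(real j - 1) * \<tau><..real j * \<tau>} s))"
    unfolding set_lebesgue_integral_def by (simp only: real_scaleR_def eq)
  also have "\<dots> = (\<Sum>j=1..m. LINT s|lborel. h (int j) * indicator {(real j - 1) * \<tau><..real j * \<tau>} s)"
    using assms by (intro Bochner_Integration.integral_sum integrable_mult_right integrable_real_indicator)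
      auto
  also have "\<dots> = (\<Sum>j=1..m. h (int j) * \<tau>)"
    using assms by (intro sum.cong refl) (simp add: left_diff_distrib)
  finally show ?thesis by (simp add: sum_distrib_left mult.commute)
qed

text \<open>The limit transform is close to 1 near time zero. Convergence in mean on a short
  interval passes this on to the average of the samples there, and that average controls the tails
  by \<open>tail_le_sampled_char\<close>.\<close>

lemma tight_if_sampled_chars_converge:
  assumes rd: "\<And>n. real_distribution (p n)" and "real_distribution P"
    and \<tau>: "\<And>n. \<tau> n > 0" "\<tau> \<longlonglongrightarrow> 0"
    and supp: "\<And>n. AE x in p n. \<bar>x\<bar> \<le> pi / \<tau> n"
    and conv: "\<And>T. T > 0 \<Longrightarrow>
      (\<lambda>n. LINT s:{-T..T}|lborel. cmod (char (p n) (\<tau> n * of_int (step_count (\<tau> n) s)) - char P s)) \<longlonglongrightarrow> 0"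
  shows "tight p"
proof (rule tightI_eventually)
  interpret P: real_distribution P by fact
  fix \<epsilon> :: real assume \<epsilon>: "\<epsilon> > 0"
  have "isCont (char P) 0" by (rule P.isCont_char)
  then have "\<exists>\<delta>'>0. \<forall>s. dist s 0 < \<delta>' \<longrightarrow> dist (char P s) (char P 0) < \<epsilon> / 16"
    unfolding continuous_at_eps_delta using \<epsilon> by (meson divide_pos_pos zero_less_numeral)
  then obtain \<delta>' where \<delta>': "\<delta>' > 0" "\<And>s. \<bar>s\<bar> < \<delta>' \<Longrightarrow> cmod (char P s - 1) < \<epsilon> / 16"
    by (auto simp: dist_norm P.char_zero)
  \<comment> \<open>Division by 3 places the closed interval of radius 2\<delta>, used below, inside
    the open one of radius \<delta>'.\<close>
  define \<delta> where "\<delta> = \<delta>' / 3"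
  have \<delta>: "\<delta> > 0" "\<And>s. \<bar>s\<bar> \<le> 2 * \<delta> \<Longrightarrow> cmod (char P s - 1) \<le> \<epsilon> / 16"
    using \<delta>' by (auto simp: \<delta>_def intro!: less_imp_le)
  let ?I = "\<lambda>n. LINT s:{-(2*\<delta>)..2*\<delta>}|lborel. cmod (char (p n) (\<tau> n * of_int (step_count (\<tau> n) s)) - char P s)"
  \<comment> \<open>The constants are dictated by the final estimate: after the factor 2/\<delta>
    the integral contributes \<epsilon>/4, and the bound \<epsilon>/16 over an interval of length
    4\<delta> contributes \<epsilon>/2.\<close>
  have "\<forall>\<^sub>F n in sequentially. ?I n < \<delta> * \<epsilon> / 8"
    using conv[of "2*\<delta>"] \<delta>(1) \<epsilon> by (intro order_tendstoD) auto
  moreover have "\<forall>\<^sub>F n in sequentially. \<tau> n < \<delta>"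
    using \<tau>(2) \<delta>(1) by (rule order_tendstoD)
  ultimately have "\<forall>\<^sub>F n in sequentially. measure (p n) {x. 2 * pi / \<delta> \<le> \<bar>x\<bar>} < \<epsilon>"
  proof eventually_elim
    case (elim n)
    interpret p: real_distribution "p n" by (rule rd)
    \<comment> \<open>Number of samples needed to cover the times from 0 to \<delta>. Rounding up
      overshoots by at most one step, so the covered interval stays below 2\<delta> once the step is
      smaller than \<delta>.\<close>
    define m where "m = nat \<lceil>\<delta> / \<tau> n\<rceil>"
    have m0: "real m \<ge> \<delta> / \<tau> n" "real m \<le> \<delta> / \<tau> n + 1" "m > 0"
    proof -
      have pos: "\<delta> / \<tau> n > 0" using \<delta>(1) \<tau>(1)[of n] by simp
      then have r: "real m = of_int \<lceil>\<delta> / \<tau> n\<rceil>" by (simp add: m_def)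
      show "real m \<ge> \<delta> / \<tau> n" "real m \<le> \<delta> / \<tau> n + 1"
        unfolding r by linarith+
      show "m > 0" using pos by (simp add: m_def)
    qed
    then have m: "real m * \<tau> n \<ge> \<delta>" "real m * \<tau> n \<le> 2 * \<delta>"
      using \<tau>(1)[of n] elim by (auto simp: field_simps)
    let ?c = "\<lambda>j. char (p n) (\<tau> n * of_int j)"
    have bdd: "cmod (char Q t - char R s) \<le> 2" if "real_distribution Q" "real_distribution R" for Q R s t
      using real_distribution.cmod_char_le_1[OF that(1), of t] real_distribution.cmod_char_le_1[OF that(2), of s]
      by (intro order_trans[OF norm_triangle_ineq4]) simp
    have i1: "set_integrable lborel {-(2*\<delta>)..2*\<delta>} (\<lambda>s. cmod (?c (step_count (\<tau> n) s) - char P s))"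
      unfolding set_integrable_def
    proof (rule Bochner_Integration.integrable_bound)
      show "integrable lborel (\<lambda>s. indicator {-(2*\<delta>)..2*\<delta>} s * 2 :: real)"
        by (intro integrable_mult_left integrable_real_indicator) (auto simp: emeasure_lborel_Icc_eq)
      show "AE s in lborel. norm (indicator {-(2*\<delta>)..2*\<delta>} s *\<^sub>R cmod (?c (step_count (\<tau> n) s) - char P s))
          \<le> norm (indicator {-(2*\<delta>)..2*\<delta>} s * 2 :: real)"
        using bdd[OF rd assms(2)] by (intro AE_I2) (simp split: split_indicator)
    qed measurable
    have ic: "set_integrable lborel {-(2*\<delta>)..2*\<delta>} (\<lambda>_. \<epsilon> / 16)"
      unfolding set_integrable_def by (intro integrable_scaleR_left integrable_real_indicator) (auto simp: emeasure_lborel_Icc_eq)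
    have "measure (p n) {x. 2 * pi / \<delta> \<le> \<bar>x\<bar>} \<le> measure (p n) {x. 2 * pi / (real m * \<tau> n) \<le> \<bar>x\<bar>}"
    proof (rule p.finite_measure_mono)
      have "2 * pi / (real m * \<tau> n) \<le> 2 * pi / \<delta>"
        using m \<delta>(1) m0(3) \<tau>(1)[of n] by (intro divide_left_mono mult_pos_pos) auto
      then show "{x. 2 * pi / \<delta> \<le> \<bar>x\<bar>} \<subseteq> {x. 2 * pi / (real m * \<tau> n) \<le> \<bar>x\<bar>}"
        by auto
    qed simp
    also have "\<dots> \<le> 2 / real m * (\<Sum>j=1..m. 1 - Re (char (p n) (real j * \<tau> n)))"
      by (rule p.tail_le_sampled_char) (use \<tau> m0 supp in auto)
    also have "\<dots> = 2 / (real m * \<tau> n) * (\<tau> n * (\<Sum>j=1..m. 1 - Re (?c (int j))))"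
      using \<tau>(1)[of n] by (simp add: mult.commute)
    also have "\<dots> = 2 / (real m * \<tau> n) * (LINT s:{0<..real m * \<tau> n}|lborel. 1 - Re (?c (step_count (\<tau> n) s)))"
      by (subst integral_step_count) (use \<tau> in auto)
    also have "\<dots> \<le> 2 / (real m * \<tau> n) * (LINT s:{-(2*\<delta>)..2*\<delta>}|lborel.
        cmod (?c (step_count (\<tau> n) s) - char P s) + \<epsilon> / 16)"
    proof (rule mult_left_mono)
      show "(LINT s:{0<..real m * \<tau> n}|lborel. 1 - Re (?c (step_count (\<tau> n) s)))
          \<le> (LINT s:{-(2*\<delta>)..2*\<delta>}|lborel. cmod (?c (step_count (\<tau> n) s) - char P s) + \<epsilon> / 16)"
        unfolding set_lebesgue_integral_def
      proof (rule integral_mono')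
        show "integrable lborel (\<lambda>s. indicator {-(2*\<delta>)..2*\<delta>} s *\<^sub>R (cmod (?c (step_count (\<tau> n) s) - char P s) + \<epsilon> / 16))"
          using set_integral_add(1)[OF i1 ic] by (simp only: set_integrable_def)
        fix s
        have "1 - Re (?c (step_count (\<tau> n) s)) \<le> cmod (?c (step_count (\<tau> n) s) - char P s) + \<epsilon> / 16" if "\<bar>s\<bar> \<le> 2 * \<delta>"
        proof -
          have "1 - Re (?c (step_count (\<tau> n) s)) \<le> cmod (1 - ?c (step_count (\<tau> n) s))"
            using complex_Re_le_cmod[of "1 - ?c (step_count (\<tau> n) s)"] by simp
          also have "\<dots> \<le> cmod (?c (step_count (\<tau> n) s) - char P s) + cmod (char P s - 1)"
            using norm_triangle_ineq[of "?c (step_count (\<tau> n) s) - char P s" "char P s - 1"]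
            by (simp add: norm_minus_commute)
          finally show ?thesis using \<delta>(2)[OF that] by simp
        qed
        then show "indicator {0<..real m * \<tau> n} s *\<^sub>R (1 - Re (?c (step_count (\<tau> n) s)))
            \<le> indicator {-(2*\<delta>)..2*\<delta>} s *\<^sub>R (cmod (?c (step_count (\<tau> n) s) - char P s) + \<epsilon> / 16)"
          using m \<delta> \<epsilon> by (auto split: split_indicator)
        show "0 \<le> indicator {-(2*\<delta>)..2*\<delta>} s *\<^sub>R (cmod (?c (step_count (\<tau> n) s) - char P s) + \<epsilon> / 16)"
          using \<epsilon> by simp
      qed
    qed (use \<tau>(1)[of n] in auto)
    also have "(LINT s:{-(2*\<delta>)..2*\<delta>}|lborel. cmod (?c (step_count (\<tau> n) s) - char P s) + \<epsilon> / 16) = ?I n + 4 * \<delta> * (\<epsilon> / 16)"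
      using \<delta>(1) by (subst set_integral_add(2)[OF i1 ic]) (simp add: set_lebesgue_integral_def)
    also have "2 / (real m * \<tau> n) * (?I n + 4 * \<delta> * (\<epsilon> / 16)) \<le> 2 / \<delta> * (?I n + 4 * \<delta> * (\<epsilon> / 16))"
      using m \<delta>(1) \<epsilon> by (intro mult_right_mono divide_left_mono add_nonneg_nonneg)
        (auto simp: set_lebesgue_integral_def)
    also have "\<dots> < 2 / \<delta> * (\<delta> * \<epsilon> / 8 + 4 * \<delta> * (\<epsilon> / 16))"
      using elim \<delta>(1) by (intro mult_strict_left_mono add_less_le_mono) auto
    also have "\<dots> \<le> \<epsilon>" using \<delta>(1) \<epsilon> by (simp add: field_simps)
    finally show ?case .
  qed
  then show "\<exists>R. \<forall>\<^sub>F n in sequentially. measure (p n) {x. R \<le> \<bar>x\<bar>} < \<epsilon>" by blast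
qed (rule rd)

text \<open>By tightness only subsequential limits \<nu> have to be identified. The Skorohod
  variables converge pointwise, so the times may move along with n: the transforms at sampled times,
  which are within one step of s, still converge to \<open>char \<nu> s\<close>. In mean they
  converge to \<open>char P\<close>, so the two transforms have distance zero on every bounded
  interval.\<close>

lemma weak_conv_if_sampled_chars_converge:
  assumes rd: "\<And>n. real_distribution (p n)" and P: "real_distribution P"
    and \<tau>: "\<And>n. \<tau> n > 0" "\<tau> \<longlonglongrightarrow> 0"
    and supp: "\<And>n. AE x in p n. \<bar>x\<bar> \<le> pi / \<tau> n"
    and conv: "\<And>T. T > 0 \<Longrightarrow>
      (\<lambda>n. LINT s:{-T..T}|lborel. cmod (char (p n) (\<tau> n * of_int (step_count (\<tau> n) s)) - char P s)) \<longlonglongrightarrow> 0"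
  shows "weak_conv_m p P"
proof (rule tight_subseq_weak_converge[OF rd P])
  show "tight p"
    by (rule tight_if_sampled_chars_converge[OF rd P \<tau> supp conv])
  fix r \<nu> assume r: "strict_mono r" and \<nu>: "real_distribution \<nu>" and weak: "weak_conv_m (p \<circ> r) \<nu>"
  interpret P: real_distribution P by fact
  interpret N: real_distribution \<nu> by fact
  have rdr: "real_distribution ((p \<circ> r) n)" for n using rd by simp
  obtain \<Omega> :: "real measure" and Y_seq Y where \<Omega>: "prob_space \<Omega>"
    and Ym: "\<And>n. Y_seq n \<in> borel_measurable \<Omega>" "Y \<in> measurable \<Omega> lborel"
    and Yd: "\<And>n. distr \<Omega> borel (Y_seq n) = (p \<circ> r) n" "distr \<Omega> borel Y = \<nu>"
    and Yc: "\<And>x. x \<in> space \<Omega> \<Longrightarrow> (\<lambda>n. Y_seq n x) \<longlonglongrightarrow> Y x"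
    using Skorohod[OF rdr \<nu> weak] by (elim exE conjE, intro that) blast+
  have Ym': "Y \<in> borel_measurable \<Omega>" using Ym(2) by simp
  interpret \<Omega>: prob_space \<Omega> by fact
  define t where "t n s = \<tau> (r n) * of_int (step_count (\<tau> (r n)) s)" for n s
  have [measurable]: "t n \<in> borel_measurable borel" for n
    unfolding t_def[abs_def] by measurable
  have tlim: "(\<lambda>n. t n s) \<longlonglongrightarrow> s" for s
  proof (rule LIM_zero_cancel, rule Lim_null_comparison)
    show "\<forall>\<^sub>F n in sequentially. norm (t n s - s) \<le> (\<tau> \<circ> r) n"
      using step_count_dist[OF \<tau>(1)] by (simp add: t_def)
    show "(\<tau> \<circ> r) \<longlonglongrightarrow> 0" using \<tau>(2) r by (rule LIMSEQ_subseq_LIMSEQ)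
  qed
  have lim: "(\<lambda>n. char ((p \<circ> r) n) (t n s)) \<longlonglongrightarrow> char \<nu> s" for s
  proof -
    have "(\<lambda>n. CLINT x|\<Omega>. iexp (t n s * Y_seq n x)) \<longlonglongrightarrow> (CLINT x|\<Omega>. iexp (s * Y x))"
    proof (rule integral_dominated_convergence[where w="\<lambda>_. 1"])
      show "AE x in \<Omega>. (\<lambda>n. iexp (t n s * Y_seq n x)) \<longlonglongrightarrow> iexp (s * Y x)"
        by (rule AE_I2) (intro tendsto_intros tlim Yc)
    qed (use Ym(1) Ym' in \<open>auto simp del: of_real_mult\<close>)
    moreover have "char ((p \<circ> r) n) (t n s) = (CLINT x|\<Omega>. iexp (t n s * Y_seq n x))" for n
      unfolding char_def Yd(1)[symmetric] by (subst integral_distr[OF Ym(1)]) auto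
    moreover have "char \<nu> s = (CLINT x|\<Omega>. iexp (s * Y x))"
      unfolding char_def Yd(2)[symmetric] by (subst integral_distr[OF Ym']) auto
    ultimately show ?thesis by simp
  qed
  have eq0: "(LINT s:{-T..T}|lborel. cmod (char \<nu> s - char P s)) = 0" if "T > 0" for T
  proof (rule LIMSEQ_unique)
    show "(\<lambda>n. LINT s:{-T..T}|lborel. cmod (char ((p \<circ> r) n) (t n s) - char P s))
        \<longlonglongrightarrow> (LINT s:{-T..T}|lborel. cmod (char \<nu> s - char P s))"
      unfolding set_lebesgue_integral_def
    proof (rule integral_dominated_convergence[where w="\<lambda>s. indicator {-T..T} s * 2"])
      show "integrable lborel (\<lambda>s. indicator {-T..T} s * 2 :: real)"
        by (intro integrable_mult_left integrable_real_indicator) (auto simp: emeasure_lborel_Icc_eq)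
      have [measurable]: "char ((p \<circ> r) n) \<in> borel_measurable borel" for n
        by (rule real_distribution.char_measurable[OF rdr])
      show "(\<lambda>s. indicator {-T..T} s *\<^sub>R cmod (char ((p \<circ> r) n) (t n s) - char P s)) \<in> borel_measurable lborel" for n
        by measurable
      show "AE s in lborel. (\<lambda>n. indicator {-T..T} s *\<^sub>R cmod (char ((p \<circ> r) n) (t n s) - char P s))
          \<longlonglongrightarrow> indicator {-T..T} s *\<^sub>R cmod (char \<nu> s - char P s)"
        by (intro AE_I2 tendsto_intros lim)
      fix n
      have "cmod (char ((p \<circ> r) n) (t n s) - char P s) \<le> 2" for s
        using real_distribution.cmod_char_le_1[OF rdr, of n "t n s"] P.cmod_char_le_1[of s]
        by (intro order_trans[OF norm_triangle_ineq4]) simp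
      then show "AE s in lborel. norm (indicator {-T..T} s *\<^sub>R cmod (char ((p \<circ> r) n) (t n s) - char P s))
          \<le> indicator {-T..T} s * 2"
        by (intro AE_I2) (auto split: split_indicator)
    qed auto
    show "(\<lambda>n. LINT s:{-T..T}|lborel. cmod (char ((p \<circ> r) n) (t n s) - char P s)) \<longlonglongrightarrow> 0"
      using LIMSEQ_subseq_LIMSEQ[OF conv[OF that] r] by (simp add: comp_def t_def)
  qed
  have "char \<nu> = char P"
  proof
    fix s :: real
    define T where "T = \<bar>s\<bar> + 1"
    define h where "h x = cmod (char \<nu> x - char P x)" for x
    have T: "T > 0" "-T < s" "s < T" by (auto simp: T_def)
    have hc: "continuous_on {-T..T} h"
      unfolding h_def by (intro continuous_intros continuous_at_imp_continuous_on ballI N.isCont_char P.isCont_char)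
    have i: "set_integrable lborel {-T..T} h"
      unfolding set_integrable_def by (rule borel_integrable_compact[OF compact_Icc hc])
    have "(h has_integral (LINT s:{-T..T}|lborel. h s)) {-T..T}"
      using set_borel_integral_eq_integral[OF i] by (metis integrable_integral)
    then have "(h has_integral 0) (cbox (-T) T)"
      using eq0[OF T(1)] by (simp add: h_def[symmetric])
    \<comment> \<open>A continuous nonnegative function with vanishing integral is zero on the whole
      interval, and s lies in it.\<close>
    then have "h s = 0"
      by (rule has_integral_0_cbox_imp_0[rotated 2]) (use hc T in \<open>auto simp: h_def\<close>)
    then show "char \<nu> s = char P s" by (simp add: h_def)
  qed
  then have "\<nu> = P" by (rule Levy_uniqueness[OF \<nu> P])
  with weak show "weak_conv_m (p \<circ> r) P" by simp
qed

text \<open>For the coupled variables the error at w is at most the expectation of min(L |Y_n - Y|,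
  2B), which is free of w. The Lipschitz part of the minimum gives the pointwise limit 0, the
  bounded part the domination.\<close>

lemma weak_conv_imp_uniform_limit_convolution:
  fixes \<phi> :: "real \<Rightarrow> real"
  assumes rd: "\<And>n. real_distribution (p n)" "real_distribution P" and weak: "weak_conv_m p P"
    and lip: "\<And>x y. \<bar>\<phi> x - \<phi> y\<bar> \<le> L * \<bar>x - y\<bar>" and bdd: "\<And>x. \<bar>\<phi> x\<bar> \<le> B"
  shows "uniform_limit UNIV (\<lambda>n w. LINT x|p n. \<phi> (w - x)) (\<lambda>w. LINT x|P. \<phi> (w - x)) sequentially"
proof -
  obtain \<Omega> :: "real measure" and Y_seq Y where \<Omega>: "prob_space \<Omega>"
    and Ym[measurable]: "\<And>n. Y_seq n \<in> borel_measurable \<Omega>" and "Y \<in> measurable \<Omega> lborel"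
    and Yd: "\<And>n. distr \<Omega> borel (Y_seq n) = p n" "distr \<Omega> borel Y = P"
    and Yc: "\<And>x. x \<in> space \<Omega> \<Longrightarrow> (\<lambda>n. Y_seq n x) \<longlonglongrightarrow> Y x"
    using Skorohod[OF rd weak] by (elim exE conjE, intro that) blast+
  then have Ym'[measurable]: "Y \<in> borel_measurable \<Omega>" by simp
  interpret \<Omega>: prob_space \<Omega> by fact
  have L: "L \<ge> 0" using lip[of 1 0] by simp
  have "L-lipschitz_on UNIV \<phi>"
    using lip L by (auto simp: lipschitz_on_def dist_norm)
  then have "continuous_on UNIV \<phi>" by (rule lipschitz_on_continuous_on)
  then have [measurable]: "\<phi> \<in> borel_measurable borel" by (rule borel_measurable_continuous_onI)
  define e where "e n = (LINT x|\<Omega>. min (L * \<bar>Y_seq n x - Y x\<bar>) (2 * B))" for n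
  have B: "B \<ge> 0" using bdd[of 0] by simp
  have e: "e \<longlonglongrightarrow> (LINT x|\<Omega>. 0)"
    unfolding e_def
  proof (rule integral_dominated_convergence[where w="\<lambda>_. 2 * B"])
    show "AE x in \<Omega>. (\<lambda>n. min (L * \<bar>Y_seq n x - Y x\<bar>) (2 * B)) \<longlonglongrightarrow> 0"
    proof (rule AE_I2)
      fix x assume "x \<in> space \<Omega>"
      then have "(\<lambda>n. min (L * \<bar>Y_seq n x - Y x\<bar>) (2 * B)) \<longlonglongrightarrow> min (L * \<bar>Y x - Y x\<bar>) (2 * B)"
        by (intro tendsto_intros Yc)
      then show "(\<lambda>n. min (L * \<bar>Y_seq n x - Y x\<bar>) (2 * B)) \<longlonglongrightarrow> 0" using B by simp
    qed
  qed (use B L in auto)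
  have est: "\<bar>(LINT x|p n. \<phi> (w - x)) - (LINT x|P. \<phi> (w - x))\<bar> \<le> e n" for n w
  proof -
    have i: "integrable \<Omega> (\<lambda>x. \<phi> (w - Z x))" if [measurable]: "Z \<in> borel_measurable \<Omega>" for Z
      by (rule \<Omega>.integrable_const_bound[of _ B]) (use bdd in auto)
    have "(LINT x|p n. \<phi> (w - x)) - (LINT x|P. \<phi> (w - x)) = (LINT x|\<Omega>. \<phi> (w - Y_seq n x) - \<phi> (w - Y x))"
      unfolding Yd[symmetric] by (subst (1 2) integral_distr) (auto simp: i)
    also have "\<bar>\<dots>\<bar> \<le> (LINT x|\<Omega>. \<bar>\<phi> (w - Y_seq n x) - \<phi> (w - Y x)\<bar>)"
      by (rule integral_abs_bound)
    also have "\<dots> \<le> e n"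
      unfolding e_def
    proof (rule integral_mono)
      show "integrable \<Omega> (\<lambda>x. min (L * \<bar>Y_seq n x - Y x\<bar>) (2 * B))"
        by (rule \<Omega>.integrable_const_bound[of _ "2 * B"]) (use B L in auto)
      show "integrable \<Omega> (\<lambda>x. \<bar>\<phi> (w - Y_seq n x) - \<phi> (w - Y x)\<bar>)"
        by (intro integrable_abs Bochner_Integration.integrable_diff i) auto
      fix x
      show "\<bar>\<phi> (w - Y_seq n x) - \<phi> (w - Y x)\<bar> \<le> min (L * \<bar>Y_seq n x - Y x\<bar>) (2 * B)"
        using lip[of "w - Y_seq n x" "w - Y x"] bdd[of "w - Y_seq n x"] bdd[of "w - Y x"]
          abs_minus_commute[of "Y x" "Y_seq n x"] by auto
    qed
    finally show ?thesis .
  qed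
  show ?thesis
  proof (rule uniform_limitI)
    fix \<epsilon> :: real assume "\<epsilon> > 0"
    with e have "\<forall>\<^sub>F n in sequentially. e n < \<epsilon>" by (auto intro: order_tendstoD)
    then show "\<forall>\<^sub>F n in sequentially. \<forall>w\<in>UNIV. dist (LINT x|p n. \<phi> (w - x)) (LINT x|P. \<phi> (w - x)) < \<epsilon>"
      by eventually_elim (auto simp: dist_norm intro: le_less_trans[OF est])
  qed
qed

text \<open>Encoded as the image of a weighted measure on the indices rather than on the
  frequencies, so that coinciding frequencies simply add their masses.\<close>

definition atomic_measure :: "nat set \<Rightarrow> (nat \<Rightarrow> real) \<Rightarrow> (nat \<Rightarrow> real) \<Rightarrow> real measure" where
  "atomic_measure I a \<omega> = distr (point_measure I (\<lambda>k. ennreal (a k))) borel \<omega>"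

lemma integral_atomic_measure:
  fixes h :: "real \<Rightarrow> 'b::{banach, second_countable_topology}"
  assumes "finite I" "\<And>k. k \<in> I \<Longrightarrow> a k \<ge> 0" "h \<in> borel_measurable borel"
  shows "(LINT x|atomic_measure I a \<omega>. h x) = (\<Sum>k\<in>I. a k *\<^sub>R h (\<omega> k))"
  unfolding atomic_measure_def using assms
  by (subst integral_distr) (auto simp: lebesgue_integral_point_measure_finite measurable_point_measure_eq1)

lemma real_distribution_atomic_measure:
  assumes "finite I" "\<And>k. k \<in> I \<Longrightarrow> a k \<ge> 0" "(\<Sum>k\<in>I. a k) = 1"
  shows "real_distribution (atomic_measure I a \<omega>)"
proof -
  have "prob_space (point_measure I (\<lambda>k. ennreal (a k)))"
    using assms by (intro prob_spaceI) (simp add: space_point_measure emeasure_point_measure_finite sum_ennreal)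
  then show ?thesis
    unfolding atomic_measure_def
    by (rule prob_space.real_distribution_distr) (simp add: measurable_point_measure_eq1)
qed

lemma AE_atomic_measure_bounded:
  assumes "\<And>k. k \<in> I \<Longrightarrow> \<bar>\<omega> k\<bar> \<le> C"
  shows "AE x in atomic_measure I a \<omega>. \<bar>x\<bar> \<le> C"
  unfolding atomic_measure_def
  by (subst AE_distr_iff) (auto simp: measurable_point_measure_eq1 space_point_measure intro!: AE_I2 assms)

text \<open>Transfer from probability measures to measures whose total masses converge. Normalising
  costs an error |1 / A n - 1 / m| m in the transforms, and undoing it costs |A n - m| B in the
  convolutions. A vanishing limit mass cannot be normalised, but then the trivial bound
  \<open>A n * B\<close> already tends to 0.\<close>

lemma atomic_convolution_uniform_limit:
  fixes q :: "nat \<Rightarrow> nat" and a \<omega> :: "nat \<Rightarrow> nat \<Rightarrow> real" and \<phi> :: "real \<Rightarrow> real"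
  assumes \<nu>: "finite_measure \<nu>" and sets[measurable_cong]: "sets \<nu> = sets borel"
    and a: "\<And>n k. a n k \<ge> 0"
    and \<tau>: "\<And>n. \<tau> n > 0" "\<tau> \<longlonglongrightarrow> 0" and \<omega>: "\<And>n k. k \<in> {1..q n} \<Longrightarrow> \<bar>\<omega> n k\<bar> \<le> pi / \<tau> n"
    and total: "(\<lambda>n. \<Sum>k=1..q n. a n k) \<longlonglongrightarrow> measure \<nu> UNIV"
    and conv: "\<And>T. T > 0 \<Longrightarrow> (\<lambda>n. LINT s:{-T..T}|lborel.
        cmod ((\<Sum>k=1..q n. of_real (a n k) * iexp (\<tau> n * of_int (step_count (\<tau> n) s) * \<omega> n k)) - (CLINT x|\<nu>. iexp (s * x)))) \<longlonglongrightarrow> 0"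
    and lip: "\<And>x y. \<bar>\<phi> x - \<phi> y\<bar> \<le> L * \<bar>x - y\<bar>" and bdd: "\<And>x. \<bar>\<phi> x\<bar> \<le> B"
  shows "uniform_limit UNIV (\<lambda>n x. \<Sum>k=1..q n. a n k * \<phi> (x - \<omega> n k)) (\<lambda>x. LINT y|\<nu>. \<phi> (x - y)) sequentially"
proof -
  interpret \<nu>: finite_measure \<nu> by fact
  have univ: "space \<nu> = UNIV" using sets_eq_imp_space_eq[OF sets] by simp
  define m where "m = measure \<nu> UNIV"
  define A where "A n = (\<Sum>k=1..q n. a n k)" for n
  have total: "A \<longlonglongrightarrow> m" using total by (simp add: A_def[abs_def] m_def)
  have B: "B \<ge> 0" using bdd[of 0] by simp
  have "L \<ge> 0" using lip[of 1 0] by simp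
  then have "L-lipschitz_on UNIV \<phi>"
    using lip by (auto simp: lipschitz_on_def dist_norm)
  then have \<phi>m[measurable]: "\<phi> \<in> borel_measurable borel"
    by (intro borel_measurable_continuous_onI lipschitz_on_continuous_on)
  have \<phi>i: "\<bar>LINT y|\<nu>. \<phi> (x - y)\<bar> \<le> B * m" for x
  proof -
    have "\<bar>LINT y|\<nu>. \<phi> (x - y)\<bar> \<le> (LINT y|\<nu>. \<bar>\<phi> (x - y)\<bar>)" by (rule integral_abs_bound)
    also have "\<dots> \<le> (LINT y|\<nu>. B)"
      by (rule integral_mono') (use bdd B in auto)
    finally show ?thesis by (simp add: univ m_def mult.commute)
  qed
  have \<phi>s: "\<bar>\<Sum>k=1..q n. a n k * \<phi> (x - \<omega> n k)\<bar> \<le> A n * B" for n x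
    unfolding A_def sum_distrib_right
    by (rule order_trans[OF sum_abs]) (intro sum_mono, simp add: abs_mult a bdd mult_left_mono)
  have A0: "A n \<ge> 0" for n unfolding A_def by (intro sum_nonneg a)
  show ?thesis
  proof (cases "m = 0")
    case True
    show ?thesis
    proof (rule uniform_limitI)
      fix e :: real assume "e > 0"
      moreover have "(\<lambda>n. A n * B) \<longlonglongrightarrow> m * B" by (intro tendsto_intros total)
      ultimately have "\<forall>\<^sub>F n in sequentially. A n * B < e" using True by (auto intro: order_tendstoD)
      then show "\<forall>\<^sub>F n in sequentially. \<forall>x\<in>UNIV. dist (\<Sum>k=1..q n. a n k * \<phi> (x - \<omega> n k)) (LINT y|\<nu>. \<phi> (x - y)) < e"
      proof eventually_elim
        case (elim n)
        show ?case
        proof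
          fix x
          have "(LINT y|\<nu>. \<phi> (x - y)) = 0" using \<phi>i[of x] True by simp
          then show "dist (\<Sum>k=1..q n. a n k * \<phi> (x - \<omega> n k)) (LINT y|\<nu>. \<phi> (x - y)) < e"
            using \<phi>s[of n x] elim by (simp add: dist_real_def)
        qed
      qed
    qed
  next
    case False
    then have m: "m > 0" by (simp add: m_def zero_less_measure_iff)
    have "\<forall>\<^sub>F n in sequentially. A n > m / 2"
      using total m by (intro order_tendstoD) auto
    \<comment> \<open>Only from N on are the masses known to be positive, so the normalised sequence
      starts there; the shift is undone at the very end.\<close>
    then obtain N where N: "\<And>n. n \<ge> N \<Longrightarrow> A n > m / 2" by (auto simp: eventually_sequentially)
    have AN: "A (n + N) > 0" for n using N[of "n + N"] m by simp
    define p where "p n = atomic_measure {1..q (n + N)} (\<lambda>k. a (n + N) k / A (n + N)) (\<omega> (n + N))" for n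
    define Q where "Q = density \<nu> (\<lambda>_. ennreal (1 / m))"
    have rd: "real_distribution (p n)" for n
      unfolding p_def using AN[of n] a
      by (intro real_distribution_atomic_measure) (auto simp: A_def sum_divide_distrib[symmetric])
    have pint: "(LINT x|p n. h x) = (\<Sum>k=1..q (n + N). (a (n + N) k / A (n + N)) *\<^sub>R h (\<omega> (n + N) k))"
      if "h \<in> borel_measurable borel" for n and h :: "real \<Rightarrow> 'b::{banach, second_countable_topology}"
      unfolding p_def using AN[of n] a that by (intro integral_atomic_measure) auto
    have Qint: "(LINT x|Q. h x) = (1 / m) *\<^sub>R (LINT x|\<nu>. h x)"
      if "h \<in> borel_measurable borel" for h :: "real \<Rightarrow> 'b::{banach, second_countable_topology}"
      unfolding Q_def using m that by (subst integral_density) auto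
    have Q: "real_distribution Q"
    proof -
      have "emeasure Q (space Q) = 1"
        using m univ by (simp add: Q_def emeasure_density nn_integral_cmult \<nu>.emeasure_eq_measure m_def
            flip: ennreal_mult)
      then show ?thesis
        by (intro real_distribution.intro prob_spaceI real_distribution_axioms.intro) (simp_all add: Q_def sets)
    qed
    let ?\<tau> = "\<lambda>n. \<tau> (n + N)"
    let ?S = "\<lambda>n s. (\<Sum>k=1..q n. of_real (a n k) * iexp (\<tau> n * of_int (step_count (\<tau> n) s) * \<omega> n k)) :: complex"
    let ?C = "\<lambda>s. CLINT x|\<nu>. iexp (s * x)"
    have charp: "char (p n) (?\<tau> n * of_int (step_count (?\<tau> n) s)) = ?S (n + N) s / of_real (A (n + N))" for n s
      unfolding char_def by (subst pint) (simp_all add: scaleR_conv_of_real sum_divide_distrib)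
    have charQ: "char Q s = ?C s / of_real m" for s
      unfolding char_def by (subst Qint) (simp_all add: scaleR_conv_of_real)
    have C_meas[measurable]: "?C \<in> borel_measurable borel"
    proof -
      have "?C = (\<lambda>s. of_real m * char Q s)" using m by (auto simp: charQ)
      then show ?thesis using real_distribution.char_measurable[OF Q] by simp
    qed
    have C_bound: "cmod (?C s) \<le> m" for s
      using real_distribution.cmod_char_le_1[OF Q, of s] m by (simp add: charQ norm_divide)
    have S_bound: "cmod (?S n s) \<le> A n" for n s
      unfolding A_def by (rule order_trans[OF norm_sum]) (intro sum_mono, simp add: norm_mult a del: of_real_mult)
    have S_meas[measurable]: "?S n \<in> borel_measurable borel" for n by measurable
    have "weak_conv_m p Q"
    proof (rule weak_conv_if_sampled_chars_converge[OF rd Q, of ?\<tau>])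
      show "?\<tau> n > 0" for n by (rule \<tau>)
      show "?\<tau> \<longlonglongrightarrow> 0" by (rule LIMSEQ_ignore_initial_segment[OF \<tau>(2)])
      show "AE x in p n. \<bar>x\<bar> \<le> pi / ?\<tau> n" for n
        unfolding p_def by (intro AE_atomic_measure_bounded \<omega>)
      fix T :: real assume T: "T > 0"
      let ?e = "\<lambda>n. LINT s:{-T..T}|lborel. cmod (?S n s - ?C s)"
      have int: "set_integrable lborel {-T..T} (\<lambda>s. cmod (?S n s - ?C s))" for n
        unfolding set_integrable_def
      proof (rule Bochner_Integration.integrable_bound)
        show "integrable lborel (\<lambda>s. indicator {-T..T} s * (A n + m) :: real)"
          by (intro integrable_mult_left integrable_real_indicator) (auto simp: emeasure_lborel_Icc_eq)
        have "cmod (?S n s - ?C s) \<le> A n + m" for s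
          using norm_triangle_ineq4[of "?S n s" "?C s"] S_bound[of n s] C_bound[of s] by linarith
        then show "AE s in lborel. norm (indicator {-T..T} s *\<^sub>R cmod (?S n s - ?C s)) \<le> norm (indicator {-T..T} s * (A n + m) :: real)"
          using A0[of n] m by (intro AE_I2) (auto split: split_indicator)
      qed measurable
      have intc: "set_integrable lborel {-T..T} (\<lambda>s. c)" for c :: real
        unfolding set_integrable_def by (intro integrable_scaleR_left integrable_real_indicator) (auto simp: emeasure_lborel_Icc_eq)
      let ?c = "\<lambda>n. \<bar>1 / A n - 1 / m\<bar> * m"
      have le: "(LINT s:{-T..T}|lborel. cmod (char (p n) (?\<tau> n * of_int (step_count (?\<tau> n) s)) - char Q s))
          \<le> ?e (n + N) / A (n + N) + ?c (n + N) * (2 * T)" for n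
      proof -
        have pt: "cmod (char (p n) (?\<tau> n * of_int (step_count (?\<tau> n) s)) - char Q s)
            \<le> cmod (?S (n + N) s - ?C s) / A (n + N) + ?c (n + N)" for s
        proof -
          have "?S (n + N) s / of_real (A (n + N)) - ?C s / of_real m
              = (?S (n + N) s - ?C s) / of_real (A (n + N)) + of_real (1 / A (n + N) - 1 / m) * ?C s"
            by (simp add: diff_divide_distrib left_diff_distrib)
          then have "cmod (?S (n + N) s / of_real (A (n + N)) - ?C s / of_real m)
              \<le> cmod (?S (n + N) s - ?C s) / A (n + N) + \<bar>1 / A (n + N) - 1 / m\<bar> * cmod (?C s)"
            using norm_triangle_ineq[of "(?S (n + N) s - ?C s) / of_real (A (n + N))" "of_real (1 / A (n + N) - 1 / m) * ?C s"] AN[of n]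
            by (simp only: norm_mult norm_divide norm_of_real abs_of_pos)
          also have "\<dots> \<le> cmod (?S (n + N) s - ?C s) / A (n + N) + ?c (n + N)"
            by (intro add_left_mono mult_left_mono C_bound) auto
          finally show ?thesis unfolding charp charQ .
        qed
        have i: "set_integrable lborel {-T..T} (\<lambda>s. cmod (?S (n + N) s - ?C s) / A (n + N))"
          using int[of "n + N"] by (rule set_integrable_divide)
        have "(LINT s:{-T..T}|lborel. cmod (char (p n) (?\<tau> n * of_int (step_count (?\<tau> n) s)) - char Q s))
            \<le> (LINT s:{-T..T}|lborel. cmod (?S (n + N) s - ?C s) / A (n + N) + ?c (n + N))"
          unfolding set_lebesgue_integral_def
        proof (rule integral_mono')
          show "integrable lborel (\<lambda>s. indicator {-T..T} s *\<^sub>R (cmod (?S (n + N) s - ?C s) / A (n + N) + ?c (n + N)))"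
            using set_integral_add(1)[OF i intc[of "?c (n + N)"]] by (simp only: set_integrable_def)
          show "indicator {-T..T} s *\<^sub>R cmod (char (p n) (?\<tau> n * of_int (step_count (?\<tau> n) s)) - char Q s)
              \<le> indicator {-T..T} s *\<^sub>R (cmod (?S (n + N) s - ?C s) / A (n + N) + ?c (n + N))" for s
            using pt[of s] by (simp split: split_indicator)
          show "0 \<le> indicator {-T..T} s *\<^sub>R (cmod (?S (n + N) s - ?C s) / A (n + N) + ?c (n + N))" for s
            using AN[of n] m by (intro scaleR_nonneg_nonneg add_nonneg_nonneg divide_nonneg_nonneg) auto
        qed
        also have "\<dots> = (LINT s:{-T..T}|lborel. cmod (?S (n + N) s - ?C s) / A (n + N)) + (LINT s:{-T..T}|lborel. ?c (n + N))"
          by (rule set_integral_add(2)[OF i intc])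
        also have "\<dots> = ?e (n + N) / A (n + N) + ?c (n + N) * (2 * T)"
          using T by (simp add: set_lebesgue_integral_def flip: times_divide_eq_right)
        finally show ?thesis .
      qed
      have "(\<lambda>n. ?e (n + N) / A (n + N) + ?c (n + N) * (2 * T)) \<longlonglongrightarrow> 0 / m + \<bar>1 / m - 1 / m\<bar> * m * (2 * T)"
        using m by (intro tendsto_intros LIMSEQ_ignore_initial_segment[OF conv[OF T]] LIMSEQ_ignore_initial_segment[OF total]) auto
      then have "(\<lambda>n. ?e (n + N) / A (n + N) + ?c (n + N) * (2 * T)) \<longlonglongrightarrow> 0" by simp
      then show "(\<lambda>n. LINT s:{-T..T}|lborel. cmod (char (p n) (?\<tau> n * of_int (step_count (?\<tau> n) s)) - char Q s)) \<longlonglongrightarrow> 0"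
      proof (rule tendsto_sandwich[OF _ _ tendsto_const, rotated 2])
        show "\<forall>\<^sub>F n in sequentially. 0 \<le> (LINT s:{-T..T}|lborel. cmod (char (p n) (?\<tau> n * of_int (step_count (?\<tau> n) s)) - char Q s))"
          by (intro always_eventually allI) (simp add: set_lebesgue_integral_def)
      qed (use le in simp)
    qed
    from weak_conv_imp_uniform_limit_convolution[OF rd Q this lip bdd]
    have unif: "uniform_limit UNIV (\<lambda>n x. LINT y|p n. \<phi> (x - y)) (\<lambda>x. LINT y|Q. \<phi> (x - y)) sequentially" .
    show ?thesis
    proof (rule uniform_limitI)
      fix e :: real assume e: "e > 0"
      have AN_lim: "(\<lambda>n. A (n + N)) \<longlonglongrightarrow> m" by (rule LIMSEQ_ignore_initial_segment[OF total])
      have "\<forall>\<^sub>F n in sequentially. A (n + N) < 2 * m"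
        using AN_lim m by (intro order_tendstoD) auto
      moreover have "(\<lambda>n. \<bar>A (n + N) - m\<bar> * B) \<longlonglongrightarrow> \<bar>m - m\<bar> * B"
        by (intro tendsto_intros AN_lim)
      then have "\<forall>\<^sub>F n in sequentially. \<bar>A (n + N) - m\<bar> * B < e / 2"
        using e by (intro order_tendstoD) auto
      \<comment> \<open>The masses stay below 2m, so this error of the normalised convolutions
        becomes at most e/2 after rescaling.\<close>
      moreover have "\<forall>\<^sub>F n in sequentially. \<forall>x\<in>UNIV. dist (LINT y|p n. \<phi> (x - y)) (LINT y|Q. \<phi> (x - y)) < e / (4 * m)"
        using unif e m by (intro uniform_limitD) auto
      ultimately have shifted: "\<forall>\<^sub>F n in sequentially. \<forall>x\<in>UNIV.
          dist (\<Sum>k=1..q (n + N). a (n + N) k * \<phi> (x - \<omega> (n + N) k)) (LINT y|\<nu>. \<phi> (x - y)) < e"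
      proof eventually_elim
        case (elim n)
        show ?case
        proof
          fix x
          let ?F = "LINT y|p n. \<phi> (x - y)" and ?G = "LINT y|Q. \<phi> (x - y)"
          have F: "(\<Sum>k=1..q (n + N). a (n + N) k * \<phi> (x - \<omega> (n + N) k)) = A (n + N) * ?F"
            using AN[of n] by (subst pint) (simp_all add: sum_distrib_left)
          have G: "(LINT y|\<nu>. \<phi> (x - y)) = m * ?G"
            using m by (subst Qint) simp_all
          have Gb: "\<bar>?G\<bar> \<le> B" using \<phi>i[of x] m unfolding G by (simp add: abs_mult)
          have "A (n + N) * ?F - m * ?G = A (n + N) * (?F - ?G) + (A (n + N) - m) * ?G"
            by (simp add: algebra_simps)
          then have "\<bar>A (n + N) * ?F - m * ?G\<bar> \<le> A (n + N) * \<bar>?F - ?G\<bar> + \<bar>A (n + N) - m\<bar> * \<bar>?G\<bar>"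
            using abs_triangle_ineq[of "A (n + N) * (?F - ?G)" "(A (n + N) - m) * ?G"] AN[of n] by (simp add: abs_mult)
          also have "\<dots> \<le> 2 * m * (e / (4 * m)) + \<bar>A (n + N) - m\<bar> * B"
            using elim(1,3) AN[of n] Gb m by (intro add_mono mult_mono) (auto simp: dist_real_def less_imp_le)
          also have "\<dots> < e" using elim(2) m e by simp
          finally show "dist (\<Sum>k=1..q (n + N). a (n + N) k * \<phi> (x - \<omega> (n + N) k)) (LINT y|\<nu>. \<phi> (x - y)) < e"
            unfolding F G dist_real_def .
        qed
      qed
      show "\<forall>\<^sub>F n in sequentially. \<forall>x\<in>UNIV. dist (\<Sum>k=1..q n. a n k * \<phi> (x - \<omega> n k)) (LINT y|\<nu>. \<phi> (x - y)) < e"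
        by (rule eventually_sequentially_seg[THEN iffD1]) (fact shifted)
    qed
  qed
qed

section \<open>The smoothing kernel\<close>

text \<open>The classical function that is flat at 0. The kernel is a multiple of its composition
  with 1 - ((x - y)/\<alpha>)^2, so smoothness of the kernel at the edge of its support reduces to
  the behaviour of \<open>flat_exp\<close> at the single point 0.\<close>

definition flat_exp :: "real \<Rightarrow> real" where
  "flat_exp u = (if u > 0 then exp (- 1 / u) else 0)"

definition flat_exp_deriv :: "real \<Rightarrow> real" where
  "flat_exp_deriv u = (if u > 0 then exp (- 1 / u) / u\<^sup>2 else 0)"

lemma isCont_flat_exp_deriv: "isCont flat_exp_deriv u"
proof -
  consider "u > 0" | "u < 0" | "u = 0" by linarith
  then show ?thesis
  proof cases
    case 1
    then have "\<forall>\<^sub>F x in nhds u. flat_exp_deriv x = exp (- 1 / x) / x\<^sup>2"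
      using eventually_nhds_in_open[of "{0<..}" u] by (auto simp: flat_exp_deriv_def elim!: eventually_mono)
    then have "isCont flat_exp_deriv u \<longleftrightarrow> isCont (\<lambda>x. exp (- 1 / x) / x\<^sup>2) u"
      by (rule isCont_cong)
    with 1 show ?thesis by (auto intro!: continuous_intros)
  next
    case 2
    then have "\<forall>\<^sub>F x in nhds u. flat_exp_deriv x = 0"
      using eventually_nhds_in_open[of "{..<0}" u] by (auto simp: flat_exp_deriv_def elim!: eventually_mono)
    then have "isCont flat_exp_deriv u \<longleftrightarrow> isCont (\<lambda>x. 0::real) u"
      by (rule isCont_cong)
    then show ?thesis by simp
  next
    case 3
    have "(flat_exp_deriv \<longlongrightarrow> 0) (at_left 0)"
      by (rule tendsto_eventually) (auto simp: eventually_at_filter flat_exp_deriv_def)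
    \<comment> \<open>The exponential decay of exp(-1/x) beats the pole of 1/x^2.\<close>
    moreover have "((\<lambda>x::real. exp (- 1 / x) / x\<^sup>2) \<longlongrightarrow> 0) (at_right 0)"
      by real_asymp
    then have "(flat_exp_deriv \<longlongrightarrow> 0) (at_right 0)"
      by (rule Lim_transform_eventually) (auto simp: eventually_at_filter flat_exp_deriv_def)
    ultimately show ?thesis
      unfolding 3 isCont_def by (simp add: filterlim_at_split flat_exp_deriv_def)
  qed
qed

lemma DERIV_flat_exp: "(flat_exp has_real_derivative flat_exp_deriv u) (at u)"
proof -
  consider "u > 0" | "u < 0" | "u = 0" by linarith
  then show ?thesis
  proof cases
    case 1
    have "\<forall>\<^sub>F x in nhds u. flat_exp x = exp (- 1 / x)"
      using 1 eventually_nhds_in_open[of "{0<..}" u] by (auto simp: flat_exp_def elim!: eventually_mono)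
    moreover have "((\<lambda>x. exp (- 1 / x)) has_real_derivative flat_exp_deriv u) (at u)"
      using 1 by (auto intro!: derivative_eq_intros simp: flat_exp_deriv_def power2_eq_square)
    ultimately show ?thesis by (subst DERIV_cong_ev[OF refl _ refl])
  next
    case 2
    have "\<forall>\<^sub>F x in nhds u. flat_exp x = 0"
      using 2 eventually_nhds_in_open[of "{..<0}" u] by (auto simp: flat_exp_def elim!: eventually_mono)
    moreover have "((\<lambda>x. 0) has_real_derivative flat_exp_deriv u) (at u)"
      using 2 by (auto simp: flat_exp_deriv_def)
    ultimately show ?thesis by (subst DERIV_cong_ev[OF refl _ refl])
  next
    case 3
    have "((\<lambda>y. flat_exp y / y) \<longlongrightarrow> 0) (at_left 0)"
      by (rule tendsto_eventually) (auto simp: eventually_at_filter flat_exp_def)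
    moreover have "((\<lambda>y::real. exp (- 1 / y) / y) \<longlongrightarrow> 0) (at_right 0)"
      by real_asymp
    then have "((\<lambda>y. flat_exp y / y) \<longlongrightarrow> 0) (at_right 0)"
      by (rule Lim_transform_eventually) (auto simp: eventually_at_filter flat_exp_def)
    ultimately show ?thesis
      unfolding 3 has_field_derivative_iff by (simp add: filterlim_at_split flat_exp_def flat_exp_deriv_def)
  qed
qed

lemma bump_kernel_eq_flat_exp:
  assumes "\<alpha> > 0"
  shows "bump_kernel \<alpha> x y = bump_constant / \<alpha> * flat_exp (1 - ((x - y) / \<alpha>)\<^sup>2)"
proof -
  have "\<bar>x - y\<bar> < \<alpha> \<longleftrightarrow> 1 - ((x - y) / \<alpha>)\<^sup>2 > 0"
    using assms abs_square_less_1[of "(x - y) / \<alpha>"] by simp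
  then show ?thesis
    by (simp add: bump_kernel_def flat_exp_def power_divide)
qed

lemma bump_kernel_diff: "bump_kernel \<alpha> x y = bump_kernel \<alpha> 0 (x - y)"
proof -
  have "\<bar>0 - (x - y)\<bar> = \<bar>x - y\<bar>" by simp
  then show ?thesis unfolding bump_kernel_def by (simp only:)
qed

text \<open>Boundedness and the Lipschitz estimate serve weak convergence; the continuous, compactly
  supported derivative serves the distributional pairing. The Lipschitz constant is a bound of the
  derivative on the compact support, outside of which the derivative vanishes.\<close>

lemma bump_kernel_C1:
  assumes "\<alpha> > 0"
  obtains D :: "real \<Rightarrow> real" and L B
  where "\<And>x. isCont D x"
    and "\<And>x. (bump_kernel \<alpha> 0 has_real_derivative D x) (at x)"
    and "\<And>x. \<bar>D x\<bar> \<le> L" and "\<And>x. \<bar>x\<bar> \<ge> \<alpha> \<Longrightarrow> D x = 0"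
    and "\<And>x y. \<bar>bump_kernel \<alpha> 0 x - bump_kernel \<alpha> 0 y\<bar> \<le> L * \<bar>x - y\<bar>"
    and "\<And>x. \<bar>bump_kernel \<alpha> 0 x\<bar> \<le> B"
proof -
  have eq: "bump_kernel \<alpha> 0 = (\<lambda>y. bump_constant / \<alpha> * flat_exp (1 - (y / \<alpha>)\<^sup>2))"
    using bump_kernel_eq_flat_exp[OF assms, of 0] by auto
  define D where "D y = bump_constant / \<alpha> * (flat_exp_deriv (1 - (y / \<alpha>)\<^sup>2) * (- (2 * (y / \<alpha>) / \<alpha>)))" for y
  have Dc: "isCont D x" for x
    unfolding D_def using assms
    by (intro continuous_intros isCont_o2[OF _ isCont_flat_exp_deriv]) auto
  have Dd: "(bump_kernel \<alpha> 0 has_real_derivative D x) (at x)" for x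
    unfolding eq D_def
    by (rule DERIV_cmult, rule DERIV_chain'[OF _ DERIV_flat_exp])
      (use assms in \<open>auto intro!: derivative_eq_intros\<close>)
  have D0: "D x = 0" if "\<bar>x\<bar> \<ge> \<alpha>" for x
  proof -
    have "(x / \<alpha>)\<^sup>2 \<ge> 1"
      using that assms abs_square_less_1[of "x / \<alpha>"] by (simp add: not_less[symmetric])
    then show ?thesis by (simp add: D_def flat_exp_deriv_def)
  qed
  have "bounded (D ` {-\<alpha>..\<alpha>})"
    by (intro compact_imp_bounded compact_continuous_image continuous_at_imp_continuous_on) (auto simp: Dc)
  then obtain L0 where L0: "\<forall>x\<in>{-\<alpha>..\<alpha>}. \<bar>D x\<bar> \<le> L0"
    by (auto simp: bounded_iff)
  have Db: "\<bar>D x\<bar> \<le> \<bar>L0\<bar>" for x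
    using L0 D0[of x] by (cases "\<bar>x\<bar> \<ge> \<alpha>") (auto simp: abs_le_iff dest!: bspec[of _ _ x])
  have fb: "\<bar>bump_kernel \<alpha> 0 x\<bar> \<le> \<bar>bump_constant / \<alpha>\<bar>" for x
  proof -
    have "\<bar>flat_exp u\<bar> \<le> 1" for u by (auto simp: flat_exp_def)
    then show ?thesis
      unfolding eq abs_mult by (intro mult_left_le) auto
  qed
  have "\<bar>bump_kernel \<alpha> 0 x - bump_kernel \<alpha> 0 y\<bar> \<le> \<bar>L0\<bar> * \<bar>x - y\<bar>" for x y
    using field_differentiable_bound[of UNIV "bump_kernel \<alpha> 0" D "\<bar>L0\<bar>" x y] Dd Db by simp
  then show thesis using that[of D "\<bar>L0\<bar>"] Dc Dd Db D0 fb by blast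
qed

text \<open>Fubini turns the pairing with the derivative of the distribution function into the
  iterated integral \<open>- \<integral> (\<integral>\<^sub>\<eta>\<^sup>\<infinity> D) \<partial>\<nu>(\<eta>)\<close>, where \<open>D\<close> is the derivative of the kernel.\<close>

lemma smoothed_distributional_derivative:
  assumes \<alpha>: "\<alpha> > 0" and "finite_measure \<nu>" and sets[measurable_cong]: "sets \<nu> = sets borel"
    and c: "\<And>x. c x = of_real (measure \<nu> {..<x})"
  shows "smoothed \<alpha> (distributional_derivative c) w = of_real (LINT x|\<nu>. bump_kernel \<alpha> 0 (w - x))"
proof -
  interpret \<nu>: finite_measure \<nu> by fact
  obtain D L B where Dc: "\<And>x. isCont D x"
    and Dd: "\<And>x. (bump_kernel \<alpha> 0 has_real_derivative D x) (at x)"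
    and Db: "\<And>x. \<bar>D x\<bar> \<le> L" and D0: "\<And>x. \<bar>x\<bar> \<ge> \<alpha> \<Longrightarrow> D x = 0"
    using bump_kernel_C1[OF \<alpha>] by metis
  have bw: "bump_kernel \<alpha> w \<xi> = bump_kernel \<alpha> 0 (\<xi> - w)" for \<xi>
    by (simp add: bump_kernel_def abs_minus_commute)
  have even: "bump_kernel \<alpha> 0 (- x) = bump_kernel \<alpha> 0 x" for x
    by (simp add: bump_kernel_def)
  have D': "((\<lambda>\<xi>. bump_kernel \<alpha> 0 (\<xi> - w)) has_real_derivative D (\<xi> - w)) (at \<xi>)" for \<xi>
    using DERIV_shift[of "bump_kernel \<alpha> 0" "D (\<xi> - w)" \<xi> "- w"] Dd by simp
  have vd: "vector_derivative (\<lambda>\<xi>. complex_of_real (bump_kernel \<alpha> w \<xi>)) (at \<xi>) = of_real (D (\<xi> - w))" for \<xi>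
    unfolding bw using D'[of \<xi>]
    by (intro vector_derivative_at has_vector_derivative_of_real) (simp add: has_real_derivative_iff_has_vector_derivative)
  have [measurable]: "D \<in> borel_measurable borel"
    by (intro borel_measurable_continuous_onI continuous_at_imp_continuous_on ballI Dc)
  have univ: "space \<nu> = UNIV" using sets_eq_imp_space_eq[OF sets] by simp
  let ?F = "\<lambda>(\<xi>::real, \<eta>::real). D (\<xi> - w) * indicator {\<eta><..} \<xi>"
  have ml: "measure \<nu> {..<\<xi>} = (LINT \<eta>|\<nu>. indicator {\<eta><..} \<xi>)" for \<xi> :: real
  proof -
    have "(LINT \<eta>|\<nu>. indicator {\<eta><..} \<xi> :: real) = (LINT \<eta>|\<nu>. indicator {..<\<xi>} \<eta>)"
      by (intro Bochner_Integration.integral_cong) (auto split: split_indicator)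
    then show ?thesis using univ by simp
  qed
  interpret pair_sigma_finite lborel \<nu> ..
  have Fm: "?F \<in> borel_measurable (lborel \<Otimes>\<^sub>M \<nu>)"
    unfolding indicator_def greaterThan_iff by measurable
  \<comment> \<open>The derivative vanishes outside a strip of width 2\<alpha>, and the strip has
    finite product measure because \<nu> is finite.\<close>
  have Fi: "integrable (lborel \<Otimes>\<^sub>M \<nu>) ?F"
  proof (rule Bochner_Integration.integrable_bound[OF _ Fm])
    show "integrable (lborel \<Otimes>\<^sub>M \<nu>) (\<lambda>p. L * indicator ({w-\<alpha>..w+\<alpha>} \<times> UNIV) p)"
      using univ sets
      by (intro integrable_mult_right integrable_real_indicator)
        (auto simp: \<nu>.emeasure_pair_measure_Times emeasure_lborel_Icc_eq ennreal_mult_eq_top_iff less_top[symmetric])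
    have "norm (?F p) \<le> norm (L * indicator ({w-\<alpha>..w+\<alpha>} \<times> UNIV) p)" for p
      using Db[of "fst p - w"] D0[of "fst p - w"]
      by (cases p) (auto split: split_indicator)
    then show "AE p in lborel \<Otimes>\<^sub>M \<nu>. norm (?F p) \<le> norm (L * indicator ({w-\<alpha>..w+\<alpha>} \<times> UNIV) p)"
      by simp
  qed
  have inner: "(LINT \<xi>|lborel. ?F (\<xi>, \<eta>)) = - bump_kernel \<alpha> 0 (w - \<eta>)" for \<eta>
  proof -
    \<comment> \<open>Beyond b the derivative vanishes, so the half-line can be cut there and the
      fundamental theorem of calculus applies. The kernel is zero at b - w, which leaves only the
      boundary term at \<eta>.\<close>
    define b where "b = max \<eta> (w + \<alpha>)"
    have b: "\<eta> \<le> b" "w + \<alpha> \<le> b" by (auto simp: b_def)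
    have "(LINT \<xi>|lborel. ?F (\<xi>, \<eta>)) = (LINT \<xi>|lborel. D (\<xi> - w) * indicator {\<eta>..b} \<xi>)"
    proof (rule integral_cong_AE)
      have "AE \<xi> in lborel. \<xi> \<noteq> \<eta>" by (rule AE_lborel_singleton)
      then show "AE \<xi> in lborel. ?F (\<xi>, \<eta>) = D (\<xi> - w) * indicator {\<eta>..b} \<xi>"
        by eventually_elim (use b D0 in \<open>auto split: split_indicator\<close>)
    qed auto
    also have "\<dots> = bump_kernel \<alpha> 0 (b - w) - bump_kernel \<alpha> 0 (\<eta> - w)"
      using b D' by (intro integral_FTC_Icc_real) (auto intro!: isCont_o2[OF _ Dc])
    also have "\<dots> = - bump_kernel \<alpha> 0 (w - \<eta>)"
      using b \<alpha> even[of "w - \<eta>"] by (simp add: bump_kernel_def)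
    finally show ?thesis .
  qed
  have "smoothed \<alpha> (distributional_derivative c) w = - (LINT \<xi>|lborel. of_real (D (\<xi> - w)) * of_real (measure \<nu> {..<\<xi>}))"
    by (simp add: smoothed_def distributional_derivative_def vd c)
  also have "\<dots> = of_real (- (LINT \<xi>|lborel. D (\<xi> - w) * measure \<nu> {..<\<xi>}))"
    by (simp flip: of_real_mult)
  also have "(LINT \<xi>|lborel. D (\<xi> - w) * measure \<nu> {..<\<xi>}) = (LINT \<xi>|lborel. LINT \<eta>|\<nu>. ?F (\<xi>, \<eta>))"
    unfolding ml by simp
  also have "\<dots> = (LINT \<eta>|\<nu>. LINT \<xi>|lborel. ?F (\<xi>, \<eta>))"
    using Fubini_integral[OF Fi] by simp
  also have "\<dots> = - (LINT \<eta>|\<nu>. bump_kernel \<alpha> 0 (w - \<eta>))"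
    unfolding inner by simp
  finally show ?thesis by simp
qed

section \<open>Square-integrable functions\<close>

lemma cnj_measurable [measurable]: "cnj \<in> borel_measurable borel"
  by (intro borel_measurable_continuous_onI continuous_intros)

lemma L2_iff: "g \<in> L2 M \<longleftrightarrow> g \<in> borel_measurable M \<and> integrable M (\<lambda>x. (cmod (g x))\<^sup>2)"
  by (simp add: L2_def)

lemma L2_measurable [measurable_dest]: "g \<in> L2 M \<Longrightarrow> g \<in> borel_measurable M"
  by (simp add: L2_def)

lemma L2_integrable_prod:
  assumes "g \<in> L2 M" "h \<in> L2 M"
  shows "integrable M (\<lambda>x. cmod (g x) * cmod (h x))" and "integrable M (\<lambda>x. cnj (g x) * h x)"
proof -
  have "integrable M (\<lambda>x. (cmod (g x))\<^sup>2 + (cmod (h x))\<^sup>2)"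
    using assms by (auto simp: L2_iff)
  moreover have "cmod (g x) * cmod (h x) \<le> (cmod (g x))\<^sup>2 + (cmod (h x))\<^sup>2" for x
    using sum_squares_bound[of "cmod (g x)" "cmod (h x)"]
      mult_nonneg_nonneg[OF norm_ge_zero[of "g x"] norm_ge_zero[of "h x"]] by linarith
  moreover have [measurable]: "g \<in> borel_measurable M" "h \<in> borel_measurable M"
    using assms by (auto simp: L2_iff)
  ultimately show "integrable M (\<lambda>x. cmod (g x) * cmod (h x))" "integrable M (\<lambda>x. cnj (g x) * h x)"
    by (auto intro: Bochner_Integration.integrable_bound simp: norm_mult)
qed

lemma L2_scale: "g \<in> L2 M \<Longrightarrow> (\<lambda>x. c * g x) \<in> L2 M"
  by (auto simp: L2_iff norm_mult power_mult_distrib)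

lemma L2_add:
  assumes "g \<in> L2 M" "h \<in> L2 M" shows "(\<lambda>x. g x + h x) \<in> L2 M"
proof -
  have "integrable M (\<lambda>x. 2 * (cmod (g x))\<^sup>2 + 2 * (cmod (h x))\<^sup>2)"
    using assms by (auto simp: L2_iff)
  moreover have "(cmod (g x + h x))\<^sup>2 \<le> 2 * (cmod (g x))\<^sup>2 + 2 * (cmod (h x))\<^sup>2" for x
  proof -
    have "(cmod (g x + h x))\<^sup>2 \<le> (cmod (g x) + cmod (h x))\<^sup>2"
      by (intro power_mono norm_triangle_ineq) auto
    then show ?thesis using sum_squares_bound[of "cmod (g x)" "cmod (h x)"] by (simp add: power2_sum)
  qed
  moreover have [measurable]: "g \<in> borel_measurable M" "h \<in> borel_measurable M"
    using assms by (auto simp: L2_iff)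
  ultimately show ?thesis
    by (auto simp: L2_iff intro: Bochner_Integration.integrable_bound)
qed

lemma L2_diff:
  assumes "g \<in> L2 M" "h \<in> L2 M" shows "(\<lambda>x. g x - h x) \<in> L2 M"
  using L2_add[OF assms(1) L2_scale[OF assms(2), of "-1"]] by simp

lemma L2_zero: "(\<lambda>x. 0) \<in> L2 M"
  by (simp add: L2_iff)

lemma L2_sum: "(\<And>i. i \<in> I \<Longrightarrow> f i \<in> L2 M) \<Longrightarrow> (\<lambda>x. \<Sum>i\<in>I. f i x) \<in> L2 M"
  by (induction I rule: infinite_finite_induct) (auto intro: L2_zero L2_add)

lemma (in finite_measure) L2_indicator: "A \<in> sets M \<Longrightarrow> (indicator A :: 'a \<Rightarrow> complex) \<in> L2 M"
  by (auto simp: L2_iff indicator_def if_distrib[of cmod] intro!: integrable_const_bound[of _ 1])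

lemma norm_L2_nonneg [simp]: "norm_L2 M g \<ge> 0"
  by (simp add: norm_L2_def)

lemma norm_L2_sq: "(norm_L2 M g)\<^sup>2 = (LINT x|M. (cmod (g x))\<^sup>2)"
  by (simp add: norm_L2_def)

lemma norm_L2_cong_AE:
  assumes "AE x in M. g x = h x" "g \<in> L2 M" "h \<in> L2 M"
  shows "norm_L2 M g = norm_L2 M h"
proof -
  have "(LINT x|M. (cmod (g x))\<^sup>2) = (LINT x|M. (cmod (h x))\<^sup>2)"
    by (rule integral_cong_AE) (use assms in \<open>auto simp: L2_iff elim: eventually_mono\<close>)
  then show ?thesis by (simp add: norm_L2_def)
qed

lemma inner_L2_cong_AE:
  assumes "AE x in M. g x = g' x" "AE x in M. h x = h' x" "g \<in> L2 M" "h \<in> L2 M" "g' \<in> L2 M" "h' \<in> L2 M"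
  shows "inner_L2 M g h = inner_L2 M g' h'"
  unfolding inner_L2_def
proof (rule integral_cong_AE)
  have [measurable]: "g \<in> borel_measurable M" "h \<in> borel_measurable M" "g' \<in> borel_measurable M" "h' \<in> borel_measurable M"
    using assms by (auto simp: L2_iff)
  show "(\<lambda>x. cnj (g x) * h x) \<in> borel_measurable M" "(\<lambda>x. cnj (g' x) * h' x) \<in> borel_measurable M"
    by measurable
  show "AE x in M. cnj (g x) * h x = cnj (g' x) * h' x"
    using assms(1,2) by eventually_elim simp
qed

lemma inner_L2_self: "inner_L2 M g g = of_real ((norm_L2 M g)\<^sup>2)"
  unfolding inner_L2_def norm_L2_sq integral_complex_of_real[symmetric]
  by (intro Bochner_Integration.integral_cong refl) (simp only: complex_norm_square mult.commute)

lemma inner_L2_cnj: "cnj (inner_L2 M g h) = inner_L2 M h g"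
  unfolding inner_L2_def Bochner_Integration.integral_cnj[symmetric]
  by (intro Bochner_Integration.integral_cong refl) (simp add: mult.commute)

lemma inner_L2_add_right:
  assumes "g \<in> L2 M" "h \<in> L2 M" "h' \<in> L2 M"
  shows "inner_L2 M g (\<lambda>x. h x + h' x) = inner_L2 M g h + inner_L2 M g h'"
  unfolding inner_L2_def using assms by (simp add: distrib_left L2_integrable_prod(2))

lemma inner_L2_diff_right:
  assumes "g \<in> L2 M" "h \<in> L2 M" "h' \<in> L2 M"
  shows "inner_L2 M g (\<lambda>x. h x - h' x) = inner_L2 M g h - inner_L2 M g h'"
  unfolding inner_L2_def using assms by (simp add: right_diff_distrib L2_integrable_prod(2))

lemma inner_L2_scale_right: "inner_L2 M g (\<lambda>x. c * h x) = c * inner_L2 M g h"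
  unfolding inner_L2_def by (simp add: mult.left_commute)

lemma inner_L2_sum_right:
  assumes "g \<in> L2 M" "\<And>i. i \<in> I \<Longrightarrow> h i \<in> L2 M"
  shows "inner_L2 M g (\<lambda>x. \<Sum>i\<in>I. h i x) = (\<Sum>i\<in>I. inner_L2 M g (h i))"
  unfolding inner_L2_def using assms
  by (simp add: sum_distrib_left L2_integrable_prod(2))

text \<open>Discriminant argument: the integral of (s|g| - |h|)^2 is a nonnegative quadratic
  polynomial in s, evaluated at its minimiser. If the leading coefficient is 0, the polynomial is
  affine and nonnegative for all s, so its slope vanishes.\<close>

lemma inner_L2_Cauchy_Schwarz:
  assumes "g \<in> L2 M" "h \<in> L2 M"
  shows "cmod (inner_L2 M g h) \<le> norm_L2 M g * norm_L2 M h"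
proof -
  have "cmod (inner_L2 M g h) \<le> (LINT x|M. cmod (g x) * cmod (h x))"
    unfolding inner_L2_def by (rule order_trans[OF integral_norm_bound]) (simp add: norm_mult)
  also have "\<dots> \<le> norm_L2 M g * norm_L2 M h"
  proof (rule power2_le_imp_le)
    let ?a = "LINT x|M. (cmod (g x))\<^sup>2" and ?b = "LINT x|M. cmod (g x) * cmod (h x)" and ?c = "LINT x|M. (cmod (h x))\<^sup>2"
    have i: "integrable M (\<lambda>x. (cmod (g x))\<^sup>2)" "integrable M (\<lambda>x. (cmod (h x))\<^sup>2)" "integrable M (\<lambda>x. cmod (g x) * cmod (h x))"
      using assms L2_integrable_prod(1)[OF assms] by (auto simp: L2_iff)
    have pos: "0 \<le> s\<^sup>2 * ?a - 2 * s * ?b + ?c" for s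
    proof -
      have "0 \<le> (LINT x|M. (s * cmod (g x) - cmod (h x))\<^sup>2)" by simp
      also have "\<dots> = (LINT x|M. s\<^sup>2 * (cmod (g x))\<^sup>2 - 2 * s * (cmod (g x) * cmod (h x)) + (cmod (h x))\<^sup>2)"
        by (intro Bochner_Integration.integral_cong refl) (simp add: power2_diff power_mult_distrib algebra_simps)
      also have "\<dots> = s\<^sup>2 * ?a - 2 * s * ?b + ?c" using i by simp
      finally show ?thesis .
    qed
    have "?b\<^sup>2 \<le> ?a * ?c"
    proof (cases "?a = 0")
      case True
      then have *: "2 * s * ?b \<le> ?c" for s using pos[of s] by simp
      have "?b = 0"
      proof (rule ccontr)
        assume "?b \<noteq> 0"
        \<comment> \<open>This choice of s makes the left side equal to the right side plus
          1.\<close>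
        then show False using *[of "(?c + 1) / (2 * ?b)"] by simp
      qed
      then show ?thesis by simp
    next
      case False
      moreover have "?a \<ge> 0" by simp
      ultimately have a: "?a > 0" by linarith
      show ?thesis using pos[of "?b / ?a"] a by (simp add: field_simps power2_eq_square)
    qed
    then show "?b\<^sup>2 \<le> (norm_L2 M g * norm_L2 M h)\<^sup>2" by (simp add: power_mult_distrib norm_L2_sq)
  qed simp
  finally show ?thesis .
qed

lemma inner_L2_tendsto_right:
  assumes "g \<in> L2 M" "\<And>n. h n \<in> L2 M" "h' \<in> L2 M"
    and "(\<lambda>n. norm_L2 M (\<lambda>x. h n x - h' x)) \<longlonglongrightarrow> 0"
  shows "(\<lambda>n. inner_L2 M g (h n)) \<longlonglongrightarrow> inner_L2 M g h'"
proof (rule LIM_zero_cancel, rule Lim_null_comparison)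
  show "\<forall>\<^sub>F n in sequentially. norm (inner_L2 M g (h n) - inner_L2 M g h') \<le> norm_L2 M g * norm_L2 M (\<lambda>x. h n x - h' x)"
    using inner_L2_Cauchy_Schwarz[OF assms(1) L2_diff[OF assms(2,3)]]
    by (simp add: inner_L2_diff_right assms(1-3))
  show "(\<lambda>n. norm_L2 M g * norm_L2 M (\<lambda>x. h n x - h' x)) \<longlonglongrightarrow> 0"
    using tendsto_mult_right_zero[OF assms(4)] .
qed

section \<open>Scalar spectral measures\<close>

text \<open>\<open>has_pvm_integral\<close> speaks about all uniformly convergent sequences of
  simple functions, so it yields nothing until one of them is exhibited. Real and imaginary parts
  are rounded down to multiples of 1/(k+1); boundedness of f leaves finitely many values. The common
  bound serves as dominating constant later.\<close>

lemma simple_function_uniform_approx: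
  fixes f :: "real \<Rightarrow> complex"
  assumes [measurable]: "f \<in> borel_measurable borel" and bdd: "\<And>x. cmod (f x) \<le> C"
  obtains s :: "nat \<Rightarrow> real \<Rightarrow> complex" where "\<And>k. simple_function borel (s k)"
    and "uniform_limit UNIV s f sequentially" and "\<And>k x. cmod (s k x) \<le> C + 2"
proof -
  define r where "r k y = of_int \<lfloor>real (Suc k) * y\<rfloor> / real (Suc k)" for k :: nat and y :: real
  define s where "s k x = Complex (r k (Re (f x))) (r k (Im (f x)))" for k x
  have r: "\<bar>r k y - y\<bar> \<le> 1 / real (Suc k)" for k y
  proof -
    have "r k y - y = (of_int \<lfloor>real (Suc k) * y\<rfloor> - real (Suc k) * y) / real (Suc k)"
      unfolding r_def by (simp add: diff_divide_distrib del: of_nat_Suc)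
    moreover have "\<bar>of_int \<lfloor>real (Suc k) * y\<rfloor> - real (Suc k) * y\<bar> \<le> 1" by linarith
    ultimately show ?thesis by (simp add: divide_right_mono del: of_nat_Suc)
  qed
  have sd: "cmod (s k x - f x) \<le> 2 / real (Suc k)" for k x
  proof -
    have "cmod (s k x - f x) \<le> \<bar>Re (s k x - f x)\<bar> + \<bar>Im (s k x - f x)\<bar>"
      by (rule cmod_le)
    also have "\<dots> \<le> 1 / real (Suc k) + 1 / real (Suc k)"
      unfolding s_def by (intro add_mono) (simp_all add: r del: of_nat_Suc)
    finally show ?thesis by simp
  qed
  have "finite (range (s k))" for k
  proof -
    let ?J = "(\<lambda>j. of_int j / real (Suc k)) ` {\<lfloor>- (real (Suc k) * C)\<rfloor>..\<lfloor>real (Suc k) * C\<rfloor>}"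
    have rJ: "r k y \<in> ?J" if "\<bar>y\<bar> \<le> C" for y
    proof -
      have "- (real (Suc k) * C) \<le> real (Suc k) * y" "real (Suc k) * y \<le> real (Suc k) * C"
        using mult_left_mono[of "-C" y "real (Suc k)"] mult_left_mono[of y C "real (Suc k)"] that by (auto simp del: of_nat_Suc)
      then have "\<lfloor>real (Suc k) * y\<rfloor> \<in> {\<lfloor>- (real (Suc k) * C)\<rfloor>..\<lfloor>real (Suc k) * C\<rfloor>}"
        by (auto intro!: floor_mono)
      then show ?thesis unfolding r_def by blast
    qed
    have "s k x \<in> (\<lambda>(a, b). Complex a b) ` (?J \<times> ?J)" for x
      using rJ[OF order_trans[OF abs_Re_le_cmod bdd[of x]]] rJ[OF order_trans[OF abs_Im_le_cmod bdd[of x]]]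
      unfolding s_def by (intro image_eqI[of _ _ "(r k (Re (f x)), r k (Im (f x)))"]) auto
    then have "range (s k) \<subseteq> (\<lambda>(a, b). Complex a b) ` (?J \<times> ?J)" by blast
    then show ?thesis by (rule finite_subset) auto
  qed
  moreover have "s k \<in> borel_measurable borel" for k
  proof -
    have "s k = (\<lambda>x. of_real (r k (Re (f x))) + \<i> * of_real (r k (Im (f x))))"
      by (auto simp: s_def complex_eq_iff)
    then show ?thesis unfolding r_def by simp
  qed
  ultimately have "simple_function borel (s k)" for k
    by (simp add: simple_function_borel_measurable)
  moreover have "uniform_limit UNIV s f sequentially"
  proof (rule uniform_limitI)
    fix e :: real assume "e > 0"
    have "(\<lambda>k. 2 / real (Suc k)) \<longlonglongrightarrow> 0"
      using LIMSEQ_Suc[OF lim_const_over_n[of 2]] by simp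
    then have "\<forall>\<^sub>F k in sequentially. 2 / real (Suc k) < e" using \<open>e > 0\<close> by (rule order_tendstoD)
    then show "\<forall>\<^sub>F k in sequentially. \<forall>x\<in>UNIV. dist (s k x) (f x) < e"
      by eventually_elim (auto simp: dist_norm intro: le_less_trans[OF sd] simp del: of_nat_Suc)
  qed
  moreover have "cmod (s k x) \<le> C + 2" for k x
  proof -
    have "cmod (s k x) \<le> cmod (f x) + cmod (s k x - f x)"
      using norm_triangle_ineq[of "f x" "s k x - f x"] by simp
    also have "\<dots> \<le> C + 2 / real (Suc k)" by (intro add_mono bdd sd)
    also have "\<dots> \<le> C + 2" by (simp add: field_simps)
    finally show ?thesis .
  qed
  ultimately show thesis using that by blast
qed

lemma pvm_L2: "projection_valued_measure M E \<Longrightarrow> B \<in> sets borel \<Longrightarrow> g \<in> L2 M \<Longrightarrow> E B g \<in> L2 M"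
  by (simp add: projection_valued_measure_def)

text \<open>Idempotence and self-adjointness of the projection, each of which holds for classes of
  almost equal functions only.\<close>

lemma pvm_inner_self:
  assumes E: "projection_valued_measure M E" and B: "B \<in> sets borel" and g: "g \<in> L2 M"
  shows "inner_L2 M (E B g) g = of_real ((norm_L2 M (E B g))\<^sup>2)"
    and "inner_L2 M g (E B g) = of_real ((norm_L2 M (E B g))\<^sup>2)"
proof -
  have L: "E B g \<in> L2 M" "E B (E B g) \<in> L2 M" using pvm_L2[OF E B] g by auto
  have "inner_L2 M (E B g) (E B g) = inner_L2 M g (E B (E B g))"
    using E B g L unfolding projection_valued_measure_def by blast
  also have "\<dots> = inner_L2 M g (E B g)"
    using E B g L unfolding projection_valued_measure_def by (intro inner_L2_cong_AE) auto
  finally show "inner_L2 M g (E B g) = of_real ((norm_L2 M (E B g))\<^sup>2)"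
    by (simp add: inner_L2_self)
  moreover have "inner_L2 M (E B g) g = inner_L2 M g (E B g)"
    using E B g unfolding projection_valued_measure_def by blast
  ultimately show "inner_L2 M (E B g) g = of_real ((norm_L2 M (E B g))\<^sup>2)" by simp
qed

text \<open>Strong additivity is tested against g: the numbers <g, E B g> are countably additive by
  continuity of the inner product, and by \<open>pvm_inner_self\<close> they are the nonnegative
  masses wanted here.\<close>

lemma pvm_scalar_measure:
  assumes E: "projection_valued_measure M E" and g: "g \<in> L2 M"
  obtains \<nu> :: "real measure" where "finite_measure \<nu>" "sets \<nu> = sets borel"
    "\<And>B. B \<in> sets borel \<Longrightarrow> measure \<nu> B = (norm_L2 M (E B g))\<^sup>2"
proof -
  define m where "m B = ennreal ((norm_L2 M (E B g))\<^sup>2)" for B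
  define \<nu> where "\<nu> = measure_of UNIV (sets (borel :: real measure)) m"
  have em: "emeasure \<nu> B = m B" if B: "B \<in> sets borel" for B
    unfolding \<nu>_def
  proof (rule emeasure_measure_of_sigma)
    show "sigma_algebra UNIV (sets (borel :: real measure))"
      using sets.sigma_algebra_axioms[of "borel :: real measure"] by simp
    have "norm_L2 M (E {} g) = norm_L2 M (\<lambda>_. 0)"
      using E g unfolding projection_valued_measure_def by (intro norm_L2_cong_AE) (auto simp: L2_zero)
    then show "positive (sets borel) m" by (simp add: positive_def m_def norm_L2_def)
    show "countably_additive (sets borel) m"
      unfolding countably_additive_def
    proof (intro allI impI)
      fix A :: "nat \<Rightarrow> real set"
      assume A: "range A \<subseteq> sets borel" "disjoint_family A" "(\<Union>i. A i) \<in> sets borel"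
      have Ai: "A i \<in> sets borel" for i using A(1) by auto
      have L: "E (A i) g \<in> L2 M" "E (\<Union>i. A i) g \<in> L2 M" for i
        using pvm_L2[OF E _ g] A(3) Ai by auto
      have "(\<lambda>n. norm_L2 M (\<lambda>x. (\<Sum>i<n. E (A i) g x) - E (\<Union>i. A i) g x)) \<longlonglongrightarrow> 0"
        using E g A unfolding projection_valued_measure_def by blast
      then have "(\<lambda>n. inner_L2 M g (\<lambda>x. \<Sum>i<n. E (A i) g x)) \<longlonglongrightarrow> inner_L2 M g (E (\<Union>i. A i) g)"
        by (intro inner_L2_tendsto_right g L L2_sum)
      then have "(\<lambda>n. \<Sum>i<n. complex_of_real ((norm_L2 M (E (A i) g))\<^sup>2)) \<longlonglongrightarrow> of_real ((norm_L2 M (E (\<Union>i. A i) g))\<^sup>2)"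
        by (simp only: inner_L2_sum_right[OF g L(1)] pvm_inner_self(2)[OF E _ g] Ai A(3))
      then have "(\<lambda>i. (norm_L2 M (E (A i) g))\<^sup>2) sums (norm_L2 M (E (\<Union>i. A i) g))\<^sup>2"
        unfolding sums_def of_real_sum[symmetric] tendsto_of_real_iff .
      then show "(\<Sum>i. m (A i)) = m (\<Union>i. A i)"
        unfolding m_def by (intro suminf_ennreal_eq) auto
    qed
  qed (fact B)
  have sets: "sets \<nu> = sets borel"
    unfolding \<nu>_def using sets.sigma_sets_eq[of "borel :: real measure"] by (simp add: sets_measure_of_conv)
  show thesis
  proof
    show "finite_measure \<nu>"
      using em[of "space \<nu>"] sets_eq_imp_space_eq[OF sets] by (intro finite_measureI) (simp add: m_def)
    show "measure \<nu> B = (norm_L2 M (E B g))\<^sup>2" if "B \<in> sets borel" for B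
      using em[OF that] by (simp add: measure_def m_def)
  qed (fact sets)
qed

text \<open>For simple functions both sides are the same finite sum. In the limit the scalar
  integrals converge by dominated convergence and the inner products by Cauchy-Schwarz. Applied to
  exponentials, this computes the Fourier transform of the scalar spectral measure.\<close>

lemma pvm_integral_bounded:
  assumes E: "projection_valued_measure M E" and g: "g \<in> L2 M"
    and \<nu>: "finite_measure \<nu>" and sets[measurable_cong]: "sets \<nu> = sets borel"
    and m: "\<And>B. B \<in> sets borel \<Longrightarrow> measure \<nu> B = (norm_L2 M (E B g))\<^sup>2"
    and f[measurable]: "f \<in> borel_measurable borel" and bdd: "\<And>x. cmod (f x) \<le> C"
    and int: "has_pvm_integral M E f g h" and h: "h \<in> L2 M"
  shows "(LINT x|\<nu>. f x) = inner_L2 M g h"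
proof -
  interpret finite_measure \<nu> by fact
  have univ: "space \<nu> = UNIV" using sets_eq_imp_space_eq[OF sets] by simp
  obtain s :: "nat \<Rightarrow> real \<Rightarrow> complex" where s: "\<And>k. simple_function borel (s k)"
    and lim: "uniform_limit UNIV s f sequentially" and sb: "\<And>k x. cmod (s k x) \<le> C + 2"
    using simple_function_uniform_approx[OF f bdd] by blast
  have fin: "finite (range (s k))" for k
    using s[of k] by (simp add: simple_function_def)
  have sm[measurable]: "s k \<in> borel_measurable borel" for k
    using s by (rule borel_measurable_simple_function)
  have sets_s: "s k -` {z} \<in> sets borel" for k z
    using measurable_sets[OF sm, of "{z}"] by simp
  have "inner_L2 M g (simple_pvm_integral E (s k) g) = (LINT x|\<nu>. s k x)" for k
  proof -
    have L: "(\<lambda>x. z * E (s k -` {z}) g x) \<in> L2 M" for z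
      by (intro L2_scale pvm_L2[OF E sets_s g])
    have "inner_L2 M g (simple_pvm_integral E (s k) g) = (\<Sum>z\<in>range (s k). z * of_real (measure \<nu> (s k -` {z})))"
      unfolding simple_pvm_integral_def
      by (subst inner_L2_sum_right[OF g L]) (simp add: inner_L2_scale_right pvm_inner_self(2)[OF E sets_s g] m[OF sets_s])
    also have "\<dots> = (\<Sum>z\<in>range (s k). LINT x|\<nu>. indicator (s k -` {z}) x *\<^sub>R z)"
      by (intro sum.cong refl) (use sets_s sets in \<open>simp add: univ scaleR_conv_of_real mult.commute\<close>)
    also have "\<dots> = (LINT x|\<nu>. (\<Sum>z\<in>range (s k). indicator (s k -` {z}) x *\<^sub>R z))"
      by (intro Bochner_Integration.integral_sum[symmetric] integrable_scaleR_left integrable_real_indicator)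
        (use sets_s sets in \<open>auto simp: less_top[symmetric]\<close>)
    also have "\<dots> = (LINT x|\<nu>. s k x)"
    proof (intro Bochner_Integration.integral_cong refl)
      fix x
      have "(\<Sum>z\<in>range (s k). indicator (s k -` {z}) x *\<^sub>R z) = (\<Sum>z\<in>range (s k). if s k x = z then z else 0)"
        by (intro sum.cong) (auto split: split_indicator)
      then show "(\<Sum>z\<in>range (s k). indicator (s k -` {z}) x *\<^sub>R z) = s k x"
        using fin by simp
    qed
    finally show ?thesis .
  qed
  moreover have "(\<lambda>k. inner_L2 M g (simple_pvm_integral E (s k) g)) \<longlonglongrightarrow> inner_L2 M g h"
  proof (rule inner_L2_tendsto_right[OF g _ h])
    show "simple_pvm_integral E (s k) g \<in> L2 M" for k
      unfolding simple_pvm_integral_def by (intro L2_sum L2_scale pvm_L2[OF E sets_s g])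
    show "(\<lambda>k. norm_L2 M (\<lambda>x. simple_pvm_integral E (s k) g x - h x)) \<longlonglongrightarrow> 0"
      using int s lim by (simp add: has_pvm_integral_def)
  qed
  moreover have "(\<lambda>k. LINT x|\<nu>. s k x) \<longlonglongrightarrow> (LINT x|\<nu>. f x)"
  proof (rule integral_dominated_convergence[where w="\<lambda>_. C + 2"])
    show "AE x in \<nu>. (\<lambda>k. s k x) \<longlonglongrightarrow> f x"
      by (intro AE_I2 tendsto_uniform_limitI[OF lim]) simp
  qed (use sb in auto)
  ultimately show ?thesis using LIMSEQ_unique by simp
qed

section \<open>Hausdorff distance and invariant measures\<close>

lemma norm_induced_metric:
  assumes "norm_induced d"
  shows "d x y \<ge> 0" "d x x = 0" "d x y = d y x" "d x z \<le> d x y + d y z" "d x y = 0 \<Longrightarrow> x = y"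
proof -
  obtain N where N: "is_norm N" and d: "\<And>x y. d x y = N (x - y)"
    using assms by (auto simp: norm_induced_def)
  have N0: "N x = 0 \<longleftrightarrow> x = 0" and Ns: "N (c *\<^sub>R x) = \<bar>c\<bar> * N x" and Nt: "N (x + y) \<le> N x + N y" for c x y
    using N by (auto simp: is_norm_def)
  have Nm: "N (- x) = N x" for x using Ns[of "-1" x] by simp
  show "d x y \<ge> 0" using Nt[of "x - y" "- (x - y)"] Nm[of "x - y"] N0[of 0] by (simp add: d)
  show "d x x = 0" using N0[of 0] by (simp add: d)
  show "d x y = d y x" using Nm[of "x - y"] by (simp add: d)
  show "d x z \<le> d x y + d y z" using Nt[of "x - y" "y - z"] by (simp add: d)
  show "x = y" if "d x y = 0" using that N0[of "x - y"] by (simp add: d)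
qed

text \<open>Equivalence of norms in finite dimension: the upper constant comes from expanding in the
  basis, the lower one is the minimum of the norm on the compact Euclidean unit sphere. It links
  Hausdorff distances, taken in d, with the Euclidean topology that underlies compactness and Borel
  sets.\<close>

lemma norm_induced_equivalent:
  fixes d :: "'a::euclidean_space \<Rightarrow> 'a \<Rightarrow> real"
  assumes "norm_induced d"
  obtains c C where "c > 0" "C > 0" "\<And>x y. d x y \<le> C * dist x y" "\<And>x y. c * dist x y \<le> d x y"
proof -
  obtain N where N: "is_norm N" and d: "\<And>x y. d x y = N (x - y)"
    using assms by (auto simp: norm_induced_def)
  have N0: "N x = 0 \<longleftrightarrow> x = 0" and Ns: "N (c *\<^sub>R x) = \<bar>c\<bar> * N x" and Nt: "N (x + y) \<le> N x + N y" for c x y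
    using N by (auto simp: is_norm_def)
  have Npos: "N x \<ge> 0" for x using norm_induced_metric(1)[OF assms, of x 0] by (simp add: d)
  have Nsum: "N (\<Sum>i\<in>I. h i) \<le> (\<Sum>i\<in>I. N (h i))" if "finite I" for h :: "'a \<Rightarrow> 'a" and I
    using that
  proof (induction I)
    case (insert i I)
    then show ?case using Nt[of "h i" "sum h I"] by simp
  qed (use N0[of 0] in simp)
  define C where "C = (\<Sum>b\<in>(Basis::'a set). N b) + 1"
  have C: "C > 0" unfolding C_def using sum_nonneg[of Basis N] Npos by (simp add: add_nonneg_pos)
  have up: "N x \<le> C * norm x" for x
  proof -
    have "N x \<le> (\<Sum>b\<in>Basis. N ((x \<bullet> b) *\<^sub>R b))"
      using Nsum[OF finite_Basis, of "\<lambda>b. (x \<bullet> b) *\<^sub>R b"] by (simp add: euclidean_representation)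
    also have "\<dots> \<le> (\<Sum>b\<in>Basis. norm x * N b)"
      unfolding Ns by (intro sum_mono mult_right_mono Basis_le_norm Npos)
    also have "\<dots> = (\<Sum>b\<in>(Basis::'a set). N b) * norm x" by (simp add: sum_distrib_left mult.commute)
    also have "\<dots> \<le> C * norm x" unfolding C_def by (intro mult_right_mono) auto
    finally show ?thesis .
  qed
  have "C-lipschitz_on (sphere 0 1) N"
    unfolding lipschitz_on_def
  proof (intro conjI ballI)
    fix x y :: 'a
    have "N x \<le> N y + N (x - y)" "N y \<le> N x + N (y - x)"
      using Nt[of y "x - y"] Nt[of x "y - x"] by simp_all
    then show "dist (N x) (N y) \<le> C * dist x y"
      using up[of "x - y"] up[of "y - x"] by (simp add: dist_norm norm_minus_commute abs_le_iff)
  qed (use C in simp)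
  then have "continuous_on (sphere 0 1) N" by (rule lipschitz_on_continuous_on)
  moreover have "sphere (0::'a) 1 \<noteq> {}"
    using norm_some_Basis by (metis empty_iff mem_sphere_0)
  ultimately obtain u where u: "u \<in> sphere 0 1" "\<And>x. x \<in> sphere 0 1 \<Longrightarrow> N u \<le> N x"
    using continuous_attains_inf[OF compact_sphere] by metis
  have "u \<noteq> 0" using u(1) by auto
  then have c: "N u > 0" using N0[of u] Npos[of u] by simp
  have low: "N u * norm x \<le> N x" for x
  proof (cases "x = 0")
    case False
    then have "N u \<le> N ((1 / norm x) *\<^sub>R x)" by (intro u(2)) simp
    then show ?thesis using False by (simp add: Ns field_simps)
  qed (simp add: Npos)
  show thesis
    by (rule that[OF c C]) (simp_all add: d dist_norm up low)
qed

section \<open>Hausdorff distance inside a compact set\<close>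

locale compact_metric_region =
  fixes X :: "'a::euclidean_space set" and d :: "'a \<Rightarrow> 'a \<Rightarrow> real"
  assumes compact_X: "compact X" and d_norm: "norm_induced d"
begin

lemmas d_nonneg = norm_induced_metric(1)[OF d_norm]
  and d_self = norm_induced_metric(2)[OF d_norm]
  and d_commute = norm_induced_metric(3)[OF d_norm]
  and d_triangle = norm_induced_metric(4)[OF d_norm]
  and d_eq_0 = norm_induced_metric(5)[OF d_norm]

lemma d_bounded:
  obtains D where "D \<ge> 0" "\<And>x y. x \<in> X \<Longrightarrow> y \<in> X \<Longrightarrow> d x y \<le> D"
proof -
  obtain c C where C: "C > 0" "\<And>x y. d x y \<le> C * dist x y"
    using norm_induced_equivalent[OF d_norm] by metis
  have "bounded X" using compact_X by (rule compact_imp_bounded)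
  then obtain e where e: "\<And>x y. x \<in> X \<Longrightarrow> y \<in> X \<Longrightarrow> dist x y \<le> e"
    using bounded_two_points[of X] by auto
  have "d x y \<le> C * \<bar>e\<bar>" if "x \<in> X" "y \<in> X" for x y
    using C(2)[of x y] e[OF that] C(1) by (meson abs_ge_self less_imp_le mult_left_mono order_trans)
  then show thesis using that[of "C * \<bar>e\<bar>"] C by simp
qed

lemma bdd_below_d: "bdd_below ((\<lambda>a. d a x) ` A)" "bdd_below ((\<lambda>b. d x b) ` A)"
  by (auto intro!: bdd_belowI[of _ 0] d_nonneg)

lemma infd_lipschitz:
  assumes "A \<noteq> {}" shows "(INF a\<in>A. d a x) \<le> (INF a\<in>A. d a y) + d x y"
proof -
  have "(INF a\<in>A. d a x) - d x y \<le> (INF a\<in>A. d a y)"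
  proof (rule cINF_greatest[OF assms])
    fix a assume "a \<in> A"
    then have "(INF a\<in>A. d a x) \<le> d a x" by (intro cINF_lower bdd_below_d)
    then show "(INF a\<in>A. d a x) - d x y \<le> d a y"
      using d_triangle[of a x y] d_commute[of x y] by linarith
  qed
  then show ?thesis by simp
qed

text \<open>The distance to a set is 1-Lipschitz for d, hence Lipschitz for the Euclidean metric by
  comparison of the norms.\<close>

lemma continuous_on_infd:
  assumes "A \<noteq> {}" shows "continuous_on Y (\<lambda>x. INF a\<in>A. d a x)"
proof -
  obtain c C where C: "C > 0" "\<And>x y. d x y \<le> C * dist x y"
    using norm_induced_equivalent[OF d_norm] by metis
  have "C-lipschitz_on Y (\<lambda>x. INF a\<in>A. d a x)"
    unfolding lipschitz_on_def
  proof (intro conjI ballI)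
    fix x y
    show "dist (INF a\<in>A. d a x) (INF a\<in>A. d a y) \<le> C * dist x y"
      using infd_lipschitz[OF assms, of x y] infd_lipschitz[OF assms, of y x] C(2)[of x y] d_commute[of x y]
      unfolding dist_real_def by linarith
  qed (use C(1) in simp)
  then show ?thesis by (rule lipschitz_on_continuous_on)
qed

text \<open>A supremum of reals bounds its elements only if the family is bounded above; compactness
  of X enters here for that reason.\<close>

lemma infd_le_hausdorff:
  assumes "A \<subseteq> X" "B \<subseteq> X" "A \<noteq> {}" "b \<in> B"
  shows "(INF a\<in>A. d a b) \<le> hausdorff_distance d A B"
proof -
  obtain D where D: "\<And>x y. x \<in> X \<Longrightarrow> y \<in> X \<Longrightarrow> d x y \<le> D" using d_bounded by metis
  obtain a0 where a0: "a0 \<in> A" using assms by auto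
  have "bdd_above ((\<lambda>b. INF a\<in>A. d a b) ` B)"
  proof (rule bdd_aboveI2)
    fix b assume "b \<in> B"
    then show "(INF a\<in>A. d a b) \<le> D"
      using a0 assms(1,2) by (intro cINF_lower2[OF bdd_below_d(1) a0] D) auto
  qed
  then have "(INF a\<in>A. d a b) \<le> (SUP b\<in>B. INF a\<in>A. d a b)"
    using assms by (intro cSUP_upper)
  then show ?thesis by (simp add: hausdorff_distance_def)
qed

lemma infd_le_hausdorff':
  assumes "A \<subseteq> X" "B \<subseteq> X" "B \<noteq> {}" "a \<in> A"
  shows "(INF b\<in>B. d a b) \<le> hausdorff_distance d A B"
proof -
  have "hausdorff_distance d A B = hausdorff_distance d B A"
    by (simp add: hausdorff_distance_def max.commute d_commute)
  moreover have "(INF b\<in>B. d a b) = (INF b\<in>B. d b a)" by (simp add: d_commute)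
  ultimately show ?thesis using infd_le_hausdorff[OF assms(2,1,3,4)] by simp
qed

lemma hausdorff_le:
  assumes "A \<noteq> {}" "B \<noteq> {}"
    and "\<And>a. a \<in> A \<Longrightarrow> (INF b\<in>B. d a b) \<le> e" and "\<And>b. b \<in> B \<Longrightarrow> (INF a\<in>A. d a b) \<le> e"
  shows "hausdorff_distance d A B \<le> e"
  unfolding hausdorff_distance_def using assms by (intro max.boundedI cSUP_least) auto

lemma hausdorff_le_pointwise:
  assumes "A \<noteq> {}" "B \<noteq> {}"
    and "\<And>a. a \<in> A \<Longrightarrow> \<exists>b\<in>B. d a b \<le> e" and "\<And>b. b \<in> B \<Longrightarrow> \<exists>a\<in>A. d a b \<le> e"
  shows "hausdorff_distance d A B \<le> e"
proof (rule hausdorff_le[OF assms(1,2)])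
  fix a assume "a \<in> A"
  then obtain b where b: "b \<in> B" "d a b \<le> e" using assms(3) by blast
  then show "(INF b\<in>B. d a b) \<le> e" by (intro cINF_lower2[OF bdd_below_d(2) b(1)])
next
  fix b assume "b \<in> B"
  then obtain a where a: "a \<in> A" "d a b \<le> e" using assms(4) by blast
  then show "(INF a\<in>A. d a b) \<le> e" by (intro cINF_lower2[OF bdd_below_d(1) a(1)])
qed

lemma hausdorff_nonneg:
  assumes "A \<subseteq> X" "B \<subseteq> X" "A \<noteq> {}" "B \<noteq> {}" shows "hausdorff_distance d A B \<ge> 0"
proof -
  obtain b where b: "b \<in> B" using assms by auto
  have "0 \<le> (INF a\<in>A. d a b)" using assms by (intro cINF_greatest d_nonneg)
  also have "\<dots> \<le> hausdorff_distance d A B" using assms b by (intro infd_le_hausdorff)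
  finally show ?thesis .
qed

text \<open>A triangle inequality in which the first two sets are compared pointwise; no infimum has
  to be attained, so none of the sets needs to be compact.\<close>

lemma hausdorff_perturb:
  assumes "A' \<subseteq> X" "B \<subseteq> X" "A \<noteq> {}" "A' \<noteq> {}" "B \<noteq> {}"
    and "\<And>a. a \<in> A \<Longrightarrow> \<exists>a'\<in>A'. d a a' \<le> e" and "\<And>a'. a' \<in> A' \<Longrightarrow> \<exists>a\<in>A. d a a' \<le> e"
  shows "hausdorff_distance d A B \<le> hausdorff_distance d A' B + e"
proof (rule hausdorff_le)
  fix a assume "a \<in> A"
  then obtain a' where a': "a' \<in> A'" "d a a' \<le> e" using assms by blast
  have "(INF b\<in>B. d a b) \<le> (INF b\<in>B. d a' b) + d a a'"
    using infd_lipschitz[of B a a'] assms by (simp add: d_commute)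
  then show "(INF b\<in>B. d a b) \<le> hausdorff_distance d A' B + e"
    using infd_le_hausdorff'[of A' B a'] assms a' by linarith
next
  fix b assume b: "b \<in> B"
  have "(INF a\<in>A. d a b) - e \<le> (INF a'\<in>A'. d a' b)"
  proof (rule cINF_greatest)
    fix a' assume "a' \<in> A'"
    then obtain a where a: "a \<in> A" "d a a' \<le> e" using assms by blast
    then have "(INF a\<in>A. d a b) \<le> d a b" by (intro cINF_lower bdd_below_d)
    then show "(INF a\<in>A. d a b) - e \<le> d a' b" using a d_triangle[of a b a'] by linarith
  qed (use assms in auto)
  then show "(INF a\<in>A. d a b) \<le> hausdorff_distance d A' B + e"
    using infd_le_hausdorff[of A' B b] assms b by linarith
qed (use assms in auto)

lemma infd_eq_0:
  assumes "compact K" "K \<noteq> {}" "(INF a\<in>K. d a x) \<le> 0" shows "x \<in> K"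
proof -
  have eq: "(\<lambda>a. INF b\<in>{x}. d b a) = (\<lambda>a. d a x)" by (simp add: d_commute)
  have "continuous_on K (\<lambda>a. d a x)"
    using continuous_on_infd[of "{x}" K] unfolding eq by simp
  then obtain a where a: "a \<in> K" "\<And>b. b \<in> K \<Longrightarrow> d a x \<le> d b x"
    using continuous_attains_inf[OF assms(1,2)] by metis
  then have "d a x \<le> (INF a\<in>K. d a x)" using assms by (intro cINF_greatest) auto
  then have "d a x = 0" using assms(3) d_nonneg[of a x] by linarith
  then show ?thesis using a d_eq_0 by metis
qed

end

section \<open>Measures of sets that are close to a compact set\<close>

locale measured_region = compact_metric_region X d
  for X :: "'a::euclidean_space set" and d +
  fixes M :: "'a measure"
  assumes ref: "reference_measure X M"
begin

lemma space_M: "space M = X" and sets_M: "sets M = sets (restrict_space borel X)"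
  using ref by (auto simp: reference_measure_def)

sublocale finite_measure M
  using ref by (simp add: reference_measure_def)

lemma X_borel: "X \<in> sets borel"
  using compact_X by (simp add: borel_compact)

lemma sets_M_iff: "A \<in> sets M \<longleftrightarrow> A \<in> sets borel \<and> A \<subseteq> X"
  unfolding sets_M using X_borel by (auto simp: sets_restrict_space_iff)

lemma compact_sets_M: "compact K \<Longrightarrow> K \<subseteq> X \<Longrightarrow> K \<in> sets M"
  by (simp add: sets_M_iff borel_compact)

lemma L2_ind: "A \<in> sets M \<Longrightarrow> (\<lambda>x. indicator A x :: complex) \<in> L2 M"
  using L2_indicator by simp

text \<open>Closed neighbourhoods of K with radii 1/(k+1) decrease to K, because a point at distance
  0 from a compact set belongs to it; a finite measure is continuous along such sequences.\<close>

lemma measure_thickening: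
  assumes K: "compact K" "K \<noteq> {}" "K \<subseteq> X" and e: "e > 0"
  obtains r where "r > 0" "{x \<in> X. (INF a\<in>K. d a x) \<le> r} \<in> sets M"
    "measure M ({x \<in> X. (INF a\<in>K. d a x) \<le> r} - K) < e"
proof -
  define V where "V k = {x \<in> X. (INF a\<in>K. d a x) \<le> 1 / real (Suc k)}" for k
  have Vs: "V k \<in> sets M" for k
  proof -
    have "closed (V k)"
      unfolding V_def using compact_imp_closed[OF compact_X]      continuous_closed_preimage[OF continuous_on_infd[OF K(2), of X], of "{..1 / real (Suc k)}"]
      by (simp add: vimage_def Int_def)
    then show ?thesis using X_borel by (auto simp: sets_M_iff V_def)
  qed
  have KV: "K \<subseteq> V k" for k
  proof
    fix x assume x: "x \<in> K"
    then have "(INF a\<in>K. d a x) \<le> d x x" by (intro cINF_lower bdd_below_d)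
    then have "(INF a\<in>K. d a x) \<le> 0" by (simp add: d_self)
    then have "(INF a\<in>K. d a x) \<le> 1 / real (Suc k)" by (rule order_trans) simp
    then show "x \<in> V k" using x K by (auto simp: V_def)
  qed
  have "(\<lambda>k. measure M (V k)) \<longlonglongrightarrow> measure M (\<Inter>k. V k)"
  proof (rule finite_Lim_measure_decseq)
    show "decseq V"
      unfolding decseq_def V_def
    proof (intro allI impI subsetI CollectI conjI)
      fix k l :: nat and x assume kl: "k \<le> l" and x: "x \<in> {x \<in> X. (INF a\<in>K. d a x) \<le> 1 / real (Suc l)}"
      have "1 / real (Suc l) \<le> 1 / real (Suc k)" using kl by (simp add: field_simps)
      then show "(INF a\<in>K. d a x) \<le> 1 / real (Suc k)" using x by (simp del: of_nat_Suc)
    qed simp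
  qed (use Vs in auto)
  moreover have "(\<Inter>k. V k) = K"
  proof
    show "(\<Inter>k. V k) \<subseteq> K"
    proof
      fix x assume x: "x \<in> (\<Inter>k. V k)"
      have "(\<lambda>k. 1 / real (Suc k)) \<longlonglongrightarrow> 0"
        using LIMSEQ_Suc[OF lim_const_over_n[of 1]] by simp
      then have "(INF a\<in>K. d a x) \<le> 0"
        by (rule LIMSEQ_le_const) (use x in \<open>auto simp: V_def\<close>)
      then show "x \<in> K" using infd_eq_0 K by blast
    qed
  qed (use KV in blast)
  ultimately have "(\<lambda>k. measure M (V k)) \<longlonglongrightarrow> measure M K" by simp
  then have "\<forall>\<^sub>F k in sequentially. measure M (V k) < measure M K + e"
    by (rule order_tendstoD) (use e in simp)
  then obtain k where "measure M (V k) < measure M K + e"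
    by (auto simp: eventually_sequentially)
  then have "measure M (V k - K) < e"
    using finite_measure_Diff[OF Vs compact_sets_M[OF K(1,3)] KV] by simp
  then show thesis using that[of "1 / real (Suc k)"] Vs by (simp add: V_def)
qed

text \<open>A set that is Hausdorff-close to K lies in a thin neighbourhood of K. Nothing similar
  holds for the opposite difference: a fine finite subset of K is close to K and yet misses all of
  its measure.\<close>

lemma measure_diff_tendsto_0:
  assumes K: "compact K" "K \<noteq> {}" "K \<subseteq> X"
    and Kn: "\<And>n. Kn n \<in> sets M" "\<And>n. Kn n \<noteq> {}"
    and lim: "(\<lambda>n. hausdorff_distance d K (Kn n)) \<longlonglongrightarrow> 0"
  shows "(\<lambda>n. measure M (Kn n - K)) \<longlonglongrightarrow> 0"
proof (rule order_tendstoI)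
  fix e :: real assume "e > 0"
  then obtain r where r: "r > 0" "{x \<in> X. (INF a\<in>K. d a x) \<le> r} \<in> sets M"
    "measure M ({x \<in> X. (INF a\<in>K. d a x) \<le> r} - K) < e"
    by (rule measure_thickening[OF K])
  have "\<forall>\<^sub>F n in sequentially. hausdorff_distance d K (Kn n) < r"
    using lim r(1) by (rule order_tendstoD)
  then show "\<forall>\<^sub>F n in sequentially. measure M (Kn n - K) < e"
  proof eventually_elim
    case (elim n)
    have "Kn n \<subseteq> X" using Kn(1)[of n] by (simp add: sets_M_iff)
    moreover have "(INF a\<in>K. d a x) \<le> r" if "x \<in> Kn n" for x
      using infd_le_hausdorff[OF K(3) \<open>Kn n \<subseteq> X\<close> K(2) that] elim by linarith
    ultimately have "Kn n \<subseteq> {x \<in> X. (INF a\<in>K. d a x) \<le> r}" by blast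
    then have "measure M (Kn n - K) \<le> measure M ({x \<in> X. (INF a\<in>K. d a x) \<le> r} - K)"
      using r(2) compact_sets_M[OF K(1,3)] by (intro finite_measure_mono) auto
    then show ?case using r(3) by simp
  qed
next
  fix a :: real assume "a < 0"
  then have "a < measure M (Kn n - K)" for n
    using measure_nonneg[of M "Kn n - K"] by linarith
  then show "\<forall>\<^sub>F n in sequentially. a < measure M (Kn n - K)" by simp
qed

lemma norm_L2_indicator_diff:
  assumes "A \<in> sets M" "B \<in> sets M"
  shows "(norm_L2 M (\<lambda>x. indicator A x - indicator B x))\<^sup>2 = measure M (A - B) + measure M (B - A)"
proof -
  have "(norm_L2 M (\<lambda>x. indicator A x - indicator B x))\<^sup>2
      = (LINT x|M. indicator (A - B) x + indicator (B - A) x)"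
    unfolding norm_L2_sq by (intro Bochner_Integration.integral_cong) (auto split: split_indicator)
  also have "\<dots> = measure M (A - B) + measure M (B - A)"
    using assms by (subst Bochner_Integration.integral_add)
      (auto simp: less_top[symmetric] intro!: integrable_real_indicator arg_cong[of _ _ "measure M"] dest: sets.sets_into_space)
  finally show ?thesis .
qed

text \<open>Hausdorff convergence is only upper semicontinuous for the measure; equality of the
  limiting measures turns it into convergence of the indicators.\<close>

lemma indicator_tendsto_L2:
  assumes K: "compact K" "K \<noteq> {}" "K \<subseteq> X"
    and Kn: "\<And>n. Kn n \<in> sets M" "\<And>n. Kn n \<noteq> {}"
    and lim: "(\<lambda>n. hausdorff_distance d K (Kn n)) \<longlonglongrightarrow> 0"
    and meas: "(\<lambda>n. measure M (Kn n)) \<longlonglongrightarrow> measure M K"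
  shows "(\<lambda>n. norm_L2 M (\<lambda>x. indicator (Kn n) x - indicator K x)) \<longlonglongrightarrow> 0"
proof -
  have Ks: "K \<in> sets M" by (rule compact_sets_M[OF K(1,3)])
  have 1: "(\<lambda>n. measure M (Kn n - K)) \<longlonglongrightarrow> 0"
    by (rule measure_diff_tendsto_0[OF K Kn lim])
  have "measure M (K - Kn n) = measure M K - measure M (Kn n) + measure M (Kn n - K)" for n
  proof -
    have "measure M (K - Kn n) = measure M K - measure M (K \<inter> Kn n)"
      using Ks Kn(1) by (simp add: finite_measure_Diff')
    moreover have "measure M (Kn n - K) = measure M (Kn n) - measure M (K \<inter> Kn n)"
      using Ks Kn(1) by (simp add: finite_measure_Diff' Int_commute)
    ultimately show ?thesis by simp
  qed
  moreover have "(\<lambda>n. measure M K - measure M (Kn n) + measure M (Kn n - K)) \<longlonglongrightarrow> measure M K - measure M K + 0"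
    by (intro tendsto_intros meas 1)
  ultimately have 2: "(\<lambda>n. measure M (K - Kn n)) \<longlonglongrightarrow> 0" by simp
  have "(\<lambda>n. sqrt (measure M (Kn n - K) + measure M (K - Kn n))) \<longlonglongrightarrow> sqrt (0 + 0)"
    by (intro tendsto_intros 1 2)
  moreover have "norm_L2 M (\<lambda>x. indicator (Kn n) x - indicator K x) = sqrt (measure M (Kn n - K) + measure M (K - Kn n))" for n
    using norm_L2_indicator_diff[OF Kn(1) Ks, of n] by (metis norm_L2_nonneg real_sqrt_unique)
  ultimately show ?thesis by simp
qed

end

section \<open>The flow acting on sets and on functions\<close>

locale measured_flow = measured_region X d M
  for X :: "'a::euclidean_space set" and d M +
  fixes S :: "real \<Rightarrow> 'a \<Rightarrow> 'a"
  assumes lip: "lipschitz_flow d X S" and inv: "flow_invariant M S"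
begin

lemma S_in: "x \<in> X \<Longrightarrow> S t x \<in> X" and S_add: "x \<in> X \<Longrightarrow> S t (S s x) = S (t + s) x" and S_0: "x \<in> X \<Longrightarrow> S 0 x = x"
  using lip by (auto simp: lipschitz_flow_def)

lemma S_minus: "x \<in> X \<Longrightarrow> S (- t) (S t x) = x" "x \<in> X \<Longrightarrow> S t (S (- t) x) = x"
  by (simp_all add: S_add S_0)

lemma S_lipschitz:
  assumes "T > 0"
  obtains L where "L \<ge> 0"
    "\<And>s t x. s \<in> {-T..T} \<Longrightarrow> t \<in> {-T..T} \<Longrightarrow> x \<in> X \<Longrightarrow> d (S s x) (S t x) \<le> L * \<bar>s - t\<bar>"
    "\<And>s x y. s \<in> {-T..T} \<Longrightarrow> x \<in> X \<Longrightarrow> y \<in> X \<Longrightarrow> d (S s x) (S s y) \<le> L * d x y"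
proof -
  obtain L where L: "\<And>s t x y. s \<in> {-T..T} \<Longrightarrow> t \<in> {-T..T} \<Longrightarrow> x \<in> X \<Longrightarrow> y \<in> X \<Longrightarrow>
      d (S s x) (S t y) \<le> L * sqrt (\<bar>s - t\<bar>\<^sup>2 + (d x y)\<^sup>2)"
  proof -
    have "\<exists>L. \<forall>s\<in>{-T..T}. \<forall>t\<in>{-T..T}. \<forall>x\<in>X. \<forall>y\<in>X. d (S s x) (S t y) \<le> L * prod_dist dist d (s, x) (t, y)"
      using lip assms by (simp add: lipschitz_flow_def)
    then obtain L where "\<forall>s\<in>{-T..T}. \<forall>t\<in>{-T..T}. \<forall>x\<in>X. \<forall>y\<in>X. d (S s x) (S t y) \<le> L * prod_dist dist d (s, x) (t, y)" ..
    then show thesis by (intro that[of L]) (simp add: prod_dist_def dist_real_def)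
  qed
  have L': "L * r \<le> \<bar>L\<bar> * r" if "r \<ge> 0" for r using that by (simp add: mult_right_mono)
  show thesis
  proof (rule that[of "\<bar>L\<bar>"])
    show "d (S s x) (S t x) \<le> \<bar>L\<bar> * \<bar>s - t\<bar>" if "s \<in> {-T..T}" "t \<in> {-T..T}" "x \<in> X" for s t x
      using L[OF that that(3)] L'[of "\<bar>s - t\<bar>"] by (simp add: d_self)
    show "d (S s x) (S s y) \<le> \<bar>L\<bar> * d x y" if "s \<in> {-T..T}" "x \<in> X" "y \<in> X" for s x y
      using L[OF that(1,1,2,3)] L'[of "d x y"] by (simp add: d_nonneg)
  qed simp
qed

lemma continuous_on_S: "continuous_on X (S t)"
proof -
  obtain L where L: "L \<ge> 0" "\<And>s x y. s \<in> {-(\<bar>t\<bar>+1)..\<bar>t\<bar>+1} \<Longrightarrow> x \<in> X \<Longrightarrow> y \<in> X \<Longrightarrow> d (S s x) (S s y) \<le> L * d x y"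
    by (rule S_lipschitz[of "\<bar>t\<bar> + 1"]) auto
  obtain c C where C: "c > 0" "C > 0" "\<And>x y. d x y \<le> C * dist x y" "\<And>x y. c * dist x y \<le> d x y"
    using norm_induced_equivalent[OF d_norm] by metis
  have "(L * C / c)-lipschitz_on X (S t)"
    unfolding lipschitz_on_def
  proof (intro conjI ballI)
    fix x y assume xy: "x \<in> X" "y \<in> X"
    have "c * dist (S t x) (S t y) \<le> d (S t x) (S t y)" by (rule C)
    also have "\<dots> \<le> L * d x y" using xy by (intro L(2)) auto
    also have "\<dots> \<le> L * (C * dist x y)" by (intro mult_left_mono C L)
    finally show "dist (S t x) (S t y) \<le> L * C / c * dist x y"
      using C(1) by (simp add: field_simps)
  qed (use L C in simp)
  then show ?thesis by (rule lipschitz_on_continuous_on)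
qed

lemma S_measurable [measurable]: "S t \<in> measurable M M"
proof -
  have "S t \<in> measurable (restrict_space borel X) (restrict_space borel X)"
    using continuous_on_S S_in by (intro measurable_restrict_space3 measurable_restrict_space2)
      (auto simp: space_restrict_space borel_measurable_continuous_on_restrict)
  then show ?thesis by (simp add: measurable_cong_sets[OF sets_M sets_M])
qed

text \<open>Images are preimages under the opposite time. This makes them measurable and connects
  invariance, which is stated for images, with composition of functions.\<close>

lemma S_image: "A \<subseteq> X \<Longrightarrow> S t ` A = {x \<in> X. S (- t) x \<in> A}"
proof (intro equalityI subsetI)
  fix x assume A: "A \<subseteq> X" and x: "x \<in> {x \<in> X. S (- t) x \<in> A}"
  then have "x = S t (S (- t) x)" using S_minus(2)[of x t] by simp
  then show "x \<in> S t ` A" using x by blast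
qed (auto simp: S_minus S_in subset_iff)

lemma S_image_sets: "A \<in> sets M \<Longrightarrow> S t ` A \<in> sets M"
  using measurable_sets[OF S_measurable, of A "- t"] S_image[of A t]
  by (auto simp: space_M vimage_def Int_def conj_commute sets_M_iff)

lemma measure_S_image: "A \<in> sets M \<Longrightarrow> measure M (S t ` A) = measure M A"
  using inv by (simp add: flow_invariant_def measure_def)

lemma compact_S_image: "compact K \<Longrightarrow> K \<subseteq> X \<Longrightarrow> compact (S t ` K)"
  using continuous_on_S by (meson compact_continuous_image continuous_on_subset)

lemma S_image_subset: "A \<subseteq> X \<Longrightarrow> S t ` A \<subseteq> X"
  using S_in by auto

lemma distr_S: "distr M M (S t) = M"
proof (rule measure_eqI)
  fix A assume "A \<in> sets (distr M M (S t))"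
  then have A: "A \<in> sets M" by simp
  have "S t -` A \<inter> space M = S (- t) ` A"
    using A S_image[of A "- t"] by (auto simp: space_M sets_M_iff)
  then show "emeasure (distr M M (S t)) A = emeasure M A"
    using A inv by (simp add: emeasure_distr flow_invariant_def)
qed simp

lemma koopman_L2:
  assumes "g \<in> L2 M" shows "koopman S t g \<in> L2 M" "norm_L2 M (koopman S t g) = norm_L2 M g"
proof -
  have [measurable]: "g \<in> borel_measurable M" using assms by (rule L2_measurable)
  have "integrable (distr M M (S t)) (\<lambda>x. (cmod (g x))\<^sup>2)"
    using assms by (simp add: distr_S L2_iff)
  then show "koopman S t g \<in> L2 M"
    by (simp add: L2_iff koopman_def comp_def integrable_distr_eq)
  have "(LINT x|distr M M (S t). (cmod (g x))\<^sup>2) = (LINT x|M. (cmod (g (S t x)))\<^sup>2)"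
    by (intro integral_distr) auto
  then show "norm_L2 M (koopman S t g) = norm_L2 M g"
    by (simp add: norm_L2_def koopman_def distr_S)
qed

text \<open>Composition with the flow pulls sets back, so time changes sign: correlations at time s
  are governed by set images at time -s throughout.\<close>

lemma inner_koopman_indicator:
  assumes "A \<subseteq> X"
  shows "inner_L2 M h (koopman S t (indicator A)) = inner_L2 M h (\<lambda>x. indicator (S (- t) ` A) x)"
  unfolding inner_L2_def koopman_def
  by (intro Bochner_Integration.integral_cong refl) (use S_image[OF assms, of "- t"] in \<open>auto simp: space_M indicator_def\<close>)

lemma S_image_close:
  assumes "T > 0"
  obtains L where "L \<ge> 0" "\<And>s t A a. s \<in> {-T..T} \<Longrightarrow> t \<in> {-T..T} \<Longrightarrow> A \<subseteq> X \<Longrightarrow> a \<in> S s ` A \<Longrightarrow> \<exists>a'\<in>S t ` A. d a a' \<le> L * \<bar>s - t\<bar>"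
proof -
  obtain L where L: "L \<ge> 0"
    "\<And>s t x. s \<in> {-T..T} \<Longrightarrow> t \<in> {-T..T} \<Longrightarrow> x \<in> X \<Longrightarrow> d (S s x) (S t x) \<le> L * \<bar>s - t\<bar>"
    by (rule S_lipschitz[OF assms]) (rule that; assumption)
  show thesis by (rule that[OF L(1)]) (use L(2) in blast)
qed

text \<open>The Lipschitz bound in time is uniform over X, so a whole set moves with bounded speed.
  Measurability in time of the approximation error rests on this.\<close>

lemma isCont_hausdorff_S:
  assumes A: "A \<subseteq> X" "A \<noteq> {}" and B: "B \<subseteq> X" "B \<noteq> {}"
  shows "isCont (\<lambda>s. hausdorff_distance d (S s ` A) B) t"
proof -
  define T where "T = \<bar>t\<bar> + 1"
  have T: "T > 0" by (simp add: T_def)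
  obtain L where L: "L \<ge> 0" "\<And>s t A a. s \<in> {-T..T} \<Longrightarrow> t \<in> {-T..T} \<Longrightarrow> A \<subseteq> X \<Longrightarrow> a \<in> S s ` A \<Longrightarrow> \<exists>a'\<in>S t ` A. d a a' \<le> L * \<bar>s - t\<bar>"
    by (rule S_image_close[OF T]) (rule that; assumption)
  have le: "hausdorff_distance d (S s ` A) B \<le> hausdorff_distance d (S s' ` A) B + L * \<bar>s - s'\<bar>"
    if "s \<in> {-T..T}" "s' \<in> {-T..T}" for s s'
  proof (rule hausdorff_perturb)
    fix a assume "a \<in> S s' ` A"
    then show "\<exists>a'\<in>S s ` A. d a' a \<le> L * \<bar>s - s'\<bar>"
      using L(2)[OF that(2,1) A(1)] by (auto simp: d_commute abs_minus_commute)
  qed (use A B S_image_subset L(2)[OF that A(1)] in auto)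
  show ?thesis
    unfolding isCont_def
  proof (rule LIM_zero_cancel, rule Lim_null_comparison)
    have "\<forall>\<^sub>F s in at t. s \<in> ball t 1" by (intro eventually_at_in_open') auto
    then show "\<forall>\<^sub>F s in at t. norm (hausdorff_distance d (S s ` A) B - hausdorff_distance d (S t ` A) B) \<le> L * \<bar>s - t\<bar>"
    proof eventually_elim
      case (elim s)
      then have "s \<in> {-T..T}" "t \<in> {-T..T}" by (auto simp: T_def dist_real_def)
      then show ?case using le[of s t] le[of t s] by (auto simp: abs_minus_commute)
    qed
    have "((\<lambda>s. L * \<bar>s - t\<bar>) \<longlongrightarrow> L * \<bar>t - t\<bar>) (at t)" by (intro tendsto_intros)
    then show "((\<lambda>s. L * \<bar>s - t\<bar>) \<longlongrightarrow> 0) (at t)" by simp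
  qed
qed

text \<open>The moving images of K are Hausdorff-continuous in time and keep their measure, so
  \<open>indicator_tendsto_L2\<close> makes their indicators continuous in mean square.\<close>

lemma isCont_inner_koopman_indicator:
  assumes K: "compact K" "K \<noteq> {}" "K \<subseteq> X" and h: "h \<in> L2 M"
  shows "isCont (\<lambda>s. inner_L2 M h (koopman S s (indicator K))) t"
  unfolding inner_koopman_indicator[OF K(3)]
proof (rule continuous_at_sequentiallyI)
  fix u :: "nat \<Rightarrow> real" assume u: "u \<longlonglongrightarrow> t"
  have Ks: "K \<in> sets M" by (rule compact_sets_M[OF K(1,3)])
  have "(\<lambda>n. hausdorff_distance d (S (- u n) ` K) (S (- t) ` K)) \<longlonglongrightarrow> hausdorff_distance d (S (- t) ` K) (S (- t) ` K)"
    by (rule isCont_tendsto_compose[OF isCont_hausdorff_S tendsto_minus[OF u]]) (use K S_image_subset in auto)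
  moreover have "hausdorff_distance d (S (- t) ` K) (S (- t) ` K) = 0"
    using K S_image_subset[OF K(3), of "-t"]
    by (intro antisym hausdorff_nonneg hausdorff_le_pointwise) (auto intro!: exI bexI simp: d_self)
  moreover have "hausdorff_distance d A B = hausdorff_distance d B A" for A B
    by (simp add: hausdorff_distance_def max.commute d_commute)
  ultimately have "(\<lambda>n. hausdorff_distance d (S (- t) ` K) (S (- u n) ` K)) \<longlonglongrightarrow> 0" by simp
  then show "(\<lambda>n. inner_L2 M h (\<lambda>x. indicator (S (- u n) ` K) x)) \<longlonglongrightarrow> inner_L2 M h (\<lambda>x. indicator (S (- t) ` K) x)"
    using K Ks by (intro inner_L2_tendsto_right indicator_tendsto_L2 h L2_ind S_image_sets compact_S_image S_image_subset)
      (auto simp: measure_S_image)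
qed

end

section \<open>Discrete correlations\<close>

lemma bij_betw_int_iterate:
  assumes "bij_betw f P P" shows "bij_betw (int_iterate P f j) P P"
  using bij_betw_funpow[OF assms, of "nat j"] bij_betw_funpow[OF bij_betw_inv_into[OF assms], of "nat (- j)"]
  by (simp add: int_iterate_def)

text \<open>\<open>inv_into\<close> inverts f on P only, so each induction step has to know that the
  iterates stay in P.\<close>

lemma int_iterate_minus_cancel:
  assumes f: "bij_betw f P P" and p: "p \<in> P"
  shows "int_iterate P f (- j) (int_iterate P f j p) = p"
proof -
  have 1: "(inv_into P f ^^ n) ((f ^^ n) p) = p" if "p \<in> P" for n p
    using that
  proof (induction n arbitrary: p)
    case (Suc n)
    have "(f ^^ n) p \<in> P" using bij_betw_funpow[OF f, of n] Suc.prems by (auto simp: bij_betw_def)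
    then have "inv_into P f (f ((f ^^ n) p)) = (f ^^ n) p"
      using f by (simp add: bij_betw_def)
    then show ?case using Suc by (simp add: funpow_swap1[of "inv_into P f"])
  qed simp
  have 2: "(f ^^ n) ((inv_into P f ^^ n) p) = p" if "p \<in> P" for n p
    using that
  proof (induction n arbitrary: p)
    case (Suc n)
    have "(inv_into P f ^^ n) p \<in> P"
      using bij_betw_funpow[OF bij_betw_inv_into[OF f], of n] Suc.prems by (auto simp: bij_betw_def)
    then have "f (inv_into P f ((inv_into P f ^^ n) p)) = (inv_into P f ^^ n) p"
      using f by (simp add: bij_betw_def f_inv_into_f)
    then show ?case using Suc by (simp add: funpow_swap1[of f])
  qed simp
  show ?thesis
    using 1[OF p, of "nat j"] 2[OF p, of "nat (- j)"] by (auto simp: int_iterate_def)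
qed

text \<open>Backward steps apply the hypothesis at the preimage and divide by the unimodular
  factor.\<close>

lemma int_iterate_eigen:
  fixes c :: "'b \<Rightarrow> complex"
  assumes f: "bij_betw f P P" and c: "\<And>p. p \<in> P \<Longrightarrow> c (f p) = exp (\<i> * of_real \<theta>) * c p" and p: "p \<in> P"
  shows "c (int_iterate P f j p) = exp (\<i> * of_real (of_int j * \<theta>)) * c p"
proof -
  have 1: "c ((f ^^ n) p) = exp (\<i> * of_real (real n * \<theta>)) * c p" for n
  proof (induction n)
    case (Suc n)
    have "(f ^^ n) p \<in> P" using bij_betw_funpow[OF f, of n] p by (auto simp: bij_betw_def)
    then show ?case using Suc c by (simp add: algebra_simps exp_add)
  qed simp
  have 2: "c ((inv_into P f ^^ n) p) = exp (\<i> * of_real (- real n * \<theta>)) * c p" for n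
  proof (induction n)
    case (Suc n)
    let ?p = "(inv_into P f ^^ n) p" and ?r = "inv_into P f ((inv_into P f ^^ n) p)"
    have "?p \<in> P"
      using bij_betw_funpow[OF bij_betw_inv_into[OF f], of n] p by (auto simp: bij_betw_def)
    then have r: "f ?r = ?p" "?r \<in> P"
      using f by (auto simp: bij_betw_def f_inv_into_f inv_into_into)
    have "c ?r = exp (\<i> * of_real (- \<theta>)) * (exp (\<i> * of_real \<theta>) * c ?r)"
      by (simp add: mult.assoc[symmetric] exp_add[symmetric])
    also have "exp (\<i> * of_real \<theta>) * c ?r = c ?p" using c[OF r(2)] r(1) by simp
    finally show ?case using Suc by (simp add: algebra_simps exp_add exp_diff exp_minus divide_inverse)
  qed simp
  show ?thesis using 1[of "nat j"] 2[of "nat (- j)"] by (auto simp: int_iterate_def)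
qed

section \<open>Cell averages as coordinates, and permutations of cells\<close>

locale cell_system = finite_measure M for M :: "'a measure" +
  fixes m :: nat and P :: "'a set set" and f :: "'a set \<Rightarrow> 'a set"
  assumes finite_P: "finite P" and card_P: "card P = m" and P_sets: "P \<subseteq> sets M" and Union_P: "\<Union>P = space M"
    and overlap: "\<And>p p'. p \<in> P \<Longrightarrow> p' \<in> P \<Longrightarrow> p \<noteq> p' \<Longrightarrow> p \<inter> p' \<in> null_sets M"
    and measure_P: "\<And>p. p \<in> P \<Longrightarrow> measure M p = measure M (space M) / real m"
    and space_pos: "measure M (space M) > 0" and bij_f: "bij_betw f P P"
begin

definition w :: real where "w = measure M (space M) / real m"

abbreviation avg :: "('a \<Rightarrow> complex) \<Rightarrow> 'a set \<Rightarrow> complex" where "avg \<equiv> cell_average M m"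

abbreviation step :: "int \<Rightarrow> 'a set \<Rightarrow> 'a set" where "step \<equiv> int_iterate P f"

lemma w_pos: "w > 0"
proof -
  have "P \<noteq> {}"
  proof
    assume "P = {}"
    then have "space M = {}" using Union_P by simp
    then show False using space_pos by simp
  qed
  then have "card P > 0" using finite_P by (simp add: card_gt_0_iff)
  then show ?thesis unfolding w_def card_P by (intro divide_pos_pos space_pos) simp
qed

lemma measure_cell: "p \<in> P \<Longrightarrow> measure M p = w"
  unfolding w_def by (rule measure_P)

lemma cell_sets [measurable]: "p \<in> P \<Longrightarrow> p \<in> sets M"
  using P_sets by (rule subsetD)

lemma step_in: "p \<in> P \<Longrightarrow> step j p \<in> P"
  by (rule bij_betwE[OF bij_betw_int_iterate[OF bij_f], rule_format])

lemma sum_step: "(\<Sum>p\<in>P. F (step j p)) = (\<Sum>p\<in>P. F p)"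
  using sum.reindex_bij_betw[OF bij_betw_int_iterate[OF bij_f, of j], of F] .

text \<open>Finitely many null overlaps are discarded at once; outside of them the cells form a
  genuine partition.\<close>

lemma AE_one_cell: "AE x in M. \<forall>p\<in>P. \<forall>p'\<in>P. x \<in> p \<longrightarrow> x \<in> p' \<longrightarrow> p = p'"
proof -
  have "AE x in M. x \<in> p \<longrightarrow> x \<in> p' \<longrightarrow> p = p'" if "p \<in> P" "p' \<in> P" for p p'
  proof (cases "p = p'")
    case False
    show ?thesis using AE_not_in[OF overlap[OF that False]] by eventually_elim simp
  qed simp
  then show ?thesis
    by (intro AE_finite_allI finite_P) simp_all
qed

lemma AE_sum_indicator:
  assumes "Q \<subseteq> P"
  shows "AE x in M. (\<Sum>p\<in>Q. indicator p x) = (indicator (\<Union>Q) x :: 'c::semiring_1)"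
  using AE_one_cell
proof eventually_elim
  case (elim x)
  show ?case
  proof (cases "x \<in> \<Union>Q")
    case True
    then obtain p where p: "p \<in> Q" "x \<in> p" by auto
    have "(\<Sum>p'\<in>Q. indicator p' x) = (\<Sum>p'\<in>Q. if p' = p then 1 else 0 :: 'c)"
      using elim p assms by (intro sum.cong) (auto simp: indicator_def)
    then show ?thesis using True p finite_subset[OF assms finite_P] by simp
  qed (auto simp: indicator_def intro!: sum.neutral)
qed

lemma integral_cells:
  fixes g :: "'a \<Rightarrow> 'c::{banach, second_countable_topology}"
  assumes g: "integrable M g" and Q: "Q \<subseteq> P"
  shows "(LINT x|M. indicator (\<Union>Q) x *\<^sub>R g x) = (\<Sum>p\<in>Q. LINT x|M. indicator p x *\<^sub>R g x)"
proof -
  have Qs: "Q \<subseteq> sets M" "finite Q" using Q P_sets finite_subset[OF Q finite_P] by auto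
  have [measurable]: "g \<in> borel_measurable M" using g by simp
  have "(LINT x|M. indicator (\<Union>Q) x *\<^sub>R g x) = (LINT x|M. (\<Sum>p\<in>Q. indicator p x *\<^sub>R g x))"
  proof (rule integral_cong_AE)
    show "AE x in M. indicator (\<Union>Q) x *\<^sub>R g x = (\<Sum>p\<in>Q. indicator p x *\<^sub>R g x)"
      using AE_sum_indicator[OF Q, where 'c=real]
      by eventually_elim (simp add: scaleR_sum_left[symmetric])
    have [measurable]: "\<Union>Q \<in> sets M" using Qs by auto
    show "(\<lambda>x. indicator (\<Union>Q) x *\<^sub>R g x) \<in> borel_measurable M" by measurable
    show "(\<lambda>x. \<Sum>p\<in>Q. indicator p x *\<^sub>R g x) \<in> borel_measurable M"
      using Qs by (intro borel_measurable_sum borel_measurable_scaleR borel_measurable_indicator) auto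
  qed
  also have "\<dots> = (\<Sum>p\<in>Q. LINT x|M. indicator p x *\<^sub>R g x)"
    using Qs g by (intro Bochner_Integration.integral_sum integrable_mult_indicator) auto
  finally show ?thesis .
qed

lemma L2_integrable: "g \<in> L2 M \<Longrightarrow> integrable M g"
  using L2_integrable_prod(2)[of "\<lambda>_. 1" M g] by (simp add: L2_iff[of "\<lambda>_. 1"])

lemma avg_eq: "avg g p = of_real (1 / w) * (LINT x|M. indicator p x *\<^sub>R g x)"
  by (simp add: cell_average_def w_def scaleR_conv_of_real mult.commute of_real_indicator)

lemma cell_integral: "(LINT x|M. indicator p x *\<^sub>R g x) = of_real w * avg g p"
  using w_pos by (simp add: avg_eq)

lemma avg_cong:
  assumes "AE x in M. g x = h x" "g \<in> L2 M" "h \<in> L2 M" "p \<in> P"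
  shows "avg g p = avg h p"
  unfolding avg_eq
proof (intro arg_cong[of _ _ "\<lambda>z. of_real (1 / w) * z"] integral_cong_AE)
  have [measurable]: "g \<in> borel_measurable M" "h \<in> borel_measurable M" using assms by (auto simp: L2_iff)
  show "(\<lambda>x. indicator p x *\<^sub>R g x) \<in> borel_measurable M" "(\<lambda>x. indicator p x *\<^sub>R h x) \<in> borel_measurable M"
    using assms(4) by measurable
  show "AE x in M. indicator p x *\<^sub>R g x = indicator p x *\<^sub>R h x"
    using assms(1) by eventually_elim simp
qed

lemma avg_scale: "avg (\<lambda>x. c * g x) p = c * avg g p"
proof -
  have "(LINT x|M. indicator p x *\<^sub>R (c * g x)) = c * (LINT x|M. indicator p x *\<^sub>R g x)"
    by (subst integral_mult_right_zero[symmetric]) (simp add: scaleR_conv_of_real mult_ac)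
  then show ?thesis by (simp add: avg_eq)
qed

lemma avg_sum:
  assumes "\<And>i. i \<in> I \<Longrightarrow> g i \<in> L2 M" "p \<in> P"
  shows "avg (\<lambda>x. \<Sum>i\<in>I. g i x) p = (\<Sum>i\<in>I. avg (g i) p)"
proof -
  have "(LINT x|M. indicator p x *\<^sub>R (\<Sum>i\<in>I. g i x)) = (\<Sum>i\<in>I. LINT x|M. indicator p x *\<^sub>R g i x)"
    unfolding scaleR_sum_right using assms cell_sets
    by (intro Bochner_Integration.integral_sum integrable_mult_indicator L2_integrable) auto
  then show ?thesis by (simp add: avg_eq sum_distrib_left)
qed

lemma avg_diff:
  assumes "g \<in> L2 M" "h \<in> L2 M" "p \<in> P"
  shows "avg (\<lambda>x. g x - h x) p = avg g p - avg h p"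
proof -
  have "(LINT x|M. indicator p x *\<^sub>R (g x - h x)) = (LINT x|M. indicator p x *\<^sub>R g x) - (LINT x|M. indicator p x *\<^sub>R h x)"
    unfolding scaleR_diff_right using assms cell_sets
    by (intro Bochner_Integration.integral_diff integrable_mult_indicator L2_integrable) auto
  then show ?thesis by (simp add: avg_eq right_diff_distrib)
qed

lemma avg_add:
  assumes "g \<in> L2 M" "h \<in> L2 M" "p \<in> P"
  shows "avg (\<lambda>x. g x + h x) p = avg g p + avg h p"
  using avg_diff[OF assms(1) L2_scale[OF assms(2), of "-1"] assms(3)] avg_scale[of "-1" h p] by simp

text \<open>A cell outside Q meets the union in finitely many null overlaps. Membership in Q can
  thus be read off from averages, although cells may share points.\<close>

lemma avg_indicator_Union:
  assumes "Q \<subseteq> P" "p \<in> P"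
  shows "avg (\<lambda>x. indicator (\<Union>Q) x) p = (if p \<in> Q then 1 else 0)"
proof -
  have "(LINT x|M. indicator p x *\<^sub>R (indicator (\<Union>Q) x :: complex)) = of_real (measure M (p \<inter> \<Union>Q))"
  proof -
    have "(LINT x|M. indicator p x *\<^sub>R (indicator (\<Union>Q) x :: complex)) = (LINT x|M. of_real (indicator (p \<inter> \<Union>Q) x))"
      by (intro Bochner_Integration.integral_cong) (auto split: split_indicator)
    moreover have "p \<inter> \<Union>Q \<inter> space M = p \<inter> \<Union>Q" using cell_sets[OF assms(2)] sets.sets_into_space by auto
    ultimately show ?thesis by simp
  qed
  moreover have "measure M (p \<inter> \<Union>Q) = (if p \<in> Q then w else 0)"
  proof (cases "p \<in> Q")
    case True
    then have "p \<inter> \<Union>Q = p" by auto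
    then show ?thesis using True measure_cell assms by simp
  next
    case False
    have "p \<inter> \<Union>Q = (\<Union>p'\<in>Q. p \<inter> p')" by auto
    also have "\<dots> \<in> null_sets M"
      using False assms finite_subset[OF assms(1) finite_P] by (intro null_sets.finite_UN overlap) auto
    finally show ?thesis using False by (simp add: measure_eq_0_null_sets)
  qed
  ultimately show ?thesis using w_pos by (simp add: avg_eq)
qed

lemma L2_cells: "(\<lambda>x. \<Sum>p\<in>P. c p * indicator p x) \<in> L2 M"
  by (intro L2_sum L2_scale L2_indicator[unfolded eta_contract_eq]) (auto simp: cell_sets)

text \<open>The averages are the coordinates with respect to the indicators of the cells, so
  identities in the cell space may be checked on them.\<close>

lemma avg_cells:
  assumes "p \<in> P" shows "avg (\<lambda>x. \<Sum>p'\<in>P. c p' * indicator p' x) p = c p"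
proof -
  have "avg (\<lambda>x. \<Sum>p'\<in>P. c p' * indicator p' x) p = (\<Sum>p'\<in>P. c p' * avg (\<lambda>x. indicator p' x) p)"
    using assms cell_sets L2_indicator
    by (subst avg_sum) (auto intro!: L2_scale simp: avg_scale)
  also have "\<dots> = (\<Sum>p'\<in>P. if p' = p then c p' else 0)"
    using avg_indicator_Union[OF _ assms, of "{_}"] by (intro sum.cong) auto
  finally show ?thesis using assms finite_P by simp
qed

lemma avg_averaging: "p \<in> P \<Longrightarrow> avg (averaging M m P g) p = avg g p"
  unfolding averaging_def by (rule avg_cells)

lemma averaging_L2: "averaging M m P g \<in> L2 M"
  unfolding averaging_def by (rule L2_cells)

text \<open>Cauchy-Schwarz on each cell against its indicator, whose squared norm is
  \<open>w\<close>, followed by summation over the cells. This is contractivity of the averaging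
  operator in coordinates.\<close>

lemma avg_contraction:
  assumes g: "g \<in> L2 M"
  shows "w * (\<Sum>p\<in>P. (cmod (avg g p))\<^sup>2) \<le> (norm_L2 M g)\<^sup>2"
proof -
  have sq: "integrable M (\<lambda>x. (cmod (g x))\<^sup>2)" using g by (simp add: L2_iff)
  have [measurable]: "g \<in> borel_measurable M" using g by (rule L2_measurable)
  have "w * (cmod (avg g p))\<^sup>2 \<le> (LINT x|M. indicator p x *\<^sub>R (cmod (g x))\<^sup>2)" if p: "p \<in> P" for p
  proof -
    let ?h = "\<lambda>x. indicator p x * g x"
    have eq: "(\<lambda>x. (cmod (?h x))\<^sup>2) = (\<lambda>x. indicator p x *\<^sub>R (cmod (g x))\<^sup>2)"
      by (auto split: split_indicator)
    have h: "?h \<in> L2 M"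
      using integrable_mult_indicator[OF cell_sets[OF p] sq] cell_sets[OF p] by (simp add: L2_iff eq)
    have i: "(\<lambda>x. indicator p x :: complex) \<in> L2 M" using L2_indicator[OF cell_sets[OF p]] by simp
    have "inner_L2 M (\<lambda>x. indicator p x) ?h = (LINT x|M. indicator p x *\<^sub>R g x)"
      unfolding inner_L2_def by (intro Bochner_Integration.integral_cong) (auto split: split_indicator)
    then have "cmod (of_real w * avg g p) \<le> norm_L2 M (\<lambda>x. indicator p x :: complex) * norm_L2 M ?h"
      using inner_L2_Cauchy_Schwarz[OF i h] by (simp add: cell_integral)
    then have "(w * cmod (avg g p))\<^sup>2 \<le> (norm_L2 M (\<lambda>x. indicator p x :: complex) * norm_L2 M ?h)\<^sup>2"
      using w_pos by (intro power_mono) (auto simp: norm_mult)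
    also have "\<dots> = (norm_L2 M (\<lambda>x. indicator p x :: complex))\<^sup>2 * (LINT x|M. indicator p x *\<^sub>R (cmod (g x))\<^sup>2)"
      by (simp only: power_mult_distrib norm_L2_sq eq)
    also have "(norm_L2 M (\<lambda>x. indicator p x :: complex))\<^sup>2 = w"
    proof -
      have "(norm_L2 M (\<lambda>x. indicator p x :: complex))\<^sup>2 = (LINT x|M. indicator p x)"
        unfolding norm_L2_sq by (intro Bochner_Integration.integral_cong) (auto split: split_indicator)
      moreover have "p \<inter> space M = p" using cell_sets[OF p] sets.sets_into_space by auto
      ultimately show ?thesis using measure_cell[OF p] by simp
    qed
    finally have "w * (w * (cmod (avg g p))\<^sup>2) \<le> w * (LINT x|M. indicator p x *\<^sub>R (cmod (g x))\<^sup>2)"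
      by (simp only: power2_eq_square mult_ac)
    then show ?thesis using w_pos by (simp only: mult_le_cancel_left_pos)
  qed
  then have "w * (\<Sum>p\<in>P. (cmod (avg g p))\<^sup>2) \<le> (\<Sum>p\<in>P. LINT x|M. indicator p x *\<^sub>R (cmod (g x))\<^sup>2)"
    unfolding sum_distrib_left by (rule sum_mono)
  also have "\<dots> = (LINT x|M. indicator (\<Union>P) x *\<^sub>R (cmod (g x))\<^sup>2)"
    by (rule integral_cells[symmetric, OF sq order_refl])
  also have "\<dots> = (norm_L2 M g)\<^sup>2"
    unfolding norm_L2_sq Union_P by (intro Bochner_Integration.integral_cong) auto
  finally show ?thesis .
qed

text \<open>The correlation \<open>\<langle>\<W> h, \<U>\<^sup>j \<W> g\<rangle>\<close> of the discretised functions, written on coefficients.\<close>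

definition corr :: "('a \<Rightarrow> complex) \<Rightarrow> ('a \<Rightarrow> complex) \<Rightarrow> int \<Rightarrow> complex" where
  "corr g h j = of_real w * (\<Sum>p\<in>P. cnj (avg h p) * avg g (step j p))"

text \<open>A permutation of the cells preserves sums of squares, so \<open>avg_contraction\<close>
  bounds both factors. Independence of the partition and of the number of steps is what makes the
  density argument work later.\<close>

lemma corr_bound:
  assumes "g \<in> L2 M" "h \<in> L2 M"
  shows "cmod (corr g h j) \<le> norm_L2 M h * norm_L2 M g"
proof -
  have "cmod (corr g h j) \<le> w * (\<Sum>p\<in>P. \<bar>cmod (avg h p)\<bar> * \<bar>cmod (avg g (step j p))\<bar>)"
    unfolding corr_def norm_mult using w_pos
    by (auto intro!: mult_left_mono order_trans[OF norm_sum] sum_mono simp: norm_mult)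
  also have "\<dots> \<le> w * (L2_set (\<lambda>p. cmod (avg h p)) P * L2_set (\<lambda>p. cmod (avg g (step j p))) P)"
    using w_pos by (intro mult_left_mono L2_set_mult_ineq) auto
  also have "\<dots> = sqrt (w * (\<Sum>p\<in>P. (cmod (avg h p))\<^sup>2)) * sqrt (w * (\<Sum>p\<in>P. (cmod (avg g p))\<^sup>2))"
    using w_pos sum_step[of "\<lambda>p. (cmod (avg g p))\<^sup>2" j] by (simp add: L2_set_def real_sqrt_mult)
  also have "\<dots> \<le> sqrt ((norm_L2 M h)\<^sup>2) * sqrt ((norm_L2 M g)\<^sup>2)"
    using w_pos by (intro mult_mono real_sqrt_le_mono avg_contraction assms) (auto intro!: sum_nonneg mult_nonneg_nonneg)
  finally show ?thesis by simp
qed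

lemma corr_diff:
  assumes "g \<in> L2 M" "g' \<in> L2 M"
  shows "corr (\<lambda>x. g x - g' x) h j = corr g h j - corr g' h j"
  unfolding corr_def using assms step_in
  by (simp add: avg_diff right_diff_distrib sum_subtractf)

lemma corr_add:
  assumes "g \<in> L2 M" "g' \<in> L2 M"
  shows "corr (\<lambda>x. g x + g' x) h j = corr g h j + corr g' h j"
  unfolding corr_def using assms step_in
  by (simp add: avg_add distrib_left sum.distrib)

lemma corr_scale: "corr (\<lambda>x. c * g x) h j = c * corr g h j"
  unfolding corr_def by (simp add: avg_scale sum_distrib_left mult_ac)

text \<open>If Q covered a cell outside Q, the average over that cell of the indicator of the union
  would be both 0 and 1. Hence \<open>act_on_union\<close>, which recovers the cells from a point
  set, always acts on the cells intended.\<close>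

lemma subset_Union_cells:
  assumes "Q \<subseteq> P" shows "{p \<in> P. p \<subseteq> \<Union>Q} = Q"
proof -
  have "p \<in> Q" if p: "p \<in> P" "p \<subseteq> \<Union>Q" for p
  proof (rule ccontr)
    assume "p \<notin> Q"
    then have "avg (\<lambda>x. indicator (\<Union>Q) x) p = 0" using avg_indicator_Union[OF assms p(1)] by simp
    moreover have "avg (\<lambda>x. indicator (\<Union>Q) x) p = avg (\<lambda>x. indicator (\<Union>{p}) x) p"
      unfolding avg_eq using p(2)
      by (intro arg_cong[of _ _ "\<lambda>z. of_real (1 / w) * z"] Bochner_Integration.integral_cong) (auto split: split_indicator)
    ultimately show False using avg_indicator_Union[of "{p}" p] p(1) by simp
  qed
  then show ?thesis using assms by auto
qed

lemma act_on_union_cells: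
  assumes "Q \<subseteq> P"
  shows "act_on_union P f k (\<Union>Q) = \<Union>(step k ` Q)" "step k ` Q \<subseteq> P"
  using step_in assms by (auto simp: act_on_union_def subset_Union_cells[OF assms])

lemma measure_Union_cells:
  assumes "Q \<subseteq> P" shows "measure M (\<Union>Q) = w * real (card Q)"
proof -
  have Qs: "\<Union>Q \<in> sets M"
    using assms cell_sets by (intro sets.finite_Union finite_subset[OF assms finite_P]) auto
  have "measure M (\<Union>Q) = (LINT x|M. indicator (\<Union>Q) x *\<^sub>R (1::real))"
    using sets.sets_into_space[OF Qs] by (simp add: Int_absorb2)
  also have "\<dots> = (\<Sum>p\<in>Q. LINT x|M. indicator p x *\<^sub>R (1::real))"
    by (rule integral_cells[OF _ assms]) simp
  also have "\<dots> = (\<Sum>p\<in>Q. w)"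
    using assms cell_sets[THEN sets.sets_into_space] measure_cell by (intro sum.cong) (auto simp: Int_absorb2 subset_iff)
  finally show ?thesis by simp
qed

lemma measure_act_on_union:
  assumes "Q \<subseteq> P" shows "measure M (act_on_union P f k (\<Union>Q)) = measure M (\<Union>Q)"
proof -
  have "inj_on (step k) Q"
    using bij_betw_int_iterate[OF bij_f, of k] assms by (auto simp: bij_betw_def inj_on_subset)
  then show ?thesis
    using act_on_union_cells[OF assms, of k] measure_Union_cells assms by (simp add: card_image)
qed

text \<open>For unions of cells the discretisation is exact: a cell moves into Q after j steps iff
  it belongs to the image of Q under -j steps. The function h needs no averaging, since integrating
  it over cells sees only its averages.\<close>

lemma corr_indicator_cells:
  assumes Q: "Q \<subseteq> P" and h: "h \<in> L2 M"
  shows "corr (\<lambda>x. indicator (\<Union>Q) x) h j = inner_L2 M h (\<lambda>x. indicator (act_on_union P f (- j) (\<Union>Q)) x)"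
proof -
  let ?R = "step (- j) ` Q"
  have R: "?R \<subseteq> P" "act_on_union P f (- j) (\<Union>Q) = \<Union>?R" using act_on_union_cells[OF Q, of "- j"] by auto
  have iff: "step j p \<in> Q \<longleftrightarrow> p \<in> ?R" if "p \<in> P" for p
  proof
    assume "step j p \<in> Q"
    then show "p \<in> ?R" using int_iterate_minus_cancel[OF bij_f that, of j] by (metis imageI)
  next
    assume "p \<in> ?R"
    then obtain r where "r \<in> Q" "p = step (- j) r" by auto
    then show "step j p \<in> Q" using int_iterate_minus_cancel[OF bij_f, of r "- j"] Q by auto
  qed
  have hi: "integrable M (\<lambda>x. cnj (h x))" using L2_integrable[OF h] by simp
  have "corr (\<lambda>x. indicator (\<Union>Q) x) h j = of_real w * (\<Sum>p\<in>P. if p \<in> ?R then cnj (avg h p) else 0)"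
    unfolding corr_def using step_in iff
    by (intro arg_cong[of _ _ "\<lambda>z. of_real w * z"] sum.cong refl) (simp add: avg_indicator_Union[OF Q])
  also have "\<dots> = of_real w * (\<Sum>p\<in>?R. cnj (avg h p))"
    using R finite_P by (subst sum.inter_restrict[symmetric]) (auto simp: Int_absorb1 Int_absorb2)
  also have "\<dots> = (\<Sum>p\<in>?R. LINT x|M. indicator p x *\<^sub>R cnj (h x))"
  proof -
    have "(LINT x|M. indicator p x *\<^sub>R cnj (h x)) = of_real w * cnj (avg h p)" for p
    proof -
      have "(LINT x|M. indicator p x *\<^sub>R cnj (h x)) = (LINT x|M. cnj (indicator p x *\<^sub>R h x))" by simp
      also have "\<dots> = cnj (LINT x|M. indicator p x *\<^sub>R h x)" by (rule Bochner_Integration.integral_cnj)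
      finally show ?thesis by (simp add: cell_integral)
    qed
    then show ?thesis by (simp add: sum_distrib_left)
  qed
  also have "\<dots> = (LINT x|M. indicator (\<Union>?R) x *\<^sub>R cnj (h x))"
    by (rule integral_cells[OF hi R(1), symmetric])
  also have "\<dots> = inner_L2 M h (\<lambda>x. indicator (act_on_union P f (- j) (\<Union>Q)) x)"
    unfolding inner_L2_def R(2) by (intro Bochner_Integration.integral_cong) (auto split: split_indicator)
  finally show ?thesis .
qed

text \<open>The set is replaced by its cell hull. By \<open>corr_bound\<close> the price is their
  distance in mean square, the same for every number of steps.\<close>

lemma corr_indicator:
  assumes A: "A \<in> sets M" and h: "h \<in> L2 M"
  shows "cmod (corr (\<lambda>x. indicator A x) h j - inner_L2 M h (\<lambda>x. indicator (act_on_union P f (- j) (cell_hull P A)) x))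
    \<le> norm_L2 M h * norm_L2 M (\<lambda>x. indicator A x - indicator (cell_hull P A) x :: complex)"
proof -
  have Q: "{p \<in> P. p \<inter> A \<noteq> {}} \<subseteq> P" by auto
  have As: "cell_hull P A \<in> sets M"
    unfolding cell_hull_def using cell_sets by (intro sets.finite_Union finite_subset[OF Q finite_P]) auto
  have L: "(\<lambda>x. indicator A x :: complex) \<in> L2 M" "(\<lambda>x. indicator (cell_hull P A) x :: complex) \<in> L2 M"
    using L2_indicator A As by auto
  have "corr (\<lambda>x. indicator A x - indicator (cell_hull P A) x) h j
      = corr (\<lambda>x. indicator A x) h j - inner_L2 M h (\<lambda>x. indicator (act_on_union P f (- j) (cell_hull P A)) x)"
    unfolding corr_diff[OF L] by (simp only: cell_hull_def corr_indicator_cells[OF Q h])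
  then show ?thesis
    using corr_bound[OF L2_diff[OF L] h, of j] by simp
qed

text \<open>After reindexing the sum along f, the discrete Koopman operator is composition of the
  coordinate function with f. The eigenvalue equation becomes a relation along orbits of cells,
  which can be iterated.\<close>

lemma eigen_average:
  assumes v: "v \<in> L2 M"
    and eig: "AE x in M. discrete_koopman M m P f 1 v x = exp (\<i> * of_real \<theta>) * v x" and p: "p \<in> P"
  shows "avg v (f p) = exp (\<i> * of_real \<theta>) * avg v p"
proof -
  have fp: "f p \<in> P" if "p \<in> P" for p using that bij_f by (auto simp: bij_betw_def)
  have "discrete_koopman M m P f 1 v = (\<lambda>x. \<Sum>p\<in>P. avg v (f p) * indicator p x)"
  proof
    fix x
    have "discrete_koopman M m P f 1 v x = (\<Sum>p\<in>P. avg v p * indicator (step (- 1) p) x)"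
      by (simp add: discrete_koopman_def)
    also have "\<dots> = (\<Sum>p\<in>P. avg v (f p) * indicator (step (- 1) (f p)) x)"
      by (rule sum.reindex_bij_betw[OF bij_f, symmetric])
    also have "\<dots> = (\<Sum>p\<in>P. avg v (f p) * indicator p x)"
      using bij_f by (intro sum.cong) (auto simp: int_iterate_def bij_betw_def)
    finally show "discrete_koopman M m P f 1 v x = (\<Sum>p\<in>P. avg v (f p) * indicator p x)" .
  qed
  then have "avg (discrete_koopman M m P f 1 v) p = avg v (f p)"
    and "discrete_koopman M m P f 1 v \<in> L2 M"
    using avg_cells[OF p] L2_cells by simp_all
  then show ?thesis using avg_cong[OF eig _ L2_scale[OF v] p] avg_scale[of _ v p] by simp
qed

lemma inner_averaging:
  assumes v: "v \<in> L2 M"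
  shows "inner_L2 M (averaging M m P g) v = of_real w * (\<Sum>p\<in>P. cnj (avg g p) * avg v p)"
proof -
  have "inner_L2 M v (averaging M m P g) = (\<Sum>p\<in>P. avg g p * inner_L2 M v (\<lambda>x. indicator p x))"
    unfolding averaging_def using v cell_sets L2_indicator
    by (subst inner_L2_sum_right) (auto intro!: L2_scale simp: inner_L2_scale_right)
  then have "inner_L2 M (averaging M m P g) v = (\<Sum>p\<in>P. cnj (avg g p) * inner_L2 M (\<lambda>x. indicator p x) v)"
    unfolding inner_L2_cnj[of M v, symmetric] by (simp only: cnj_sum complex_cnj_mult)
  moreover have "inner_L2 M (\<lambda>x. indicator p x) v = of_real w * avg v p" for p
    unfolding cell_integral[symmetric] inner_L2_def
    by (intro Bochner_Integration.integral_cong) (auto split: split_indicator)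
  ultimately show ?thesis by (simp add: sum_distrib_left mult_ac)
qed

text \<open>Parseval's identity for the eigenbasis: j steps multiply the k-th component by its j-th
  phase. This is the bridge from the atomic spectral measure, sampled at j steps, to the dynamics on
  cells.\<close>

lemma spectral_corr:
  assumes basis: "discrete_eigenbasis M m P f v \<theta>" and g: "g \<in> L2 M"
  shows "(\<Sum>k=1..m. of_real ((norm_L2 M (rank_one_projector M (v k) (averaging M m P g)))\<^sup>2)
      * exp (\<i> * of_real (of_int j * \<theta> k))) = corr g g j"
proof -
  let ?G = "averaging M m P g"
  have ob: "orthonormal_basis M P m v" using basis by (simp add: discrete_eigenbasis_def)
  have vL: "v k \<in> L2 M" if "k \<in> {1..m}" for k
    using ob that by (auto simp: orthonormal_basis_def cell_space_def)
  have orth: "inner_L2 M (v i) (v k) = (if i = k then 1 else 0)" if "i \<in> {1..m}" "k \<in> {1..m}" for i k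
    using ob that by (auto simp: orthonormal_basis_def)
  have "?G \<in> cell_space M P"
    using averaging_L2 by (auto simp: cell_space_def averaging_def)
  then obtain b where b: "AE x in M. ?G x = (\<Sum>k=1..m. b k * v k x)"
    using ob by (auto simp: orthonormal_basis_def)
  have sL: "(\<lambda>x. \<Sum>k=1..m. b k * v k x) \<in> L2 M"
    by (intro L2_sum L2_scale vL)
  have bk: "inner_L2 M (v k) ?G = b k" if k: "k \<in> {1..m}" for k
  proof -
    have "inner_L2 M (v k) ?G = inner_L2 M (v k) (\<lambda>x. \<Sum>i=1..m. b i * v i x)"
      by (rule inner_L2_cong_AE) (use b averaging_L2 sL vL[OF k] in auto)
    also have "\<dots> = (\<Sum>i=1..m. b i * inner_L2 M (v k) (v i))"
      by (subst inner_L2_sum_right[OF vL[OF k]]) (auto intro!: L2_scale vL simp: inner_L2_scale_right)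
    also have "\<dots> = (\<Sum>i=1..m. if i = k then b i else 0)"
      using orth[OF k] by (intro sum.cong) auto
    finally show ?thesis using k by simp
  qed
  have nrm: "(norm_L2 M (rank_one_projector M (v k) ?G))\<^sup>2 = (cmod (b k))\<^sup>2" if k: "k \<in> {1..m}" for k
  proof -
    have "(norm_L2 M (rank_one_projector M (v k) ?G))\<^sup>2 = (norm_L2 M (v k))\<^sup>2 * (cmod (b k))\<^sup>2"
      unfolding norm_L2_sq rank_one_projector_def bk[OF k] by (simp add: norm_mult power_mult_distrib)
    moreover have "complex_of_real ((norm_L2 M (v k))\<^sup>2) = 1"
      unfolding inner_L2_self[symmetric] using orth[OF k k] by simp
    ultimately show ?thesis by (simp only: of_real_eq_1_iff mult_1)
  qed
  have avg_g: "avg g p = (\<Sum>k=1..m. b k * avg (v k) p)" if p: "p \<in> P" for p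
  proof -
    have "avg g p = avg ?G p" using p by (simp add: avg_averaging)
    also have "\<dots> = avg (\<lambda>x. \<Sum>k=1..m. b k * v k x) p"
      by (rule avg_cong[OF b averaging_L2 sL p])
    also have "\<dots> = (\<Sum>k=1..m. b k * avg (v k) p)"
      by (subst avg_sum[OF _ p]) (auto intro!: L2_scale vL simp: avg_scale)
    finally show ?thesis .
  qed
  have vstep: "avg (v k) (step j p) = exp (\<i> * of_real (of_int j * \<theta> k)) * avg (v k) p" if "k \<in> {1..m}" "p \<in> P" for k p
  proof (rule int_iterate_eigen[OF bij_f _ that(2)])
    have "AE x in M. discrete_koopman M m P f 1 (v k) x = exp (\<i> * of_real (\<theta> k)) * v k x"
      using basis that(1) by (simp add: discrete_eigenbasis_def)
    then show "avg (v k) (f p) = exp (\<i> * of_real (\<theta> k)) * avg (v k) p" if "p \<in> P" for p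
      by (rule eigen_average[OF vL[OF \<open>k \<in> {1..m}\<close>] _ that])
  qed
  have "corr g g j = of_real w * (\<Sum>p\<in>P. cnj (avg g p) * (\<Sum>k=1..m. b k * (exp (\<i> * of_real (of_int j * \<theta> k)) * avg (v k) p)))"
    unfolding corr_def using vstep step_in by (simp add: avg_g[OF step_in])
  also have "\<dots> = (\<Sum>k=1..m. b k * exp (\<i> * of_real (of_int j * \<theta> k)) * (of_real w * (\<Sum>p\<in>P. cnj (avg g p) * avg (v k) p)))"
    unfolding sum_distrib_left by (subst sum.swap) (simp add: mult_ac)
  also have "\<dots> = (\<Sum>k=1..m. of_real ((cmod (b k))\<^sup>2) * exp (\<i> * of_real (of_int j * \<theta> k)))"
  proof (intro sum.cong refl)
    fix k assume k: "k \<in> {1..m}"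
    have "of_real w * (\<Sum>p\<in>P. cnj (avg g p) * avg (v k) p) = inner_L2 M ?G (v k)"
      by (rule inner_averaging[OF vL[OF k], symmetric])
    also have "\<dots> = cnj (b k)" using bk[OF k] inner_L2_cnj[of M "v k" ?G] by simp
    finally show "b k * exp (\<i> * of_real (of_int j * \<theta> k)) * (of_real w * (\<Sum>p\<in>P. cnj (avg g p) * avg (v k) p))
        = of_real ((cmod (b k))\<^sup>2) * exp (\<i> * of_real (of_int j * \<theta> k))"
      by (simp only: complex_norm_square mult_ac)
  qed
  finally show ?thesis using nrm by simp
qed

end

section \<open>Convergence of correlations\<close>

text \<open>Indices at which the sequence stays away from 0, if infinite in number, form a
  subsequence that violates the hypothesis. It is designed for convergence in mean, which gives
  almost everywhere convergence along subsequences only.\<close>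

lemma tendsto_0_subseqI:
  fixes a :: "nat \<Rightarrow> real"
  assumes "\<And>r :: nat \<Rightarrow> nat. strict_mono r \<Longrightarrow> \<exists>s :: nat \<Rightarrow> nat. strict_mono s \<and> (\<lambda>n. a (r (s n))) \<longlonglongrightarrow> 0"
  shows "a \<longlonglongrightarrow> 0"
proof (rule ccontr)
  assume "\<not> a \<longlonglongrightarrow> 0"
  then obtain e where e: "e > 0" "\<not> (\<forall>\<^sub>F n in sequentially. dist (a n) 0 < e)"
    by (auto simp: tendsto_iff)
  then have "infinite {n. \<not> dist (a n) 0 < e}"
    by (simp add: frequently_cofinite not_eventually flip: cofinite_eq_sequentially)
  then obtain r :: "nat \<Rightarrow> nat" where r: "strict_mono r" "\<And>n. r n \<in> {n. \<not> dist (a n) 0 < e}"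
    using infinite_enumerate by blast
  obtain s :: "nat \<Rightarrow> nat" where "(\<lambda>n. a (r (s n))) \<longlonglongrightarrow> 0"
    using assms[OF r(1)] by blast
  then have "\<forall>\<^sub>F n in sequentially. dist (a (r (s n))) 0 < e"
    using e(1) by (simp add: tendsto_iff)
  then show False using r(2) by (auto simp: eventually_sequentially)
qed

section \<open>From approximation of sets to convergence of correlations\<close>

locale periodic_approximation = measured_flow X d M S
  for X :: "'a::euclidean_space set" and d M S +
  fixes q :: "nat \<Rightarrow> nat" and l \<tau> :: "nat \<Rightarrow> real"
    and P :: "nat \<Rightarrow> 'a set set" and f :: "nat \<Rightarrow> 'a set \<Rightarrow> 'a set"
  assumes \<tau>_pos: "\<And>n. \<tau> n > 0"
    and cells: "\<And>n. cell_system M (q n) (P n) (f n)"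
    and l_lim: "l \<longlonglongrightarrow> 0"
    and diam: "\<And>n p x y. p \<in> P n \<Longrightarrow> x \<in> p \<Longrightarrow> y \<in> p \<Longrightarrow> d x y \<le> l n"
    and approx: "\<And>(t::real) A. compact A \<Longrightarrow> A \<noteq> {} \<Longrightarrow> A \<subseteq> X \<Longrightarrow>
      (\<lambda>n. LBINT s=-t..t. hausdorff_distance d (S s ` A)
        (act_on_union (P n) (f n) (step_count (\<tau> n) s) (cell_hull (P n) A))) \<longlonglongrightarrow> 0"
begin

sublocale cs: cell_system M "q n" "P n" "f n" for n
  by (rule cells)

definition image_cells :: "nat \<Rightarrow> 'a set \<Rightarrow> int \<Rightarrow> 'a set" where
  "image_cells n A j = act_on_union (P n) (f n) j (cell_hull (P n) A)"

definition err :: "nat \<Rightarrow> 'a set \<Rightarrow> real \<Rightarrow> real" where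
  "err n A s = hausdorff_distance d (S s ` A) (image_cells n A (step_count (\<tau> n) s))"

lemma cell_nonempty: "p \<in> P n \<Longrightarrow> p \<noteq> {}"
  using cs.measure_cell[of p n] cs.w_pos[of n] by auto

lemma cell_subset: "p \<in> P n \<Longrightarrow> p \<subseteq> X"
  using cs.cell_sets[of p n] by (simp add: sets_M_iff)

text \<open>The last claim is the discrete counterpart of invariance: permuting cells of equal
  measure keeps their number.\<close>

lemma hull_props:
  assumes "A \<noteq> {}" "A \<subseteq> X"
  shows "A \<subseteq> cell_hull (P n) A" "cell_hull (P n) A \<subseteq> X" "cell_hull (P n) A \<in> sets M"
    "image_cells n A j \<noteq> {}" "image_cells n A j \<subseteq> X" "image_cells n A j \<in> sets M"
    "measure M (image_cells n A j) = measure M (cell_hull (P n) A)"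
proof -
  let ?Q = "{p \<in> P n. p \<inter> A \<noteq> {}}"
  have Q: "?Q \<subseteq> P n" by auto
  have fin: "finite ?Q" using cs.finite_P[of n] by simp
  have cover: "\<Union>(P n) = X" using cs.Union_P[of n] by (simp add: space_M)
  show A: "A \<subseteq> cell_hull (P n) A"
  proof
    fix x assume x: "x \<in> A"
    then obtain p where "p \<in> P n" "x \<in> p" using assms cover by blast
    then show "x \<in> cell_hull (P n) A" using x by (auto simp: cell_hull_def)
  qed
  show "cell_hull (P n) A \<subseteq> X" using cell_subset by (auto simp: cell_hull_def)
  show "cell_hull (P n) A \<in> sets M"
    unfolding cell_hull_def using cs.cell_sets by (intro sets.finite_Union fin) auto
  have act: "image_cells n A j = \<Union>(int_iterate (P n) (f n) j ` ?Q)" "int_iterate (P n) (f n) j ` ?Q \<subseteq> P n"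
    using cs.act_on_union_cells[OF Q] by (auto simp: image_cells_def cell_hull_def)
  have "?Q \<noteq> {}" using A assms(1) by (auto simp: cell_hull_def)
  then obtain p where "p \<in> ?Q" by blast
  then have "int_iterate (P n) (f n) j p \<in> P n" "int_iterate (P n) (f n) j p \<subseteq> image_cells n A j"
    using act(1) subsetD[OF act(2) imageI] by auto
  then show "image_cells n A j \<noteq> {}" using cell_nonempty by blast
  show "image_cells n A j \<subseteq> X"
    unfolding act(1) by (rule Union_least) (rule cell_subset[OF subsetD[OF act(2)]])
  show "image_cells n A j \<in> sets M"
    unfolding act(1)
    by (intro sets.finite_Union finite_imageI fin subsetI) (rule cs.cell_sets[OF subsetD[OF act(2)]])
  show "measure M (image_cells n A j) = measure M (cell_hull (P n) A)"
    unfolding image_cells_def cell_hull_def by (rule cs.measure_act_on_union[OF Q])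
qed

lemma hausdorff_hull:
  assumes "A \<noteq> {}" "A \<subseteq> X" shows "hausdorff_distance d A (cell_hull (P n) A) \<le> l n"
proof (rule hausdorff_le_pointwise)
  have l0: "0 \<le> l n"
  proof -
    obtain a where "a \<in> A" using assms by auto
    then obtain p where "p \<in> P n" "a \<in> p" using hull_props(1)[OF assms, of n] by (auto simp: cell_hull_def)
    then show ?thesis using diam[of p n a a] by (simp add: d_self)
  qed
  show "\<exists>b\<in>cell_hull (P n) A. d a b \<le> l n" if "a \<in> A" for a
    using that hull_props(1)[OF assms, of n] l0 by (intro bexI[of _ a]) (auto simp: d_self)
  show "\<exists>a\<in>A. d a b \<le> l n" if "b \<in> cell_hull (P n) A" for b
    using that diam by (fastforce simp: cell_hull_def)
qed (use assms hull_props(1)[OF assms, of n] in auto)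

lemma hausdorff_hull_tendsto:
  assumes "A \<noteq> {}" "A \<subseteq> X" shows "(\<lambda>n. hausdorff_distance d A (cell_hull (P n) A)) \<longlonglongrightarrow> 0"
proof (rule tendsto_sandwich[OF _ _ tendsto_const l_lim])
  have "0 \<le> hausdorff_distance d A (cell_hull (P n) A)" for n
    using hull_props(1,2)[OF assms, of n] assms by (intro hausdorff_nonneg) auto
  then show "\<forall>\<^sub>F n in sequentially. 0 \<le> hausdorff_distance d A (cell_hull (P n) A)" by simp
  show "\<forall>\<^sub>F n in sequentially. hausdorff_distance d A (cell_hull (P n) A) \<le> l n"
    using hausdorff_hull[OF assms] by simp
qed

text \<open>The hull contains A and stays within one cell diameter of it, so only the excess over A
  matters, and that is handled by \<open>measure_diff_tendsto_0\<close>.\<close>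

lemma hull_tendsto:
  assumes A: "compact A" "A \<noteq> {}" "A \<subseteq> X"
  shows "(\<lambda>n. measure M (cell_hull (P n) A)) \<longlonglongrightarrow> measure M A"
    and "(\<lambda>n. norm_L2 M (\<lambda>x. indicator A x - indicator (cell_hull (P n) A) x)) \<longlonglongrightarrow> 0"
proof -
  note hp = hull_props[OF A(2,3)]
  have As: "A \<in> sets M" by (rule compact_sets_M[OF A(1,3)])
  have 1: "(\<lambda>n. measure M (cell_hull (P n) A - A)) \<longlonglongrightarrow> 0"
    using hp(1) A by (intro measure_diff_tendsto_0 A hp(3) hausdorff_hull_tendsto) auto
  moreover have eq: "measure M (cell_hull (P n) A - A) = measure M (cell_hull (P n) A) - measure M A" for n
    using hp(1,3) As by (intro finite_measure_Diff) auto
  ultimately show "(\<lambda>n. measure M (cell_hull (P n) A)) \<longlonglongrightarrow> measure M A"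
    by (simp add: LIM_zero_iff)
  have "norm_L2 M (\<lambda>x. indicator A x - indicator (cell_hull (P n) A) x) = sqrt (measure M (cell_hull (P n) A - A))" for n
  proof -
    have "A - cell_hull (P n) A = {}" using hp(1)[of n] by auto
    then show ?thesis
      using norm_L2_indicator_diff[OF As hp(3), of n] by (metis add_0 measure_empty norm_L2_nonneg real_sqrt_unique)
  qed
  then show "(\<lambda>n. norm_L2 M (\<lambda>x. indicator A x - indicator (cell_hull (P n) A) x)) \<longlonglongrightarrow> 0"
    using tendsto_real_sqrt[OF 1] by simp
qed

text \<open>For a fixed number of steps the error is continuous in time, and the number of steps is
  a measurable function with countably many values.\<close>

lemma err_measurable:
  assumes "A \<noteq> {}" "A \<subseteq> X" shows "err n A \<in> borel_measurable borel"
proof -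
  have "(\<lambda>s. hausdorff_distance d (S s ` A) (image_cells n A j)) \<in> borel_measurable borel" for j
    using hull_props[OF assms] assms
    by (intro borel_measurable_continuous_onI continuous_at_imp_continuous_on ballI isCont_hausdorff_S) auto
  then show ?thesis
    unfolding err_def[abs_def]
    by (rule measurable_compose_countable[OF _ step_count_measurable])
qed

lemma err_bounds:
  assumes "A \<noteq> {}" "A \<subseteq> X"
  obtains D where "\<And>n s. 0 \<le> err n A s" "\<And>n s. err n A s \<le> D"
proof -
  obtain D where D: "D \<ge> 0" "\<And>x y. x \<in> X \<Longrightarrow> y \<in> X \<Longrightarrow> d x y \<le> D"
    by (rule d_bounded) (rule that; assumption)
  note hp = hull_props[OF assms]
  show thesis
  proof (rule that[of D])
    fix n s
    show "0 \<le> err n A s"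
      unfolding err_def using assms hp S_image_subset by (intro hausdorff_nonneg) auto
    have "S s ` A \<subseteq> X" "S s ` A \<noteq> {}" using assms S_image_subset by auto
    then show "err n A s \<le> D"
      unfolding err_def
    proof (intro hausdorff_le_pointwise)
      fix a assume "a \<in> S s ` A"
      then have "d a b \<le> D" if "b \<in> image_cells n A (step_count (\<tau> n) s)" for b
        using D(2) that \<open>S s ` A \<subseteq> X\<close> hp(5) by blast
      then show "\<exists>b\<in>image_cells n A (step_count (\<tau> n) s). d a b \<le> D" using hp(4) by blast
    next
      fix b assume "b \<in> image_cells n A (step_count (\<tau> n) s)"
      then have "d a b \<le> D" if "a \<in> S s ` A" for a
        using D(2) that \<open>S s ` A \<subseteq> X\<close> hp(5) by blast
      then show "\<exists>a\<in>S s ` A. d a b \<le> D" using \<open>S s ` A \<noteq> {}\<close> by blast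
    qed (use hp(4) \<open>S s ` A \<noteq> {}\<close> in auto)
  qed
qed

abbreviation disc_corr :: "nat \<Rightarrow> ('a \<Rightarrow> complex) \<Rightarrow> ('a \<Rightarrow> complex) \<Rightarrow> real \<Rightarrow> complex" where
  "disc_corr n g h s \<equiv> cs.corr n g h (step_count (\<tau> n) s)"

abbreviation flow_corr :: "('a \<Rightarrow> complex) \<Rightarrow> ('a \<Rightarrow> complex) \<Rightarrow> real \<Rightarrow> complex" where
  "flow_corr g h s \<equiv> inner_L2 M h (koopman S s g)"

lemma disc_measurable [measurable]: "disc_corr n g h \<in> borel_measurable borel"
  by measurable

lemma disc_tendsto_indicator:
  assumes A: "compact A" "A \<noteq> {}" "A \<subseteq> X" and h: "h \<in> L2 M" and r: "strict_mono r"
    and lim: "(\<lambda>n. err (r n) A (- s)) \<longlonglongrightarrow> 0"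
  shows "(\<lambda>n. disc_corr (r n) (\<lambda>x. indicator A x) h s) \<longlonglongrightarrow> flow_corr (\<lambda>x. indicator A x) h s"
proof -
  note hp = hull_props[OF A(2,3)]
  have As: "A \<in> sets M" by (rule compact_sets_M[OF A(1,3)])
  let ?B = "\<lambda>n. image_cells (r n) A (step_count (\<tau> (r n)) (- s))"
  have "(\<lambda>n. norm_L2 M (\<lambda>x. indicator (?B n) x - indicator (S (- s) ` A) x)) \<longlonglongrightarrow> 0"
  proof (rule indicator_tendsto_L2)
    show "(\<lambda>n. hausdorff_distance d (S (- s) ` A) (?B n)) \<longlonglongrightarrow> 0"
      using lim by (simp add: err_def)
    show "(\<lambda>n. measure M (?B n)) \<longlonglongrightarrow> measure M (S (- s) ` A)"
      using LIMSEQ_subseq_LIMSEQ[OF hull_tendsto(1)[OF A] r] by (simp add: hp(7) measure_S_image[OF As] comp_def)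
  qed (use A compact_S_image S_image_subset hp in auto)
  then have 1: "(\<lambda>n. inner_L2 M h (\<lambda>x. indicator (?B n) x)) \<longlonglongrightarrow> inner_L2 M h (\<lambda>x. indicator (S (- s) ` A) x)"
    by (intro inner_L2_tendsto_right h L2_ind hp(6) S_image_sets As)
  have "(\<lambda>n. disc_corr (r n) (\<lambda>x. indicator A x) h s - inner_L2 M h (\<lambda>x. indicator (?B n) x)) \<longlonglongrightarrow> 0"
  proof (rule Lim_null_comparison)
    let ?e = "\<lambda>n. norm_L2 M h * norm_L2 M (\<lambda>x. indicator A x - indicator (cell_hull (P n) A) x :: complex)"
    \<comment> \<open>Rounding away from zero is odd in time, so the image under minus the step
      count of s is the image at the rounded time of -s.\<close>
    have "norm (disc_corr (r n) (\<lambda>x. indicator A x) h s - inner_L2 M h (\<lambda>x. indicator (?B n) x)) \<le> (?e \<circ> r) n" for n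
      using cs.corr_indicator[OF As h, of "r n" "step_count (\<tau> (r n)) s"]
      by (simp add: image_cells_def step_count_minus[OF \<tau>_pos])
    then show "\<forall>\<^sub>F n in sequentially. norm (disc_corr (r n) (\<lambda>x. indicator A x) h s - inner_L2 M h (\<lambda>x. indicator (?B n) x)) \<le> (?e \<circ> r) n"
      by simp
    show "(?e \<circ> r) \<longlonglongrightarrow> 0"
      by (rule LIMSEQ_subseq_LIMSEQ[OF tendsto_mult_right_zero[OF hull_tendsto(2)[OF A]] r])
  qed
  from tendsto_add[OF this 1] show ?thesis
    using inner_koopman_indicator[OF A(3), of h s] by simp
qed

lemma koopman_diff: "koopman S s (\<lambda>x. g x - g' x) = (\<lambda>x. koopman S s g x - koopman S s g' x)"
  and koopman_add: "koopman S s (\<lambda>x. g x + g' x) = (\<lambda>x. koopman S s g x + koopman S s g' x)"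
  and koopman_scale: "koopman S s (\<lambda>x. c * g x) = (\<lambda>x. c * koopman S s g x)"
  by (auto simp: koopman_def)

lemma cont_diff:
  assumes "g \<in> L2 M" "g' \<in> L2 M" "h \<in> L2 M"
  shows "flow_corr (\<lambda>x. g x - g' x) h s = flow_corr g h s - flow_corr g' h s"
  unfolding koopman_diff by (intro inner_L2_diff_right koopman_L2 assms)

lemma cont_bound:
  assumes "g \<in> L2 M" "h \<in> L2 M" shows "cmod (flow_corr g h s) \<le> norm_L2 M h * norm_L2 M g"
  using inner_L2_Cauchy_Schwarz[OF assms(2) koopman_L2(1)[OF assms(1)]] koopman_L2(2)[OF assms(1)] by simp

text \<open>Using a general measure \<open>\<kappa>\<close> on the time axis covers both Lebesgue measure on
  an interval and the point mass at time zero.\<close>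

context
  fixes \<kappa> :: "real measure" and h :: "'a \<Rightarrow> complex"
  assumes \<kappa>: "finite_measure \<kappa>" and sets_\<kappa> [measurable_cong, simp]: "sets \<kappa> = sets borel" and h: "h \<in> L2 M"
    and err_lim: "\<And>A. compact A \<Longrightarrow> A \<noteq> {} \<Longrightarrow> A \<subseteq> X \<Longrightarrow> (\<lambda>n. LINT s|\<kappa>. err n A (- s)) \<longlonglongrightarrow> 0"
begin

interpretation \<kappa>: finite_measure \<kappa> by (rule \<kappa>)

text \<open>The Bochner integral of a non-measurable function is 0 by convention, so the convergence
  would carry no information without the measurability clause.\<close>

definition approximable :: "('a \<Rightarrow> complex) \<Rightarrow> bool" where
  "approximable g \<longleftrightarrow> g \<in> L2 M \<and> flow_corr g h \<in> borel_measurable borel \<and>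
    (\<lambda>n. LINT s|\<kappa>. cmod (disc_corr n g h s - flow_corr g h s)) \<longlonglongrightarrow> 0"

lemma difference_bound:
  assumes "g \<in> L2 M"
  shows "cmod (disc_corr n g h s - flow_corr g h s) \<le> 2 * (norm_L2 M h * norm_L2 M g)"
  using norm_triangle_ineq4[of "disc_corr n g h s" "flow_corr g h s"] cs.corr_bound[OF assms h, of n "step_count (\<tau> n) s"]
    cont_bound[OF assms h, of s] by linarith

lemma difference_integrable:
  assumes "g \<in> L2 M" "flow_corr g h \<in> borel_measurable borel"
  shows "integrable \<kappa> (\<lambda>s. cmod (disc_corr n g h s - flow_corr g h s))"
proof (rule \<kappa>.integrable_const_bound)
  show "AE s in \<kappa>. norm (cmod (disc_corr n g h s - flow_corr g h s)) \<le> 2 * (norm_L2 M h * norm_L2 M g)"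
    using difference_bound[OF assms(1)] by simp
  have [measurable]: "flow_corr g h \<in> borel_measurable borel" by fact
  show "(\<lambda>s. cmod (disc_corr n g h s - flow_corr g h s)) \<in> borel_measurable \<kappa>" by measurable
qed

text \<open>Every subsequence is refined until the error tends to 0 almost everywhere; there
  \<open>disc_tendsto_indicator\<close> applies at almost every time, and the bound on correlations
  permits dominated convergence.\<close>

lemma approximable_compact:
  assumes A: "compact A" "A \<noteq> {}" "A \<subseteq> X"
  shows "approximable (\<lambda>x. indicator A x)"
proof -
  have L: "(\<lambda>x. indicator A x :: complex) \<in> L2 M" by (rule L2_ind[OF compact_sets_M[OF A(1,3)]])
  have cm[measurable]: "flow_corr (\<lambda>x. indicator A x) h \<in> borel_measurable borel"
    using isCont_inner_koopman_indicator[OF A h]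
    by (intro borel_measurable_continuous_onI continuous_at_imp_continuous_on) auto
  have [measurable]: "err n A \<in> borel_measurable borel" for n
    by (rule err_measurable[OF A(2,3)])
  obtain D where D: "\<And>n s. 0 \<le> err n A s" "\<And>n s. err n A s \<le> D"
    by (rule err_bounds[OF A(2,3)]) (rule that; assumption)
  have int: "integrable \<kappa> (\<lambda>s. err n A (- s))" for n
    by (rule \<kappa>.integrable_const_bound[of _ D]) (use D in auto)
  have "(\<lambda>n. LINT s|\<kappa>. cmod (disc_corr n (\<lambda>x. indicator A x) h s - flow_corr (\<lambda>x. indicator A x) h s)) \<longlonglongrightarrow> 0"
  proof (rule tendsto_0_subseqI)
    fix r :: "nat \<Rightarrow> nat" assume r: "strict_mono r"
    have "(\<lambda>n. LINT s|\<kappa>. norm (err (r n) A (- s))) \<longlonglongrightarrow> 0"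
      using LIMSEQ_subseq_LIMSEQ[OF err_lim[OF A] r] D(1) by (simp add: comp_def)
    from tendsto_L1_AE_subseq[OF int this] obtain t :: "nat \<Rightarrow> nat" where t: "strict_mono t"
      and ae: "AE s in \<kappa>. (\<lambda>n. err (r (t n)) A (- s)) \<longlonglongrightarrow> 0" by blast
    have rt: "strict_mono (\<lambda>n. r (t n))" using strict_mono_o[OF r t] by (simp add: comp_def)
    have "(\<lambda>n. LINT s|\<kappa>. cmod (disc_corr (r (t n)) (\<lambda>x. indicator A x) h s - flow_corr (\<lambda>x. indicator A x) h s))
        \<longlonglongrightarrow> (LINT s|\<kappa>. 0)"
    proof (rule integral_dominated_convergence[where w="\<lambda>_. 2 * (norm_L2 M h * norm_L2 M (\<lambda>x. indicator A x :: complex))"])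
      show "AE s in \<kappa>. (\<lambda>n. cmod (disc_corr (r (t n)) (\<lambda>x. indicator A x) h s - flow_corr (\<lambda>x. indicator A x) h s)) \<longlonglongrightarrow> 0"
        using ae
      proof eventually_elim
        case (elim s)
        show ?case
          using disc_tendsto_indicator[OF A h rt elim] by (intro tendsto_norm_zero LIM_zero)
      qed
      show "AE s in \<kappa>. norm (cmod (disc_corr (r (t n)) (\<lambda>x. indicator A x) h s - flow_corr (\<lambda>x. indicator A x) h s))
          \<le> 2 * (norm_L2 M h * norm_L2 M (\<lambda>x. indicator A x :: complex))" for n
        using difference_bound[OF L] by simp
    qed measurable
    then show "\<exists>t. strict_mono t \<and> (\<lambda>n. LINT s|\<kappa>. cmod (disc_corr (r (t n)) (\<lambda>x. indicator A x) h s - flow_corr (\<lambda>x. indicator A x) h s)) \<longlonglongrightarrow> 0"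
      using t by auto
  qed
  then show ?thesis using L cm by (simp add: approximable_def)
qed

lemma approximable_zero: "approximable (\<lambda>x. 0)"
proof -
  have "flow_corr (\<lambda>x. 0) h s = 0" "disc_corr n (\<lambda>x. 0) h s = 0" for n s
    by (simp_all add: inner_L2_def koopman_def cs.corr_def cs.avg_eq)
  then show ?thesis by (simp add: approximable_def L2_zero)
qed

lemma approximable_scale: assumes "approximable g" shows "approximable (\<lambda>x. c * g x)"
proof -
  have "flow_corr (\<lambda>x. c * g x) h s = c * flow_corr g h s" for s
    unfolding koopman_scale by (rule inner_L2_scale_right)
  moreover have "cmod (disc_corr n (\<lambda>x. c * g x) h s - c * flow_corr g h s) = cmod c * cmod (disc_corr n g h s - flow_corr g h s)" for n s
    by (simp add: cs.corr_scale norm_mult flip: right_diff_distrib)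
  moreover have "(\<lambda>s. c * flow_corr g h s) \<in> borel_measurable borel"
    using assms by (intro borel_measurable_times) (auto simp: approximable_def)
  ultimately show ?thesis
    using assms tendsto_mult_right_zero[of "\<lambda>n. LINT s|\<kappa>. cmod (disc_corr n g h s - flow_corr g h s)" _ "cmod c"]
    by (simp add: approximable_def L2_scale)
qed

text \<open>The additional term does not depend on n, which is what allows the limits in n and in
  the function to be exchanged.\<close>

lemma approximable_close:
  assumes g: "g \<in> L2 M" "flow_corr g h \<in> borel_measurable borel"
    and g': "g' \<in> L2 M" "flow_corr g' h \<in> borel_measurable borel"
  shows "(LINT s|\<kappa>. cmod (disc_corr n g h s - flow_corr g h s))
    \<le> (LINT s|\<kappa>. cmod (disc_corr n g' h s - flow_corr g' h s)) + 2 * (norm_L2 M h * norm_L2 M (\<lambda>x. g x - g' x)) * measure \<kappa> UNIV"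
proof -
  let ?e = "2 * (norm_L2 M h * norm_L2 M (\<lambda>x. g x - g' x))"
  have univ: "space \<kappa> = UNIV" using sets_eq_imp_space_eq[OF sets_\<kappa>] by simp
  have "(LINT s|\<kappa>. cmod (disc_corr n g h s - flow_corr g h s)) \<le> (LINT s|\<kappa>. cmod (disc_corr n g' h s - flow_corr g' h s) + ?e)"
  proof (rule integral_mono)
    fix s
    have "disc_corr n g h s - flow_corr g h s
        = (disc_corr n g' h s - flow_corr g' h s) + (disc_corr n (\<lambda>x. g x - g' x) h s - flow_corr (\<lambda>x. g x - g' x) h s)"
      by (simp add: cs.corr_diff[OF g(1) g'(1)] cont_diff[OF g(1) g'(1) h])
    then show "cmod (disc_corr n g h s - flow_corr g h s) \<le> cmod (disc_corr n g' h s - flow_corr g' h s) + ?e"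
      using difference_bound[OF L2_diff[OF g(1) g'(1)], of n s]
        norm_triangle_ineq[of "disc_corr n g' h s - flow_corr g' h s" "disc_corr n (\<lambda>x. g x - g' x) h s - flow_corr (\<lambda>x. g x - g' x) h s"]
      by simp
  qed (intro difference_integrable g g' Bochner_Integration.integrable_add \<kappa>.integrable_const)+
  also have "\<dots> = (LINT s|\<kappa>. cmod (disc_corr n g' h s - flow_corr g' h s)) + ?e * measure \<kappa> UNIV"
    using difference_integrable[OF g'] by (simp add: univ)
  finally show ?thesis .
qed

lemma approximable_add: assumes "approximable g" "approximable g'" shows "approximable (\<lambda>x. g x + g' x)"
proof -
  have g: "g \<in> L2 M" "flow_corr g h \<in> borel_measurable borel" "g' \<in> L2 M" "flow_corr g' h \<in> borel_measurable borel"
    using assms by (auto simp: approximable_def)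
  have eq: "flow_corr (\<lambda>x. g x + g' x) h s = flow_corr g h s + flow_corr g' h s" for s
    unfolding koopman_add by (intro inner_L2_add_right koopman_L2 g h)
  have sum_lim: "(\<lambda>n. (LINT s|\<kappa>. cmod (disc_corr n g h s - flow_corr g h s)) + (LINT s|\<kappa>. cmod (disc_corr n g' h s - flow_corr g' h s))) \<longlonglongrightarrow> 0"
    by (rule tendsto_add_zero) (use assms in \<open>simp_all add: approximable_def\<close>)
  have "(\<lambda>n. LINT s|\<kappa>. cmod (disc_corr n (\<lambda>x. g x + g' x) h s - flow_corr (\<lambda>x. g x + g' x) h s)) \<longlonglongrightarrow> 0"
  proof (rule tendsto_sandwich[OF _ _ tendsto_const sum_lim])
    have "(LINT s|\<kappa>. cmod (disc_corr n (\<lambda>x. g x + g' x) h s - flow_corr (\<lambda>x. g x + g' x) h s))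
        \<le> (LINT s|\<kappa>. cmod (disc_corr n g h s - flow_corr g h s) + cmod (disc_corr n g' h s - flow_corr g' h s))" for n
    proof (rule integral_mono')
      fix s
      have "disc_corr n (\<lambda>x. g x + g' x) h s - flow_corr (\<lambda>x. g x + g' x) h s = (disc_corr n g h s - flow_corr g h s) + (disc_corr n g' h s - flow_corr g' h s)"
        by (simp add: eq cs.corr_add[OF g(1,3)])
      then show "cmod (disc_corr n (\<lambda>x. g x + g' x) h s - flow_corr (\<lambda>x. g x + g' x) h s) \<le> cmod (disc_corr n g h s - flow_corr g h s) + cmod (disc_corr n g' h s - flow_corr g' h s)"
        by (simp only: norm_triangle_ineq)
    qed (auto intro!: difference_integrable g)
    then show "\<forall>\<^sub>F n in sequentially. (LINT s|\<kappa>. cmod (disc_corr n (\<lambda>x. g x + g' x) h s - flow_corr (\<lambda>x. g x + g' x) h s))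
        \<le> (LINT s|\<kappa>. cmod (disc_corr n g h s - flow_corr g h s)) + (LINT s|\<kappa>. cmod (disc_corr n g' h s - flow_corr g' h s))"
      by (simp add: difference_integrable g)
  qed simp
  moreover have "flow_corr (\<lambda>x. g x + g' x) h \<in> borel_measurable borel"
    unfolding eq using g by measurable
  ultimately show ?thesis using L2_add[OF g(1,3)] by (simp add: approximable_def)
qed

lemma approximable_sum: "finite I \<Longrightarrow> (\<And>i. i \<in> I \<Longrightarrow> approximable (g i)) \<Longrightarrow> approximable (\<lambda>x. \<Sum>i\<in>I. g i x)"
  by (induction I rule: finite_induct) (auto intro: approximable_zero approximable_add)

text \<open>By \<open>approximable_close\<close> a single good approximant is fixed before n grows.
  Measurability in time survives because the flow correlations converge pointwise.\<close>

lemma approximable_limit: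
  assumes gk: "\<And>k. approximable (g k)" and g: "g' \<in> L2 M" and lim: "(\<lambda>k. norm_L2 M (\<lambda>x. g k x - g' x)) \<longlonglongrightarrow> 0"
  shows "approximable g'"
proof -
  have gL: "g k \<in> L2 M" and gm: "flow_corr (g k) h \<in> borel_measurable borel" for k
    using gk by (auto simp: approximable_def)
  have "(\<lambda>k. flow_corr (g k) h s) \<longlonglongrightarrow> flow_corr g' h s" for s
  proof (rule inner_L2_tendsto_right[OF h])
    show "(\<lambda>k. norm_L2 M (\<lambda>x. koopman S s (g k) x - koopman S s g' x)) \<longlonglongrightarrow> 0"
      using lim by (simp only: koopman_diff[symmetric] koopman_L2(2)[OF L2_diff[OF gL g]])
  qed (intro koopman_L2 gL g)+
  then have m: "flow_corr g' h \<in> borel_measurable borel"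
    by (rule borel_measurable_LIMSEQ_metric[OF gm])
  have sym: "norm_L2 M (\<lambda>x. g' x - g k x) = norm_L2 M (\<lambda>x. g k x - g' x)" for k
    by (simp add: norm_L2_def norm_minus_commute)
  have "(\<lambda>n. LINT s|\<kappa>. cmod (disc_corr n g' h s - flow_corr g' h s)) \<longlonglongrightarrow> 0"
  proof (rule order_tendstoI)
    fix e :: real assume e: "e > 0"
    have "(\<lambda>k. 2 * (norm_L2 M h * norm_L2 M (\<lambda>x. g k x - g' x)) * measure \<kappa> UNIV) \<longlonglongrightarrow> 2 * (norm_L2 M h * 0) * measure \<kappa> UNIV"
      by (intro tendsto_intros lim)
    then have "\<forall>\<^sub>F k in sequentially. 2 * (norm_L2 M h * norm_L2 M (\<lambda>x. g k x - g' x)) * measure \<kappa> UNIV < e / 2"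
      using e by (intro order_tendstoD) auto
    then obtain k where k: "2 * (norm_L2 M h * norm_L2 M (\<lambda>x. g k x - g' x)) * measure \<kappa> UNIV < e / 2"
      by (auto simp: eventually_sequentially)
    have "\<forall>\<^sub>F n in sequentially. (LINT s|\<kappa>. cmod (disc_corr n (g k) h s - flow_corr (g k) h s)) < e / 2"
      using gk[of k] e by (intro order_tendstoD) (auto simp: approximable_def)
    then show "\<forall>\<^sub>F n in sequentially. (LINT s|\<kappa>. cmod (disc_corr n g' h s - flow_corr g' h s)) < e"
    proof eventually_elim
      case (elim n)
      then show ?case using approximable_close[OF g m gL gm, of n k] k unfolding sym by linarith
    qed
  next
    fix e :: real assume "e < 0"
    then have "e < (LINT s|\<kappa>. cmod (disc_corr n g' h s - flow_corr g' h s))" for n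
      by (rule less_le_trans) simp
    then show "\<forall>\<^sub>F n in sequentially. e < (LINT s|\<kappa>. cmod (disc_corr n g' h s - flow_corr g' h s))" by simp
  qed
  then show ?thesis using g m by (simp add: approximable_def)
qed

text \<open>Inner regularity: compact subsets exhaust a Borel set in measure, and for nested sets
  this is convergence of indicators in mean square.\<close>

lemma approximable_indicator:
  assumes A: "A \<in> sets M" shows "approximable (\<lambda>x. indicator A x)"
proof -
  have Ab: "A \<in> sets borel" "A \<subseteq> X" using A by (auto simp: sets_M_iff)
  have idm: "(\<lambda>x. x) \<in> measurable M borel"
    by (rule measurableI) (auto simp: sets_M_iff space_M intro!: sets.Int X_borel)
  \<comment> \<open>The regularity theorem concerns Borel measures on the whole space, so the
    measure on X is pushed forward along the inclusion.\<close>
  let ?M = "distr M borel (\<lambda>x. x)"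
  have em: "emeasure ?M B = emeasure M B" if "B \<in> sets borel" "B \<subseteq> X" for B
    using that by (simp add: emeasure_distr[OF idm] space_M Int_absorb2)
  have reg: "emeasure ?M A = (SUP K\<in>{K. K \<subseteq> A \<and> compact K}. emeasure ?M K)"
    by (rule inner_regular) (use Ab idm in \<open>auto simp: emeasure_distr space_M\<close>)
  have "\<exists>K. K \<subseteq> A \<and> compact K \<and> measure M A < measure M K + 1 / real (Suc k)" for k
  proof (rule ccontr)
    assume no: "\<not> ?thesis"
    then have "emeasure ?M K \<le> ennreal (measure M A - 1 / real (Suc k))" if "K \<subseteq> A" "compact K" for K
      using that Ab em[of K] by (auto simp: borel_compact emeasure_eq_measure not_less intro!: ennreal_leI simp del: of_nat_Suc)
    then have "emeasure ?M A \<le> ennreal (measure M A - 1 / real (Suc k))"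
      unfolding reg by (intro SUP_least) auto
    then have "ennreal (measure M A) \<le> ennreal (measure M A - 1 / real (Suc k))"
      using em[OF Ab] by (simp add: emeasure_eq_measure)
    \<comment> \<open>\<open>ennreal\<close> sends negative numbers to 0, so the preceding
      inequality is contradictory only for positive measure; in the null case the empty set is
      already a witness.\<close>
    moreover have "measure M A \<noteq> 0"
    proof
      assume "measure M A = 0"
      with no show False by (auto dest!: spec[of _ "{}"])
    qed
    ultimately show False
      by (simp add: ennreal_le_iff2 zero_less_measure_iff[symmetric] del: of_nat_Suc)
  qed
  then obtain K where K: "\<And>k. K k \<subseteq> A" "\<And>k. compact (K k)" "\<And>k. measure M A < measure M (K k) + 1 / real (Suc k)"
    by metis
  have Ks: "K k \<in> sets M" for k by (intro compact_sets_M K(2) order_trans[OF K(1) Ab(2)])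
  have "approximable (\<lambda>x. indicator (K k) x)" for k
  proof (cases "K k = {}")
    case True
    then show ?thesis using approximable_zero by simp
  next
    case False
    then show ?thesis by (intro approximable_compact K(2) order_trans[OF K(1) Ab(2)])
  qed
  moreover have "(\<lambda>k. norm_L2 M (\<lambda>x. indicator (K k) x - indicator A x)) \<longlonglongrightarrow> 0"
  proof (rule tendsto_sandwich[OF _ _ tendsto_const])
    have "norm_L2 M (\<lambda>x. indicator (K k) x - indicator A x) \<le> sqrt (1 / real (Suc k))" for k
    proof (rule real_le_rsqrt)
      have "K k - A = {}" using K(1) by auto
      then have "measure M (K k - A) = 0" by (simp only: measure_empty)
      then show "(norm_L2 M (\<lambda>x. indicator (K k) x - indicator A x))\<^sup>2 \<le> 1 / real (Suc k)"
        using K(3)[of k] finite_measure_Diff[OF A Ks K(1), of k]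
        by (simp add: norm_L2_indicator_diff[OF Ks A] del: of_nat_Suc)
    qed
    then show "\<forall>\<^sub>F k in sequentially. norm_L2 M (\<lambda>x. indicator (K k) x - indicator A x) \<le> sqrt (1 / real (Suc k))"
      by simp
    have "(\<lambda>k. 1 / real (Suc k)) \<longlonglongrightarrow> 0"
      using LIMSEQ_Suc[OF lim_const_over_n[of 1]] by simp
    from tendsto_real_sqrt[OF this] show "(\<lambda>k. sqrt (1 / real (Suc k))) \<longlonglongrightarrow> 0" by simp
  qed simp
  ultimately show ?thesis by (rule approximable_limit[OF _ L2_ind[OF A]])
qed

lemma approximable_simple:
  assumes F: "simple_function M F" shows "approximable F"
proof -
  let ?F = "\<lambda>x. \<Sum>y\<in>F ` space M. y * indicator (F -` {y} \<inter> space M) x"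
  have fin: "finite (F ` space M)" using F by (simp add: simple_function_def)
  have sets: "F -` {y} \<inter> space M \<in> sets M" if "y \<in> F ` space M" for y
    using F that by (auto simp: simple_function_def)
  have 1: "approximable ?F"
    by (intro approximable_sum fin approximable_scale approximable_indicator sets)
  have eq: "?F x = F x" if x: "x \<in> space M" for x
  proof -
    have "?F x = (\<Sum>y\<in>F ` space M. if y = F x then y else 0)"
      using x by (intro sum.cong) (auto split: split_indicator)
    then show ?thesis using fin x by simp
  qed
  have "?F \<in> L2 M" using 1 by (simp add: approximable_def)
  then have FL: "F \<in> L2 M"
    unfolding L2_iff using eq borel_measurable_simple_function[OF F]
    by (simp cong: Bochner_Integration.integrable_cong)
  have "norm_L2 M (\<lambda>x. ?F x - F x) = 0"
    unfolding norm_L2_def using eq by (simp cong: Bochner_Integration.integral_cong)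
  then show ?thesis
    by (intro approximable_limit[of "\<lambda>_. ?F" F] 1 FL) simp
qed

lemma approximable_L2:
  assumes g: "g \<in> L2 M" shows "approximable g"
proof -
  have gm[measurable]: "g \<in> borel_measurable M" using g by (rule L2_measurable)
  obtain F where F: "\<And>i. simple_function M (F i)" "\<And>x. x \<in> space M \<Longrightarrow> (\<lambda>i. F i x) \<longlonglongrightarrow> g x"
    "\<And>i x. x \<in> space M \<Longrightarrow> dist (F i x) 0 \<le> 2 * dist (g x) 0"
    using borel_measurable_implies_sequence_metric[OF gm, of 0] by blast
  have [measurable]: "F i \<in> borel_measurable M" for i by (rule borel_measurable_simple_function[OF F(1)])
  have "(\<lambda>i. LINT x|M. (cmod (F i x - g x))\<^sup>2) \<longlonglongrightarrow> (LINT x|M. 0)"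
  \<comment> \<open>The approximants are at most 2|g|, so their distance from g is at most 3|g|,
    whose square gives the constant.\<close>
  proof (rule integral_dominated_convergence[where w="\<lambda>x. 9 * (cmod (g x))\<^sup>2"])
    show "AE x in M. (\<lambda>i. (cmod (F i x - g x))\<^sup>2) \<longlonglongrightarrow> 0"
    proof (rule AE_I2)
      fix x assume "x \<in> space M"
      then have "(\<lambda>i. (cmod (F i x - g x))\<^sup>2) \<longlonglongrightarrow> (cmod (g x - g x))\<^sup>2"
        by (intro tendsto_intros F)
      then show "(\<lambda>i. (cmod (F i x - g x))\<^sup>2) \<longlonglongrightarrow> 0" by simp
    qed
    show "AE x in M. norm ((cmod (F i x - g x))\<^sup>2) \<le> 9 * (cmod (g x))\<^sup>2" for i
    proof (rule AE_I2)
      fix x assume "x \<in> space M"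
      then have "cmod (F i x - g x) \<le> 3 * cmod (g x)"
        using F(3)[of x i] norm_triangle_ineq4[of "F i x" "g x"] by simp
      then have "(cmod (F i x - g x))\<^sup>2 \<le> (3 * cmod (g x))\<^sup>2" by (intro power_mono) auto
      then show "norm ((cmod (F i x - g x))\<^sup>2) \<le> 9 * (cmod (g x))\<^sup>2" by (simp add: power_mult_distrib)
    qed
  qed (use g in \<open>auto simp: L2_iff\<close>)
  from tendsto_real_sqrt[OF this] have "(\<lambda>i. norm_L2 M (\<lambda>x. F i x - g x)) \<longlonglongrightarrow> 0"
    by (simp add: norm_L2_def)
  then show ?thesis by (intro approximable_limit[OF approximable_simple[OF F(1)] g])
qed

lemma disc_tendsto_L1:
  assumes "g \<in> L2 M"
  shows "(\<lambda>n. LINT s|\<kappa>. cmod (disc_corr n g h s - flow_corr g h s)) \<longlonglongrightarrow> 0" "flow_corr g h \<in> borel_measurable borel"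
  using approximable_L2[OF assms] by (auto simp: approximable_def)

end

text \<open>The time interval is symmetric, so reflection removes the sign that pulling back sets
  introduces, and the integral becomes the one in the definition of periodic approximation.\<close>

lemma err_integral_tendsto:
  assumes A: "compact A" "A \<noteq> {}" "A \<subseteq> X" and T: "T > 0"
  shows "(\<lambda>n. LINT s|density lborel (\<lambda>s. ennreal (indicator {-T..T} s)). err n A (- s)) \<longlonglongrightarrow> 0"
proof -
  have [measurable]: "err n A \<in> borel_measurable borel" for n
    by (rule err_measurable[OF A(2,3)])
  have "(LINT s|density lborel (\<lambda>s. ennreal (indicator {-T..T} s)). err n A (- s)) = (LBINT s=-T..T. err n A s)" for n
  proof -
    have "(LINT s|density lborel (\<lambda>s. ennreal (indicator {-T..T} s)). err n A (- s)) = (LINT s|lborel. indicator {-T..T} s *\<^sub>R err n A (- s))"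
      by (subst integral_density) auto
    also have "\<dots> = (LINT s|lborel. indicator {-T..T} (- s) *\<^sub>R err n A (- s))"
      by (intro Bochner_Integration.integral_cong refl) (auto split: split_indicator)
    also have "\<dots> = (LINT s|lborel. indicator {-T..T} s *\<^sub>R err n A s)"
      using lborel_integral_real_affine[of "-1" "\<lambda>s. indicator {-T..T} s *\<^sub>R err n A s" 0] by simp
    also have "\<dots> = (LINT s:{-T..T}|lborel. err n A s)"
      by (simp add: set_lebesgue_integral_def)
    also have "\<dots> = (LBINT s=-T..T. err n A s)"
      using T interval_integral_Icc[of "-T" T "err n A"] by simp
    finally show ?thesis .
  qed
  then show ?thesis
    using approx[OF A, of T] by (simp add: err_def image_cells_def)
qed

lemma err_0: "A \<noteq> {} \<Longrightarrow> A \<subseteq> X \<Longrightarrow> err n A 0 = hausdorff_distance d A (cell_hull (P n) A)"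
proof -
  assume A: "A \<noteq> {}" "A \<subseteq> X"
  have "step_count (\<tau> n) 0 = 0" by (simp add: step_count_def)
  moreover have "image_cells n A 0 = cell_hull (P n) A"
    using cs.subset_Union_cells[of "{p \<in> P n. p \<inter> A \<noteq> {}}" n]
    by (simp add: image_cells_def cell_hull_def act_on_union_def int_iterate_def)
  moreover have "S 0 ` A = A" using A(2) S_0 by (simp add: subset_iff cong: image_cong_simp)
  ultimately show ?thesis by (simp add: err_def)
qed

lemma disc_corr_tendsto_interval:
  assumes g: "g \<in> L2 M" "h \<in> L2 M" and T: "T > 0"
  shows "(\<lambda>n. LINT s:{-T..T}|lborel. cmod (disc_corr n g h s - flow_corr g h s)) \<longlonglongrightarrow> 0"
proof -
  let ?\<kappa> = "density lborel (\<lambda>s. ennreal (indicator {-T..T} s))"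
  have fin: "finite_measure ?\<kappa>"
    by (rule finite_measureI) (simp add: emeasure_density ennreal_indicator emeasure_lborel_Icc_eq)
  note lim = disc_tendsto_L1[OF fin _ g(2) err_integral_tendsto[OF _ _ _ T] g(1)]
  have [measurable]: "flow_corr g h \<in> borel_measurable borel" by (rule lim(2)) simp_all
  have "(LINT s|?\<kappa>. cmod (disc_corr n g h s - flow_corr g h s)) = (LINT s:{-T..T}|lborel. cmod (disc_corr n g h s - flow_corr g h s))" for n
    unfolding set_lebesgue_integral_def by (subst integral_density) auto
  then show ?thesis using lim(1) by simp
qed

text \<open>With the unit point mass as measure on the time axis the error reduces to the distance
  between a set and its hull. For g = h this yields the convergence of the total masses.\<close>

lemma disc_corr_tendsto_0:
  assumes g: "g \<in> L2 M" "h \<in> L2 M"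
  shows "(\<lambda>n. disc_corr n g h 0) \<longlonglongrightarrow> inner_L2 M h g"
proof -
  let ?\<kappa> = "return borel (0::real)"
  have fin: "finite_measure ?\<kappa>"
    by (intro prob_space.finite_measure prob_space_return) simp
  have "(\<lambda>n. LINT s|?\<kappa>. err n A (- s)) \<longlonglongrightarrow> 0" if A: "compact A" "A \<noteq> {}" "A \<subseteq> X" for A
  proof -
    have [measurable]: "err n A \<in> borel_measurable borel" for n
      by (rule err_measurable[OF A(2,3)])
    have "(LINT s|?\<kappa>. err n A (- s)) = hausdorff_distance d A (cell_hull (P n) A)" for n
      by (subst integral_return) (auto simp: err_0[OF A(2,3)])
    then show ?thesis using hausdorff_hull_tendsto[OF A(2,3)] by simp
  qed
  note lim = disc_tendsto_L1[OF fin _ g(2) this g(1)]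
  have [measurable]: "flow_corr g h \<in> borel_measurable borel" by (rule lim(2)) simp_all
  have "(LINT s|?\<kappa>. cmod (disc_corr n g h s - flow_corr g h s)) = cmod (disc_corr n g h 0 - flow_corr g h 0)" for n
    by (subst integral_return) auto
  then have "(\<lambda>n. cmod (disc_corr n g h 0 - flow_corr g h 0)) \<longlonglongrightarrow> 0" using lim(1) by simp
  then have "(\<lambda>n. disc_corr n g h 0) \<longlonglongrightarrow> flow_corr g h 0"
    by (rule LIM_zero_cancel[OF tendsto_norm_zero_cancel])
  moreover have "flow_corr g h 0 = inner_L2 M h g"
    unfolding inner_L2_def koopman_def by (intro Bochner_Integration.integral_cong) (auto simp: S_0 space_M)
  ultimately show ?thesis by simp
qed

end

section \<open>Uniform convergence of the smoothed spectral densities\<close>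

lemma cell_system_of_partition_sequence:
  assumes ref: "reference_measure X M" and part: "partition_sequence d X M q l P"
    and f: "bij_betw (f n) (P n) (P n)" and n: "n \<ge> 1"
  shows "cell_system M (q n) (P n) (f n)"
proof -
  have sp: "space M = X" "finite_measure M" "emeasure M X \<noteq> 0" using ref by (auto simp: reference_measure_def)
  interpret finite_measure M by fact
  have "measure M (space M) > 0"
    using sp by (simp add: zero_less_measure_iff emeasure_eq_measure)
  moreover have "finite (P n)" "card (P n) = q n" "P n \<subseteq> sets M" "\<Union>(P n) = space M"
    using part n sp(1) by (simp_all add: partition_sequence_def)
  moreover have "p \<inter> p' \<in> null_sets M" if "p \<in> P n" "p' \<in> P n" "p \<noteq> p'" for p p'
    using part n that by (simp add: partition_sequence_def)
  moreover have "measure M p = measure M (space M) / real (q n)" if "p \<in> P n" for p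
    using part n that unfolding sp(1) by (simp add: partition_sequence_def)
  ultimately show ?thesis
    using f by (intro cell_system.intro cell_system_axioms.intro finite_measure_axioms)
qed

theorem theorem5p3:
  fixes X :: "(real ^ 'n) set"
    and d :: "real ^ 'n \<Rightarrow> real ^ 'n \<Rightarrow> real"
    and S :: "real \<Rightarrow> real ^ 'n \<Rightarrow> real ^ 'n"
    and M :: "(real ^ 'n) measure"
    and E :: "real set \<Rightarrow> (real ^ 'n \<Rightarrow> complex) \<Rightarrow> real ^ 'n \<Rightarrow> complex"
    and \<tau> l :: "nat \<Rightarrow> real"
    and q :: "nat \<Rightarrow> nat"
    and P :: "nat \<Rightarrow> (real ^ 'n) set set"
    and f :: "nat \<Rightarrow> (real ^ 'n) set \<Rightarrow> (real ^ 'n) set"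
    and v :: "nat \<Rightarrow> nat \<Rightarrow> real ^ 'n \<Rightarrow> complex"
    and \<theta> :: "nat \<Rightarrow> nat \<Rightarrow> real"
    and g :: "real ^ 'n \<Rightarrow> complex"
    and \<alpha> :: real
  assumes "compact X"
    and "norm_induced d"
    and "lipschitz_flow d X S"
    and "reference_measure X M"
    and "flow_invariant M S"
    and "koopman_spectral_measure M S E"
    and "\<forall>n\<ge>1. \<tau> n > 0" and "antimono_on {1..} \<tau>" and "\<tau> \<longlonglongrightarrow> 0"
    and "partition_sequence d X M q l P"
    and "\<forall>n\<ge>1. bij_betw (f n) (P n) (P n)"
    and "periodically_approximates d X S \<tau> P f"
    and "\<forall>n\<ge>1. discrete_eigenbasis M (q n) (P n) (f n) (v n) (\<theta> n)"
    and "g \<in> L2 M"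
    and "\<alpha> > 0"
  shows "uniform_limit UNIV
           (\<lambda>n. smoothed \<alpha> (discrete_spectral_density M (q n) (v n) (\<lambda>k. \<theta> n k / \<tau> n)
                              (averaging M (q n) (P n) g)))
           (smoothed \<alpha> (spectral_density M E g))
           sequentially"
proof -
  note part = \<open>partition_sequence d X M q l P\<close> and g = \<open>g \<in> L2 M\<close>
  \<comment> \<open>The hypotheses hold from index 1 on, whereas the locale wants them at every
    index; all sequences are shifted by one, and the shift is removed in the last step.\<close>
  have \<tau>: "\<tau> (Suc n) > 0" for n using assms(7) by simp
  have \<tau>_lim: "(\<lambda>n. \<tau> (Suc n)) \<longlonglongrightarrow> 0" by (rule LIMSEQ_Suc[OF assms(9)])
  interpret pa: periodic_approximation X d M S "\<lambda>n. q (Suc n)" "\<lambda>n. l (Suc n)" "\<lambda>n. \<tau> (Suc n)" "\<lambda>n. P (Suc n)" "\<lambda>n. f (Suc n)"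
  proof (intro periodic_approximation.intro measured_flow.intro measured_region.intro compact_metric_region.intro
      periodic_approximation_axioms.intro measured_flow_axioms.intro measured_region_axioms.intro)
    show "cell_system M (q (Suc n)) (P (Suc n)) (f (Suc n))" for n
      by (rule cell_system_of_partition_sequence[OF assms(4) part assms(11)[rule_format]]) simp_all
    show "(\<lambda>n. l (Suc n)) \<longlonglongrightarrow> 0"
      using part by (intro LIMSEQ_Suc) (simp add: partition_sequence_def)
    have cell_diam: "\<forall>n\<ge>1. \<forall>p\<in>P n. \<forall>x\<in>p. \<forall>y\<in>p. d x y \<le> l n"
      using part by (simp add: partition_sequence_def)
    show "d x y \<le> l (Suc n)" if "p \<in> P (Suc n)" "x \<in> p" "y \<in> p" for n p x y
      using cell_diam[rule_format, OF _ that] by simp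
    show "(\<lambda>n. LBINT s=-ereal t..ereal t. hausdorff_distance d (S s ` A)
        (act_on_union (P (Suc n)) (f (Suc n)) (step_count (\<tau> (Suc n)) s) (cell_hull (P (Suc n)) A))) \<longlonglongrightarrow> 0"
      if "compact A" "A \<noteq> {}" "A \<subseteq> X" for t :: real and A
    proof -
      have "(\<lambda>n. LBINT s=-ereal t..ereal t. hausdorff_distance d (S s ` A)
          (act_on_union (P n) (f n) (step_count (\<tau> n) s) (cell_hull (P n) A))) \<longlonglongrightarrow> 0"
        using assms(12)[unfolded periodically_approximates_def, THEN spec[of _ t], THEN spec[of _ A]] that by simp
      then show ?thesis by (rule LIMSEQ_Suc)
    qed
  qed (rule assms(1-5) \<tau>)+
  have E: "projection_valued_measure M E"
    and K: "\<And>t. has_pvm_integral M E (\<lambda>\<omega>. exp (\<i> * of_real (\<omega> * t))) g (koopman S t g)"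
    using assms(6) g unfolding koopman_spectral_measure_def by blast+
  obtain \<nu> :: "real measure" where \<nu>: "finite_measure \<nu>" "sets \<nu> = sets borel"
    and \<nu>m: "\<And>B. B \<in> sets borel \<Longrightarrow> measure \<nu> B = (norm_L2 M (E B g))\<^sup>2"
    by (rule pvm_scalar_measure[OF E g]) (rule that; assumption)
  have \<nu>_total: "measure \<nu> UNIV = (norm_L2 M g)\<^sup>2"
  proof -
    have "norm_L2 M (E UNIV g) = norm_L2 M g"
      using E g pvm_L2[OF E _ g, of UNIV] unfolding projection_valued_measure_def by (intro norm_L2_cong_AE) auto
    then show ?thesis using \<nu>m[of UNIV] by simp
  qed
  \<comment> \<open>The spectral representation of the Koopman group, tested against g.\<close>
  have char: "(CLINT x|\<nu>. iexp (s * x)) = inner_L2 M g (koopman S s g)" for s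
    using pvm_integral_bounded[OF E g \<nu> \<nu>m _ _ K[of s] pa.koopman_L2(1)[OF g], of 1]
    by (simp add: mult.commute)
  define a where "a n k = (norm_L2 M (rank_one_projector M (v (Suc n) k) (averaging M (q (Suc n)) (P (Suc n)) g)))\<^sup>2" for n k
  define \<omega> where "\<omega> n k = \<theta> (Suc n) k / \<tau> (Suc n)" for n k
  have basis: "discrete_eigenbasis M (q (Suc n)) (P (Suc n)) (f (Suc n)) (v (Suc n)) (\<theta> (Suc n))" for n
    using assms(13) by simp
  have corr: "(\<Sum>k=1..q (Suc n). of_real (a n k) * iexp (of_int j * \<theta> (Suc n) k)) = pa.cs.corr n g g j" for n j
    unfolding a_def by (rule pa.cs.spectral_corr[OF basis g])
  \<comment> \<open>At a sampled time the step length cancels against the one dividing the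
    eigenphase, which leaves an integer power of the eigenvalue.\<close>
  have corr_step: "(\<Sum>k=1..q (Suc n). of_real (a n k) * iexp (\<tau> (Suc n) * of_int (step_count (\<tau> (Suc n)) s) * \<omega> n k))
      = pa.disc_corr n g g s" for n s
    unfolding corr[symmetric] \<omega>_def using \<tau>[of n] by simp
  obtain L B where lip: "\<And>x y. \<bar>bump_kernel \<alpha> 0 x - bump_kernel \<alpha> 0 y\<bar> \<le> L * \<bar>x - y\<bar>"
    and bdd: "\<And>x. \<bar>bump_kernel \<alpha> 0 x\<bar> \<le> B"
    by (rule bump_kernel_C1[OF \<open>\<alpha> > 0\<close>]) (rule that; assumption)
  have "uniform_limit UNIV (\<lambda>n x. \<Sum>k=1..q (Suc n). a n k * bump_kernel \<alpha> 0 (x - \<omega> n k))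
      (\<lambda>x. LINT y|\<nu>. bump_kernel \<alpha> 0 (x - y)) sequentially"
  proof (rule atomic_convolution_uniform_limit[OF \<nu> _ \<tau> \<tau>_lim])
    show "a n k \<ge> 0" for n k by (simp add: a_def)
    show "\<bar>\<omega> n k\<bar> \<le> pi / \<tau> (Suc n)" if "k \<in> {1..q (Suc n)}" for n k
    proof -
      have "\<theta> (Suc n) k \<in> {-pi..<pi}" using basis[of n] that by (simp add: discrete_eigenbasis_def)
      then have "\<bar>\<theta> (Suc n) k\<bar> \<le> pi" by (auto simp: abs_le_iff)
      then show ?thesis using \<tau>[of n] by (simp add: \<omega>_def divide_right_mono)
    qed
    \<comment> \<open>At time zero all exponentials are 1, so the correlation is the total mass of
      the atoms.\<close>
    have "(\<lambda>n. Re (pa.disc_corr n g g 0)) \<longlonglongrightarrow> Re (inner_L2 M g g)"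
      by (intro tendsto_Re pa.disc_corr_tendsto_0 g)
    moreover have "Re (pa.disc_corr n g g 0) = (\<Sum>k=1..q (Suc n). a n k)" for n
      unfolding corr_step[symmetric] by (simp add: step_count_def)
    ultimately show "(\<lambda>n. \<Sum>k=1..q (Suc n). a n k) \<longlonglongrightarrow> measure \<nu> UNIV"
      by (simp add: inner_L2_self \<nu>_total)
    show "(\<lambda>n. LINT s:{-T..T}|lborel. cmod ((\<Sum>k=1..q (Suc n). of_real (a n k)
        * iexp (\<tau> (Suc n) * of_int (step_count (\<tau> (Suc n)) s) * \<omega> n k)) - (CLINT x|\<nu>. iexp (s * x)))) \<longlonglongrightarrow> 0"
      if "T > 0" for T
      unfolding corr_step char by (rule pa.disc_corr_tendsto_interval[OF g g that])
  qed (fact lip bdd)+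
  then have lim: "uniform_limit UNIV (\<lambda>n x. complex_of_real (\<Sum>k=1..q (Suc n). a n k * bump_kernel \<alpha> 0 (x - \<omega> n k)))
      (\<lambda>x. complex_of_real (LINT y|\<nu>. bump_kernel \<alpha> 0 (x - y))) sequentially"
    by (simp only: uniform_limit_iff dist_of_real)
  have discrete: "smoothed \<alpha> (discrete_spectral_density M (q (Suc n)) (v (Suc n)) (\<lambda>k. \<theta> (Suc n) k / \<tau> (Suc n))
      (averaging M (q (Suc n)) (P (Suc n)) g))
      = (\<lambda>x. complex_of_real (\<Sum>k=1..q (Suc n). a n k * bump_kernel \<alpha> 0 (x - \<omega> n k)))" for n
  proof
    fix x
    show "smoothed \<alpha> (discrete_spectral_density M (q (Suc n)) (v (Suc n)) (\<lambda>k. \<theta> (Suc n) k / \<tau> (Suc n))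
        (averaging M (q (Suc n)) (P (Suc n)) g)) x
      = complex_of_real (\<Sum>k=1..q (Suc n). a n k * bump_kernel \<alpha> 0 (x - \<omega> n k))"
      by (simp add: smoothed_def discrete_spectral_density_def delta_def a_def \<omega>_def bump_kernel_diff[of \<alpha> x])
  qed
  have continuous: "smoothed \<alpha> (spectral_density M E g) = (\<lambda>x. complex_of_real (LINT y|\<nu>. bump_kernel \<alpha> 0 (x - y)))"
    unfolding spectral_density_def
    by (rule ext, rule smoothed_distributional_derivative[OF \<open>\<alpha> > 0\<close> \<nu>]) (simp add: pvm_inner_self(1)[OF E _ g] \<nu>m)
  show ?thesis
    by (rule filterlim_sequentially_Suc[THEN iffD1]) (unfold discrete continuous, rule lim)
qed

end
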